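(* With the notation of the context, set $h_2(\lambda)=\sqrt{f(\lambda)}\,\dfrac{x_1^2}{\ell_1\ell_2}$ (evaluated at $x_0=\lambda x_1$, so that it depends only on $\lambda$), which is differentiable on $I_2\cup I_4$. Let $\lambda\in I_2\cup I_4$ and let $N$ denote the normal bundle of $L_\alpha^+$ in $Z$. Then either $N\simeq O(1)^{\oplus2}$ or $N\simeq O\oplus O(2)$, and the latter holds if and only if $\lambda$ is a critical point of $h_2$. The same claim holds for $L_\alpha^-$.
   Context: Fix real numbers $a,b>0$ and a real quadratic form $Q(y_0,y_1)$; put $f(\lambda)=\lambda(\lambda+1)(a\lambda-b)$. Assume: there is $\lambda_0\in\mathbf R$ such that $Q(\lambda,1)^2-f(\lambda)\ge0$ for all $\lambda\in\mathbf R$ with equality iff $\lambda=\lambda_0$, and $\lambda_0$ is a root of multiplicity two; and $Q(\lambda,1)>\sqrt{f(\lambda)}$ whenever $\lambda\in\mathbf R$, $f(\lambda)\ge0$, $\lambda\ne\lambda_0$; moreover $\lambda_0>b/a$ (as may be arranged by a projective transformation in $y_0,y_1$). Put $I_2=(-1,0)$, $I_4=(b/a,+\infty)$ (where $f>0$). $B\subset\mathbf{CP}^3$ is the quartic $(y_2y_3+Q(y_0,y_1))^2-y_0y_1(y_0+y_1)(ay_0-by_1)=0$; the real structure on $\mathbf{CP}^3$ is $\sigma(y_0:y_1:y_2:y_3)=(\overline y_0:\overline y_1:\overline y_3:\overline y_2)$; the singular points of $B$ are $P_\infty=(0:0:0:1)$, $\overline P_\infty=(0:0:1:0)$, $P_0=(\lambda_0:1:0:0)$.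 $\Phi_0:Z_0\to\mathbf{CP}^3$ is the double covering branched along $B$, $Z_0=\{z^2+(y_2y_3+Q)^2-y_0y_1(y_0+y_1)(ay_0-by_1)=0\}\subset O(2)$, with real structure $(y,z)\mapsto(\sigma(y),\overline z)$. Small resolutions: near $p_\infty=\Phi_0^{-1}(P_\infty)$ put $x_i=y_i/y_3$, $\xi=z+i(x_2+Q(x_0,x_1))$, $\eta=z-i(x_2+Q(x_0,x_1))$, so $Z_0:\ \xi\eta=x_0x_1(x_0+x_1)(ax_0-bx_1)$. Choose an ordered triple of distinct linear forms $\ell_1,\ell_2,\ell_3\in\{x_0,x_1,x_0+x_1,ax_0-bx_1\}$. Blow up successively along $\{\xi=\ell_1=0\}$ (with $\xi=u\ell_1$), $\{u=\ell_2=0\}$ (with $u=v\ell_2$), $\{v=\ell_3=0\}$ (with $v=w\ell_3$). This gives a small resolution of $p_\infty$; the conjugate point $\overline p_\infty$ is resolved correspondingly by reality, and the ordinary double point over $P_0$ by any small resolution; this gives $\mu:Z\to Z_0$ with $Z$ smooth; put $\Phi=\Phi_0\circ\mu$. For $\lambda\in I_2\cup I_4$ write $Q=Q(\lambda,1)$, $f=f(\lambda)$, and for real $\alpha\ne0$ with $-Q-\sqrt f\le\alpha\le-Q+\sqrt f$ let $C_\alpha\subset H_\lambda=\{y_0=\lambda y_1\}$ be the conic $y_2y_3=\alpha y_1^2$. Apart from the exceptional curves over $P_\infty,\overline P_\infty$, $\Phi^{-1}(C_\alpha)$ consists of the real smooth rational curves $L_\alpha^+$ and $L_\alpha^-$,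 mapped biholomorphically onto $C_\alpha$, given respectively by $z=\sqrt{f-(\alpha+Q)^2}\,x_1^2$ and $z=-\sqrt{f-(\alpha+Q)^2}\,x_1^2$ (proper transforms in $Z$). *)

theory Defs
  imports "HOL-Analysis.Analysis" "HOL-Computational_Algebra.Polynomial"
begin

type_synonym ('a, 'n) atlas = "('a set \<times> ('a \<Rightarrow> complex ^ 'n)) set"

text \<open>The real derivative \<^term>\<open>(*v) J\<close> of a complex matrix is complex linear, so this is
  complex differentiability in several variables.\<close>

definition holo_on :: "(complex ^ 'n::finite \<Rightarrow> complex ^ 'm::finite) \<Rightarrow> (complex ^ 'n) set \<Rightarrow> bool" where
  "holo_on f S \<longleftrightarrow> (\<forall>x\<in>S. \<exists>J. (f has_derivative (*v) J) (at x))"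

definition cjacobian :: "(complex ^ 'n::finite \<Rightarrow> complex ^ 'm::finite) \<Rightarrow> complex ^ 'n \<Rightarrow> complex ^ 'n ^ 'm" where
  "cjacobian f x = matrix (frechet_derivative f (at x))"

definition carrier_of :: "('a, 'n::finite) atlas \<Rightarrow> 'a set" where
  "carrier_of A = (\<Union>(U, \<phi>)\<in>A. U)"

definition holo_atlas :: "('a, 'n::finite) atlas \<Rightarrow> bool" where
  "holo_atlas A \<longleftrightarrow>
     (\<forall>(U, \<phi>)\<in>A. inj_on \<phi> U \<and> open (\<phi> ` U)) \<and>
     (\<forall>(U, \<phi>)\<in>A. \<forall>(V, \<psi>)\<in>A.
        open (\<phi> ` (U \<inter> V)) \<and> holo_on (\<psi> \<circ> inv_into U \<phi>) (\<phi> ` (U \<inter> V)))"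

definition atlas_topology :: "('a, 'n::finite) atlas \<Rightarrow> 'a topology" where
  "atlas_topology A = topology_generated_by {{p \<in> U. \<phi> p \<in> S} |U \<phi> S. (U, \<phi>) \<in> A \<and> open S}"

definition complex_manifold :: "('a, 'n::finite) atlas \<Rightarrow> bool" where
  "complex_manifold A \<longleftrightarrow> holo_atlas A \<and>
     Hausdorff_space (atlas_topology A) \<and> second_countable (atlas_topology A)"

text \<open>The charts of the maximal atlas.\<close>

definition compatible_charts :: "('a, 'n::finite) atlas \<Rightarrow> ('a, 'n) atlas" where
  "compatible_charts A = {c. fst c \<subseteq> carrier_of A \<and> holo_atlas (insert c A)}"

definition restrict_atlas :: "('a, 'n::finite) atlas \<Rightarrow> 'a set \<Rightarrow> ('a, 'n) atlas" where
  "restrict_atlas A W = {(U \<inter> W, \<phi>) |U \<phi>. (U, \<phi>) \<in> A}"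

definition conj_atlas :: "('a, 'n::finite) atlas \<Rightarrow> ('a, 'n) atlas" where
  "conj_atlas A = {(U, \<lambda>p. \<chi> i. cnj (\<phi> p $ i)) |U \<phi>. (U, \<phi>) \<in> A}"

definition prod_atlas :: "('a, 'n::finite) atlas \<Rightarrow> ('b, 'm::finite) atlas \<Rightarrow> ('a \<times> 'b, 'n + 'm) atlas" where
  "prod_atlas A B =
     {(U \<times> V, \<lambda>(p, q). \<chi> i. case i of Inl j \<Rightarrow> \<phi> p $ j | Inr k \<Rightarrow> \<psi> q $ k) |U \<phi> V \<psi>.
        (U, \<phi>) \<in> A \<and> (V, \<psi>) \<in> B}"

definition holo_map :: "('a, 'n::finite) atlas \<Rightarrow> ('b, 'm::finite) atlas \<Rightarrow> ('a \<Rightarrow> 'b) \<Rightarrow> bool" where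
  "holo_map A B f \<longleftrightarrow> continuous_map (atlas_topology A) (atlas_topology B) f \<and>
     (\<forall>(U, \<phi>)\<in>A. \<forall>(V, \<psi>)\<in>B. holo_on (\<psi> \<circ> f \<circ> inv_into U \<phi>) (\<phi> ` {p \<in> U. f p \<in> V}))"

definition biholomorphic :: "('a, 'n::finite) atlas \<Rightarrow> ('b, 'm::finite) atlas \<Rightarrow> ('a \<Rightarrow> 'b) \<Rightarrow> bool" where
  "biholomorphic A B f \<longleftrightarrow> bij_betw f (carrier_of A) (carrier_of B) \<and>
     holo_map A B f \<and> holo_map B A (inv_into (carrier_of A) f)"

text \<open>Holomorphic immersions that are homeomorphisms onto their image, i.e. biholomorphic maps
  onto a complex submanifold of the target.\<close>

definition holo_embedding :: "('a, 'n::finite) atlas \<Rightarrow> ('b, 'm::finite) atlas \<Rightarrow> ('a \<Rightarrow> 'b) \<Rightarrow> bool" where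
  "holo_embedding A B f \<longleftrightarrow> holo_map A B f \<and>
     (\<forall>(U, \<phi>)\<in>A. \<forall>(V, \<psi>)\<in>B. \<forall>p\<in>U. f p \<in> V \<longrightarrow>
        inj ((*v) (cjacobian (\<psi> \<circ> f \<circ> inv_into U \<phi>) (\<phi> p)))) \<and>
     embedding_map (atlas_topology A) (atlas_topology B) f"

text \<open>The fibre coordinates over \<^term>\<open>bdom E i \<inter> bdom E j\<close> are related by
  \<open>e\<^sub>i = btrans E i j p *v e\<^sub>j\<close>.\<close>

record ('i, 'a, 'r) vbundle =
  bindex :: "'i set"
  bdom :: "'i \<Rightarrow> 'a set"
  btrans :: "'i \<Rightarrow> 'i \<Rightarrow> 'a \<Rightarrow> complex ^ 'r ^ 'r"

definition holo_matrix_on ::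
  "('a, 'n::finite) atlas \<Rightarrow> ('a \<Rightarrow> complex ^ 'r::finite ^ 's::finite) \<Rightarrow> 'a set \<Rightarrow> bool" where
  "holo_matrix_on A g D \<longleftrightarrow>
     (\<forall>(U, \<phi>)\<in>A. \<forall>c. holo_on (\<lambda>x. (\<chi> r. g (inv_into U \<phi> x) $ r $ c)) (\<phi> ` (U \<inter> D)))"

definition holo_bundle :: "('a, 'n::finite) atlas \<Rightarrow> ('i, 'a, 'r::finite) vbundle \<Rightarrow> bool" where
  "holo_bundle A E \<longleftrightarrow>
     (\<Union>i\<in>bindex E. bdom E i) = carrier_of A \<and>
     (\<forall>i\<in>bindex E. openin (atlas_topology A) (bdom E i)) \<and>
     (\<forall>i\<in>bindex E. \<forall>j\<in>bindex E.
        holo_matrix_on A (btrans E i j) (bdom E i \<inter> bdom E j) \<and>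
        (\<forall>p\<in>bdom E i \<inter> bdom E j. invertible (btrans E i j p))) \<and>
     (\<forall>i\<in>bindex E. \<forall>j\<in>bindex E. \<forall>k\<in>bindex E. \<forall>p\<in>bdom E i \<inter> bdom E j \<inter> bdom E k.
        btrans E i j p ** btrans E j k p = btrans E i k p)"

definition bundle_iso ::
  "('a, 'n::finite) atlas \<Rightarrow> ('i, 'a, 'r::finite) vbundle \<Rightarrow> ('j, 'a, 'r) vbundle \<Rightarrow> bool" where
  "bundle_iso A E F \<longleftrightarrow> holo_bundle A E \<and> holo_bundle A F \<and>
     (\<exists>h. (\<forall>i\<in>bindex E. \<forall>k\<in>bindex F.
             holo_matrix_on A (h i k) (bdom E i \<inter> bdom F k) \<and>
             (\<forall>p\<in>bdom E i \<inter> bdom F k. invertible (h i k p))) \<and>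
          (\<forall>i\<in>bindex E. \<forall>j\<in>bindex E. \<forall>k\<in>bindex F. \<forall>l\<in>bindex F.
             \<forall>p\<in>bdom E i \<inter> bdom E j \<inter> bdom F k \<inter> bdom F l.
               btrans E i j p ** h j l p = h i k p ** btrans F k l p))"

definition pullback_bundle ::
  "('b, 'm::finite) atlas \<Rightarrow> ('b \<Rightarrow> 'a) \<Rightarrow> ('i, 'a, 'r::finite) vbundle \<Rightarrow> ('i, 'b, 'r) vbundle" where
  "pullback_bundle B f E =
     \<lparr>bindex = bindex E, bdom = (\<lambda>i. {q \<in> carrier_of B. f q \<in> bdom E i}),
      btrans = (\<lambda>i j q. btrans E i j (f q))\<rparr>"

text \<open>Charts \<open>(w\<^sub>1, w\<^sub>2, w\<^sub>3)\<close> of a threefold in which the curve is \<open>w\<^sub>2 = w\<^sub>3 = 0\<close>.  The classes of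
  \<open>\<partial>/\<partial>w\<^sub>2, \<partial>/\<partial>w\<^sub>3\<close> are a frame of \<open>N = TZ|\<^sub>L / TL\<close>, and the matrix of the change of frame is the
  corresponding block of the Jacobian matrix of the change of charts.\<close>

definition adapted_charts :: "('a, 3) atlas \<Rightarrow> 'a set \<Rightarrow> ('a, 3) atlas" where
  "adapted_charts A L =
     {(U, \<phi>) \<in> compatible_charts A. L \<inter> U = {p \<in> U. \<phi> p $ 2 = 0 \<and> \<phi> p $ 3 = 0}}"

definition normal_index :: "2 \<Rightarrow> 3" where
  "normal_index i = (if i = 1 then 2 else 3)"

definition normal_bundle ::
  "('a, 3) atlas \<Rightarrow> 'a set \<Rightarrow> ('a set \<times> ('a \<Rightarrow> complex ^ 3), 'a, 2) vbundle" where
  "normal_bundle A L =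
     \<lparr>bindex = adapted_charts A L,
      bdom = (\<lambda>c. L \<inter> fst c),
      btrans = (\<lambda>c d p. \<chi> i j.
        cjacobian (snd c \<circ> inv_into (fst d) (snd d)) (snd d p) $ normal_index i $ normal_index j)\<rparr>"

text \<open>The point \<open>(s : t)\<close> is the punctured complex line through \<open>(s, t)\<close>.\<close>

type_synonym cp1 = "(complex \<times> complex) set"

definition cp1_pt :: "complex \<Rightarrow> complex \<Rightarrow> cp1" where
  "cp1_pt s t = {(c * s, c * t) |c. c \<noteq> 0}"

definition CP1 :: "(cp1, 1) atlas" where
  "CP1 = (\<lambda>\<psi>. (range \<psi>, inv \<psi>)) ` {\<lambda>x. cp1_pt (x $ 1) 1, \<lambda>x. cp1_pt 1 (x $ 1)}"

text \<open>The direct sum of the \<open>O(d r)\<close>.  The trivialisations are indexed by the two homogeneous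
  coordinates; that of \<open>O(k)\<close> where the coordinate \<open>i\<close> is nonzero sends a homogeneous \<open>F\<close> of
  degree \<open>k\<close> to \<open>F / i\<^sup>k\<close>.\<close>

definition split_bundle :: "('r::finite \<Rightarrow> int) \<Rightarrow> (complex \<times> complex \<Rightarrow> complex, cp1, 'r) vbundle" where
  "split_bundle d =
     \<lparr>bindex = {fst, snd},
      bdom = (\<lambda>i. {P \<in> carrier_of CP1. \<exists>y\<in>P. i y \<noteq> 0}),
      btrans = (\<lambda>i j P. let y = (SOME y. y \<in> P) in
        \<chi> r c. if r = c then (j y / i y) powi d r else 0)\<rparr>"

text \<open>\<open>L\<close> is a smooth rational curve whose normal bundle is isomorphic to
  \<open>O(d 1) \<oplus> O(d 2)\<close>.\<close>

definition normal_bundle_iso_split :: "('a, 3) atlas \<Rightarrow> 'a set \<Rightarrow> (2 \<Rightarrow> int) \<Rightarrow> bool" where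
  "normal_bundle_iso_split A L d \<longleftrightarrow>
     (\<exists>\<theta>. holo_embedding CP1 A \<theta> \<and> \<theta> ` carrier_of CP1 = L \<and>
          bundle_iso CP1 (pullback_bundle CP1 \<theta> (normal_bundle A L)) (split_bundle d))"

text \<open>Points of the total space of \<open>O(2)\<close> over \<open>\<bbbC>\<bbbP>\<^sup>3\<close>, as orbits \<open>(y : z)\<close> of weight
  \<open>(1, 1, 1, 1; 2)\<close>.  The homogeneous coordinates \<open>y\<^sub>0, \<dots>, y\<^sub>3\<close> are indexed by the type 4
  (in which 4 = 0).\<close>

type_synonym o2 = "((complex ^ 4) \<times> complex) set"

definition o2_pt :: "complex ^ 4 \<Rightarrow> complex \<Rightarrow> o2" where
  "o2_pt y z = {(c *s y, c\<^sup>2 * z) |c. c \<noteq> 0}"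

definition hom4 :: "complex \<Rightarrow> complex \<Rightarrow> complex \<Rightarrow> complex \<Rightarrow> complex ^ 4" where
  "hom4 y0 y1 y2 y3 = (\<chi> i. if i = 0 then y0 else if i = 1 then y1 else if i = 2 then y2 else y3)"

text \<open>Affine coordinates where \<open>y\<^sub>k \<noteq> 0\<close>: the \<open>y\<^sub>i / y\<^sub>k\<close> for \<open>i \<noteq> k\<close>, and \<open>z / y\<^sub>k\<^sup>2\<close> in the
  \<open>k\<close>-th place.\<close>

definition o2_param :: "4 \<Rightarrow> complex ^ 4 \<Rightarrow> o2" where
  "o2_param k x = o2_pt (\<chi> i. if i = k then 1 else x $ i) (x $ k)"

definition O2 :: "(o2, 4) atlas" where
  "O2 = (\<lambda>k. (range (o2_param k), inv (o2_param k))) ` UNIV"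

definition qform :: "real \<times> real \<times> real \<Rightarrow> 'a \<Rightarrow> 'a \<Rightarrow> 'a::real_algebra_1" where
  "qform Q y0 y1 =
     (case Q of (q0, q1, q2) \<Rightarrow> of_real q0 * y0\<^sup>2 + of_real q1 * y0 * y1 + of_real q2 * y1\<^sup>2)"

definition ffun :: "real \<Rightarrow> real \<Rightarrow> real \<Rightarrow> real" where
  "ffun a b t = t * (t + 1) * (a * t - b)"

definition Z0 :: "real \<Rightarrow> real \<Rightarrow> real \<times> real \<times> real \<Rightarrow> o2 set" where
  "Z0 a b Q = {o2_pt y z |y z. y \<noteq> 0 \<and>
     z\<^sup>2 + (y $ 2 * y $ 3 + qform Q (y $ 0) (y $ 1))\<^sup>2
       - y $ 0 * y $ 1 * (y $ 0 + y $ 1) * (of_real a * y $ 0 - of_real b * y $ 1) = 0}"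

definition real_structure :: "o2 \<Rightarrow> o2" where
  "real_structure P =
     (\<lambda>(y, z). (hom4 (cnj (y $ 0)) (cnj (y $ 1)) (cnj (y $ 3)) (cnj (y $ 2)), cnj z)) ` P"

definition p_infty :: o2 where
  "p_infty = o2_pt (hom4 0 0 0 1) 0"

definition p_infty_bar :: o2 where
  "p_infty_bar = o2_pt (hom4 0 0 1 0) 0"

definition p_zero :: "real \<Rightarrow> o2" where
  "p_zero lam0 = o2_pt (hom4 (of_real lam0) 1 0 0) 0"

text \<open>A binary linear form is given by its pair of coefficients.\<close>

definition lform :: "real \<times> real \<Rightarrow> 'a \<Rightarrow> 'a \<Rightarrow> 'a::real_algebra_1" where
  "lform l x0 x1 = of_real (fst l) * x0 + of_real (snd l) * x1"

definition four_forms :: "real \<Rightarrow> real \<Rightarrow> (real \<times> real) set" where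
  "four_forms a b = {(1, 0), (0, 1), (1, 1), (a, - b)}"

definition xi_coord :: "real \<times> real \<times> real \<Rightarrow> o2 \<Rightarrow> complex" where
  "xi_coord Q P = (let x = inv (o2_param 3) P in x $ 3 + \<i> * (x $ 2 + qform Q (x $ 0) (x $ 1)))"

definition lform_coord :: "real \<times> real \<Rightarrow> o2 \<Rightarrow> complex" where
  "lform_coord l P = (let x = inv (o2_param 3) P in lform l (x $ 0) (x $ 1))"

text \<open>The blow-up of \<open>X\<close> along \<open>{m = l = 0}\<close>, as the closure in \<open>X \<times> \<bbbC>\<bbbP>\<^sup>1\<close> of the graph of
  \<open>(m : l)\<close>.  The function \<open>m\<close> may take the value \<open>(1 : 0)\<close>, i.e. infinity; for
  \<open>m = (m\<^sub>0 : m\<^sub>1)\<close> one has \<open>(m : l) = (m\<^sub>0 : m\<^sub>1 l)\<close>.\<close>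

definition blow_up ::
  "'a topology \<Rightarrow> 'a set \<Rightarrow> ('a \<Rightarrow> cp1) \<Rightarrow> ('a \<Rightarrow> complex) \<Rightarrow> ('a \<times> cp1) set" where
  "blow_up T X m l = (X \<times> carrier_of CP1) \<inter>
     (prod_topology T (atlas_topology CP1) closure_of
        {(p, cp1_pt m0 (m1 * l p)) |p m0 m1.
           p \<in> X \<and> (m0, m1) \<noteq> (0, 0) \<and> m p = cp1_pt m0 m1 \<and> (m0, m1 * l p) \<noteq> (0, 0)})"

text \<open>The successive blow-ups, with new coordinates \<open>u = \<xi> / l1\<close>, \<open>v = u / l2\<close>, \<open>w = v / l3\<close>.
  They are carried out over all of \<open>{y\<^sub>3 \<noteq> 0}\<close>: the equation \<open>\<xi>\<eta> = x\<^sub>0x\<^sub>1(x\<^sub>0 + x\<^sub>1)(ax\<^sub>0 - bx\<^sub>1)\<close> holds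
  there, and the blow-ups change nothing outside \<open>p_infty\<close>.\<close>

definition resolution_model ::
  "real \<Rightarrow> real \<Rightarrow> real \<times> real \<times> real \<Rightarrow> real \<times> real \<Rightarrow> real \<times> real \<Rightarrow> real \<times> real \<Rightarrow>
    (((o2 \<times> cp1) \<times> cp1) \<times> cp1) set" where
  "resolution_model a b Q l1 l2 l3 =
     (let T0 = atlas_topology O2;
          T1 = prod_topology T0 (atlas_topology CP1);
          T2 = prod_topology T1 (atlas_topology CP1);
          X0 = Z0 a b Q \<inter> range (o2_param 3);
          X1 = blow_up T0 X0 (\<lambda>P. cp1_pt (xi_coord Q P) 1) (lform_coord l1);
          X2 = blow_up T1 X1 snd (lform_coord l2 \<circ> fst)
      in blow_up T2 X2 snd (lform_coord l3 \<circ> fst \<circ> fst))"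

text \<open>\<open>\<mu> : Z \<rightarrow> Z\<^sub>0\<close> is one of the small resolutions under consideration, where \<open>Z\<close> is the threefold
  with atlas \<open>A\<close>.  Over \<open>{y\<^sub>2 \<noteq> 0}\<close> it is the complex conjugate of the one over \<open>{y\<^sub>3 \<noteq> 0}\<close>; the
  node \<open>p_zero lam0\<close> is replaced by a smooth rational curve in an arbitrary way.\<close>

definition small_resolution ::
  "real \<Rightarrow> real \<Rightarrow> real \<times> real \<times> real \<Rightarrow> real \<Rightarrow> real \<times> real \<Rightarrow> real \<times> real \<Rightarrow> real \<times> real \<Rightarrow>
    ('z, 3) atlas \<Rightarrow> ('z \<Rightarrow> o2) \<Rightarrow> bool" where
  "small_resolution a b Q lam0 l1 l2 l3 A \<mu> \<longleftrightarrow>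
     (let over = (\<lambda>W. {p \<in> carrier_of A. \<mu> p \<in> W});
          A3 = restrict_atlas A (over (range (o2_param 3)));
          A2 = restrict_atlas A (over (range (o2_param 2)))
      in complex_manifold A \<and>
         holo_map A O2 \<mu> \<and>
         \<mu> ` carrier_of A = Z0 a b Q \<and>
         proper_map (atlas_topology A) (subtopology (atlas_topology O2) (Z0 a b Q)) \<mu> \<and>
         holo_embedding
           (restrict_atlas A (over (- {p_infty, p_infty_bar, p_zero lam0}))) O2 \<mu> \<and>
         (\<exists>\<kappa>. holo_embedding A3 (prod_atlas (prod_atlas (prod_atlas O2 CP1) CP1) CP1) \<kappa> \<and>
              \<kappa> ` carrier_of A3 = resolution_model a b Q l1 l2 l3 \<and>
              (\<forall>p\<in>carrier_of A3. fst (fst (fst (\<kappa> p))) = \<mu> p)) \<and>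
         (\<exists>\<tau>. biholomorphic (conj_atlas A3) A2 \<tau> \<and>
              (\<forall>p\<in>carrier_of A3. \<mu> (\<tau> p) = real_structure (\<mu> p))) \<and>
         (\<exists>\<theta>. holo_embedding CP1 A \<theta> \<and> \<theta> ` carrier_of CP1 = over {p_zero lam0}))"

text \<open>The curve \<open>z = s \<surd>(f - (\<alpha> + Q)\<^sup>2) y\<^sub>1\<^sup>2\<close> over the conic \<open>y\<^sub>0 = lam y\<^sub>1\<close>, \<open>y\<^sub>2y\<^sub>3 = \<alpha>y\<^sub>1\<^sup>2\<close>
  for a sign \<open>s\<close>.\<close>

definition L_image ::
  "real \<Rightarrow> real \<Rightarrow> real \<times> real \<times> real \<Rightarrow> real \<Rightarrow> real \<Rightarrow> real \<Rightarrow> o2 set" where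
  "L_image a b Q s lam \<alpha> = {o2_pt y z |y z. y \<noteq> 0 \<and>
     y $ 0 = of_real lam * y $ 1 \<and> y $ 2 * y $ 3 = of_real \<alpha> * (y $ 1)\<^sup>2 \<and>
     z = of_real (s * sqrt (ffun a b lam - (\<alpha> + qform Q lam 1)\<^sup>2)) * (y $ 1)\<^sup>2}"

definition L_curve ::
  "real \<Rightarrow> real \<Rightarrow> real \<times> real \<times> real \<Rightarrow> ('z, 3) atlas \<Rightarrow> ('z \<Rightarrow> o2) \<Rightarrow>
    real \<Rightarrow> real \<Rightarrow> real \<Rightarrow> 'z set" where
  "L_curve a b Q A \<mu> s lam \<alpha> = atlas_topology A closure_of
     {p \<in> carrier_of A. \<mu> p \<in> L_image a b Q s lam \<alpha> - {p_infty, p_infty_bar}}"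

definition h2 :: "real \<Rightarrow> real \<Rightarrow> real \<times> real \<Rightarrow> real \<times> real \<Rightarrow> real \<Rightarrow> real" where
  "h2 a b l1 l2 t = sqrt (ffun a b t) / (lform l1 t 1 * lform l2 t 1)"

end

theory Submission
  imports Defs "HOL-Complex_Analysis.Conformal_Mappings"
begin

text \<open>Write \<open>l\<^sub>4\<close> for the remaining linear form.  Near \<open>L = L\<^sub>\<alpha>\<^sup>\<plusminus>\<close> the resolution has the
  coordinates \<open>(x\<^sub>0, x\<^sub>1, v)\<close> over \<open>y\<^sub>3 \<noteq> 0\<close>, where \<open>\<xi> = v l\<^sub>1 l\<^sub>2\<close> and \<open>\<eta> = l\<^sub>3 l\<^sub>4 / v\<close>, and the
  conjugate ones over \<open>y\<^sub>2 \<noteq> 0\<close>; along \<open>L\<close> the coordinate \<open>v\<close> is a constant \<open>v0 \<noteq> 0\<close>.  The two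
  charts are related by \<open>(x\<^sub>0, x\<^sub>1, v) \<mapsto> (x\<^sub>0 / x\<^sub>2, x\<^sub>1 / x\<^sub>2, l\<^sub>3 l\<^sub>4 / (v l\<^sub>1 l\<^sub>2))\<close>, so with \<open>x = x\<^sub>1\<close> on \<open>L\<close>
  the transition matrix of the normal bundle is upper triangular with rows \<open>(a, b / x)\<close> and
  \<open>(0, c / x\<^sup>2)\<close>.  Here \<open>a\<close> and \<open>c\<close> are nonzero constants and \<open>b = H'(lam) / v0\<close> for
  \<open>H = l\<^sub>3 l\<^sub>4 / (l\<^sub>1 l\<^sub>2) = h\<^sub>2\<^sup>2\<close>.  If \<open>b = 0\<close> this is \<open>O \<oplus> O(2)\<close>, if \<open>b \<noteq> 0\<close> it is \<open>O(1) \<oplus> O(1)\<close>,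
  and in the latter case Liouville's theorem excludes \<open>O \<oplus> O(2)\<close>.\<close>

section \<open>Complex differentiability in several variables\<close>

text \<open>The constancy of \<open>v\<close> on \<open>L\<close> comes from the parametrisation by
  \<open>x = x1\<close>: there \<open>x2 = \<alpha> x^2\<close> and \<open>z = r x^2\<close>, with
  \<open>r\<close> the signed square root of \<open>f - (\<alpha> + Q)^2\<close>. So
  \<open>\<xi> = g x^2\<close> for \<open>g = r + i (\<alpha> + Q)\<close>, and \<open>l1 l2\<close>
  is a constant multiple of \<open>x^2\<close> as well. Since \<open>|g|^2 = f > 0\<close>, the
  constant is nonzero. The entry \<open>b\<close> is a derivative of \<open>H\<close> because a
  displacement \<open>t\<close> of the normal coordinate \<open>x0 - lam x1\<close> at
  \<open>x\<close> moves the slope \<open>x0 / x1\<close> to \<open>lam + t / x\<close>.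

  Two features of the definitions shape the work. The normal bundle is trivialised by every adapted
  chart of the maximal atlas, while holomorphy means only pointwise complex differentiability:
  holomorphic dependence of Jacobian entries has to be derived, and an isomorphism found in two
  charts has to be spread to all of them. Secondly, the splitting type quantifies over all
  embeddings with image \<open>L\<close>, so the exclusion of \<open>O + O(2)\<close> must work
  through the inverse of an arbitrary embedding.\<close>

abbreviation holo_at :: "(complex ^ 'n::finite \<Rightarrow> complex ^ 'm::finite) \<Rightarrow> complex ^ 'n \<Rightarrow> bool" where
  "holo_at f x \<equiv> \<exists>J. (f has_derivative (*v) J) (at x)"

text \<open>Scalar version of \<open>holo_at\<close>, for which sum, product and quotient rules are
  available. Additivity of the derivative is part of \<open>has_derivative\<close>, so only complex
  homogeneity is recorded.\<close>

definition cdiff :: "(complex ^ 'n::finite \<Rightarrow> complex) \<Rightarrow> complex ^ 'n \<Rightarrow> bool" where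
  "cdiff g x \<longleftrightarrow> (\<exists>D. (g has_derivative D) (at x) \<and> (\<forall>c h. D (c *s h) = c * D h))"

lemma cdiffI: "(g has_derivative D) (at x) \<Longrightarrow> (\<And>c h. D (c *s h) = c * D h) \<Longrightarrow> cdiff g x"
  unfolding cdiff_def by blast

lemma cdiffE:
  assumes "cdiff g x"
  obtains D where "(g has_derivative D) (at x)" "\<And>c h. D (c *s h) = c * D h"
  using assms unfolding cdiff_def by blast

lemma bounded_linear_matrix_vector: "bounded_linear ((*v) (J :: complex ^ 'n::finite ^ 'm::finite))"
  by (simp add: linear_conv_bounded_linear[symmetric])

lemma norm_axis: "norm (axis i (z::complex) :: complex ^ 'n::finite) = norm z"
proof -
  have "(\<Sum>j\<in>UNIV. (norm ((axis i z :: complex ^ 'n) $ j))\<^sup>2) = (\<Sum>j\<in>UNIV. if j = i then (norm z)\<^sup>2 else 0)"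
    by (intro sum.cong) (auto simp: axis_def)
  then show ?thesis
    by (simp add: norm_vec_def L2_set_def)
qed

text \<open>A vector is the sum of its components times coordinate axes, so the rules for finite
  sums and bounded linear maps suffice.\<close>

lemma vec_has_derivative:
  fixes f :: "'a::real_normed_vector \<Rightarrow> complex ^ 'n::finite"
  assumes "\<And>i. ((\<lambda>x. f x $ i) has_derivative (\<lambda>h. f' h $ i)) (at x)"
  shows "(f has_derivative f') (at x)"
proof -
  have ax: "bounded_linear (\<lambda>z::complex. axis i z :: complex ^ 'n)" for i
  proof (rule bounded_linear_intro[where K = 1])
    show "norm (axis i x :: complex ^ 'n) \<le> norm x * 1" for x :: complex
      by (simp add: norm_axis)
  qed (auto simp: axis_def vec_eq_iff)
  have "((\<lambda>x. \<Sum>i\<in>UNIV. axis i (f x $ i)) has_derivative (\<lambda>h. \<Sum>i\<in>UNIV. axis i (f' h $ i))) (at x)"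
    by (intro has_derivative_sum bounded_linear.has_derivative[OF ax] assms)
  moreover have "(\<Sum>i\<in>UNIV. axis i (v $ i)) = v" for v :: "complex ^ 'n"
    by (simp add: vec_eq_iff axis_def if_distrib cong: if_cong)
  ultimately show ?thesis
    by simp
qed

lemma has_derivative_vec_nth:
  "(f has_derivative f') F \<Longrightarrow> ((\<lambda>x. f x $ i) has_derivative (\<lambda>h. f' h $ i)) F"
  by (rule bounded_linear.has_derivative[OF bounded_linear_vec_nth])

text \<open>Complex homogeneous component derivatives assemble into a complex linear map, and such a
  map is multiplication by its matrix. Holomorphy is checked through this criterion
  throughout.\<close>

lemma holo_at_iff:
  fixes f :: "complex ^ 'n::finite \<Rightarrow> complex ^ 'm::finite"
  shows "holo_at f x \<longleftrightarrow> (\<forall>i. cdiff (\<lambda>x. f x $ i) x)"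
proof
  assume "holo_at f x"
  then obtain J where J: "(f has_derivative (*v) J) (at x)" by blast
  show "\<forall>i. cdiff (\<lambda>x. f x $ i) x"
    using has_derivative_vec_nth[OF J]
    by (intro allI cdiffI) (auto simp: vector_scalar_commute)
next
  assume "\<forall>i. cdiff (\<lambda>x. f x $ i) x"
  then have "\<forall>i. \<exists>D. ((\<lambda>x. f x $ i) has_derivative D) (at x) \<and> (\<forall>c h. D (c *s h) = c * D h)"
    unfolding cdiff_def .
  then obtain D where D: "\<And>i. ((\<lambda>x. f x $ i) has_derivative D i) (at x)"
    "\<And>i c h. D i (c *s h) = c * D i h" by metis
  define D' where "D' = (\<lambda>h. \<chi> i. D i h)"
  have d: "(f has_derivative D') (at x)"
    by (rule vec_has_derivative) (simp add: D'_def D)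
  have "D' (u + v) = D' u + D' v" for u v
    using has_derivative_linear[OF d] by (simp add: linear_add)
  moreover have "D' (c *s v) = c *s D' v" for c v
    by (simp add: D'_def D vec_eq_iff)
  ultimately have "Vector_Spaces.linear (*s) (*s) D'"
    by unfold_locales auto
  then have "D' = (*v) (matrix D')"
    by (auto simp: matrix_works)
  then show "holo_at f x" using d by metis
qed

lemma holo_atI: "(\<And>i. cdiff (\<lambda>x. f x $ i) x) \<Longrightarrow> holo_at f x"
  by (simp add: holo_at_iff)

lemma cdiff_nth_holo: "holo_at f x \<Longrightarrow> cdiff (\<lambda>x. f x $ i) x"
  by (simp add: holo_at_iff)

lemma cdiff_const [intro, simp]: "cdiff (\<lambda>x. c) x"
  by (rule cdiffI[OF has_derivative_const]) simp

lemma cdiff_nth [intro, simp]: "cdiff (\<lambda>x. x $ i) x"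
  by (rule cdiffI[OF has_derivative_vec_nth[OF has_derivative_ident]]) simp

lemma cdiff_add [intro]: "cdiff f x \<Longrightarrow> cdiff g x \<Longrightarrow> cdiff (\<lambda>x. f x + g x) x"
  by (elim cdiffE, rule cdiffI, rule has_derivative_add, assumption+) (auto simp: algebra_simps)

lemma cdiff_diff [intro]: "cdiff f x \<Longrightarrow> cdiff g x \<Longrightarrow> cdiff (\<lambda>x. f x - g x) x"
  by (elim cdiffE, rule cdiffI, rule has_derivative_diff, assumption+) (auto simp: algebra_simps)

lemma cdiff_mult [intro]: "cdiff f x \<Longrightarrow> cdiff g x \<Longrightarrow> cdiff (\<lambda>x. f x * g x) x"
  by (elim cdiffE, rule cdiffI, rule has_derivative_mult, assumption+) (auto simp: algebra_simps)

lemma cdiff_power [intro]: "cdiff f x \<Longrightarrow> cdiff (\<lambda>x. f x ^ n) x"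
  by (induction n) auto

lemma cdiff_inverse: "cdiff f x \<Longrightarrow> f x \<noteq> 0 \<Longrightarrow> cdiff (\<lambda>x. inverse (f x)) x"
  by (elim cdiffE, rule cdiffI, rule Deriv.has_derivative_inverse, assumption+) (auto simp: algebra_simps)

lemma cdiff_divide [intro]: "cdiff f x \<Longrightarrow> cdiff g x \<Longrightarrow> g x \<noteq> 0 \<Longrightarrow> cdiff (\<lambda>x. f x / g x) x"
  unfolding divide_inverse by (intro cdiff_mult cdiff_inverse)

lemma cdiff_compose: "cdiff g (f x) \<Longrightarrow> holo_at f x \<Longrightarrow> cdiff (\<lambda>x. g (f x)) x"
  by (elim cdiffE exE, rule cdiffI, rule has_derivative_compose, assumption+)
    (simp add: vector_scalar_commute)

lemma holo_at_compose: "holo_at g (f x) \<Longrightarrow> holo_at f x \<Longrightarrow> holo_at (\<lambda>x. g (f x)) x"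
  by (rule holo_atI, rule cdiff_compose[where f = f], rule cdiff_nth_holo[of g])

lemma cdiff_field:
  assumes "g field_differentiable at (w $ i)"
  shows "cdiff (\<lambda>w. g (w $ i)) w"
proof -
  obtain d where d: "(g has_derivative (*) d) (at (w $ i))"
    using assms unfolding field_differentiable_def has_field_derivative_def by blast
  show ?thesis
    by (rule cdiffI[OF has_derivative_compose[OF has_derivative_vec_nth[OF has_derivative_ident] d]])
      (simp add: algebra_simps)
qed

lemma holo_at_cong:
  assumes "holo_at f x" "open S" "x \<in> S" "\<And>y. y \<in> S \<Longrightarrow> f y = g y"
  shows "holo_at g x"
proof -
  obtain J where "(f has_derivative (*v) J) (at x)" using assms(1) by blast
  from has_derivative_transform_within_open[OF this assms(2,3)] assms(4) show ?thesis by blast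
qed

lemma holo_at_isCont: "holo_at f x \<Longrightarrow> isCont f x"
  using has_derivative_continuous by blast

lemma holo_on_iff: "holo_on f S \<longleftrightarrow> (\<forall>x\<in>S. holo_at f x)"
  by (simp add: holo_on_def)

lemma holo_on_continuous: "holo_on f S \<Longrightarrow> continuous_on S f"
  unfolding holo_on_def by (meson continuous_at_imp_continuous_on has_derivative_continuous)

lemma cjacobian_eq: "(f has_derivative (*v) J) (at x) \<Longrightarrow> cjacobian f x = J"
  unfolding cjacobian_def by (metis frechet_derivative_at matrix_of_matrix_vector_mul)

lemma cjacobian_has_derivative: "holo_at f x \<Longrightarrow> (f has_derivative (*v) (cjacobian f x)) (at x)"
  using cjacobian_eq by blast

lemma cjacobian_cong:
  assumes "holo_at f x" "open S" "x \<in> S" "\<And>y. y \<in> S \<Longrightarrow> f y = g y"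
  shows "cjacobian g x = cjacobian f x"
  by (rule cjacobian_eq, rule has_derivative_transform_within_open[OF cjacobian_has_derivative])
    (use assms in auto)

lemma cjacobian_compose:
  assumes "holo_at f x" "holo_at g (f x)"
  shows "cjacobian (\<lambda>x. g (f x)) x = cjacobian g (f x) ** cjacobian f x"
  by (intro cjacobian_eq has_derivative_eq_rhs[OF has_derivative_compose[OF
        cjacobian_has_derivative[OF assms(1)] cjacobian_has_derivative[OF assms(2)]]])
    (simp add: matrix_vector_mul_assoc fun_eq_iff)

lemma cjacobian_ident: "cjacobian (\<lambda>x. x) x = mat 1"
  by (intro cjacobian_eq has_derivative_eq_rhs[OF has_derivative_ident]) (simp add: fun_eq_iff)

section \<open>Reduction to one variable, and holomorphic dependence of the Jacobian matrix\<close>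

lemma holo_at_curve:
  fixes f :: "complex ^ 'n::finite \<Rightarrow> complex ^ 'm::finite"
  assumes "holo_at f (\<gamma> x)" "\<And>j. ((\<lambda>x. \<gamma> x $ j) has_field_derivative d $ j) (at x)"
  shows "((\<lambda>x. f (\<gamma> x) $ i) has_field_derivative (cjacobian f (\<gamma> x) *v d) $ i) (at x)"
proof -
  have "(\<gamma> has_derivative (\<lambda>h. h *s d)) (at x)"
    using assms(2) by (intro vec_has_derivative)
      (simp add: has_field_derivative_def mult_commute_abs)
  from has_derivative_vec_nth[OF has_derivative_compose[OF this cjacobian_has_derivative[OF assms(1)]], of i]
  show ?thesis
    by (simp add: has_field_derivative_def vector_scalar_commute mult_commute_abs)
qed

lemma cjacobian_entry:
  assumes "holo_at f x"
  shows "((\<lambda>t. f (x + t *s axis j 1) $ i) has_field_derivative cjacobian f x $ i $ j) (at 0)"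
proof -
  have "((\<lambda>t. (x + t *s axis j 1) $ k) has_field_derivative (axis j 1 :: complex ^ 'a) $ k) (at 0)" for k
    by (auto intro!: derivative_eq_intros)
  moreover have "holo_at f (x + 0 *s axis j 1)" using assms by simp
  ultimately have "((\<lambda>t. f (x + t *s axis j 1) $ i) has_field_derivative
      (cjacobian f (x + 0 *s axis j 1) *v axis j 1) $ i) (at 0)"
    by (intro holo_at_curve[where \<gamma> = "\<lambda>t. x + t *s axis j 1"])
  then show ?thesis
    by (simp add: matrix_vector_mul_component inner_axis) 
      (simp add: matrix_vector_mult_def axis_def if_distrib cong: if_cong)
qed

lemma cjacobian_entry_eq:
  assumes "holo_at f x" "((\<lambda>t. f (x + t *s axis j 1) $ i) has_field_derivative d) (at 0)"
  shows "cjacobian f x $ i $ j = d"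
  using cjacobian_entry[OF assms(1)] assms(2) DERIV_unique by blast

lemma difference_quotient_bound:
  fixes g :: "complex \<Rightarrow> complex"
  assumes g: "g holomorphic_on ball 0 r" and M: "\<And>t. norm t < r \<Longrightarrow> norm (g t) \<le> M"
    and t: "norm t \<le> r / 2" and r: "r > 0"
  shows "norm (g t - g 0 - deriv g 0 * t) \<le> 32 * M / r\<^sup>2 * (norm t)\<^sup>2"
proof -
  let ?f = "\<lambda>n. (deriv ^^ n) g"
  have hol: "?f n holomorphic_on ball 0 r" for n
    by (rule holomorphic_higher_deriv[OF g open_ball])
  have d: "(?f n has_field_derivative ?f (Suc n) x) (at x within cball 0 (r/2))"
    if "x \<in> cball 0 (r/2)" for n x
    using holomorphic_derivI[OF hol open_ball, of x] that r
    by (auto intro: has_field_derivative_at_within)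
  have B: "norm (?f (Suc 1) x) \<le> 32 * M / r\<^sup>2" if "x \<in> cball 0 (r/2)" for x
  proof -
    have sub: "cball x (r/4) \<subseteq> ball 0 r"
    proof
      fix y assume "y \<in> cball x (r/4)"
      then have "norm (y - x) \<le> r/4" "norm x \<le> r/2" using that by (auto simp: dist_norm norm_minus_commute)
      moreover have "norm y \<le> norm (y - x) + norm x" using norm_triangle_ineq[of "y - x" x] by simp
      ultimately have "norm y < r" using r by linarith
      then show "y \<in> ball 0 r" by simp
    qed
    \<comment> \<open>Balls of radius \<open>r/4\<close> around points of norm at most
      \<open>r/2\<close> stay inside \<open>ball 0 r\<close>, so Cauchy's inequality applies to the
      second derivative. The constant 32 is \<open>2! * 4^2\<close>.\<close>
    have "norm (?f 2 x) \<le> fact 2 * M / (r/4) ^ 2"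
    proof (rule Cauchy_inequality)
      show "g holomorphic_on ball x (r/4)"
        using g sub ball_subset_cball holomorphic_on_subset by (meson order_trans)
      show "continuous_on (cball x (r/4)) g"
        using g sub by (meson holomorphic_on_imp_continuous_on continuous_on_subset)
      show "norm (g y) \<le> M" if "norm (x - y) = r/4" for y
      proof -
        have "y \<in> cball x (r/4)" using that by (simp add: dist_norm)
        then have "y \<in> ball 0 r" using sub by blast
        then show ?thesis by (intro M) simp
      qed
    qed (use r in simp)
    moreover have "fact 2 * M / (r/4) ^ 2 = 32 * M / r\<^sup>2"
      by (simp add: power2_eq_square)
    ultimately show ?thesis by (simp add: numeral_2_eq_2)
  qed
  have "cmod (?f 0 t - (\<Sum>i\<le>1. ?f i 0 * (t - 0) ^ i / fact i)) \<le> 32 * M / r\<^sup>2 * cmod (t - 0) ^ Suc 1 / fact 1"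
    by (rule complex_Taylor[OF convex_cball d B]) (use t r in auto)
  then show ?thesis
    by (simp add: power2_eq_square algebra_simps)
qed

text \<open>Weierstrass' theorem: the difference quotients in direction \<open>j\<close> with step
  \<open>1/n\<close> are holomorphic along the curve, and \<open>difference_quotient_bound\<close>
  makes them converge uniformly to the Jacobian entry. No continuity of the Jacobian is assumed; the
  uniformity comes from a bound for \<open>f\<close> on a compact ball.\<close>

lemma holomorphic_cjacobian_curve:
  fixes f :: "complex ^ 'n::finite \<Rightarrow> complex ^ 'm::finite"
  assumes f: "holo_on f S" and S: "open S" and X: "open X"
    and \<gamma>: "\<And>k. (\<lambda>x. \<gamma> x $ k) holomorphic_on X" and sub: "\<gamma> ` X \<subseteq> S"
  shows "(\<lambda>x. cjacobian f (\<gamma> x) $ i $ j) holomorphic_on X"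
proof -
  have fd: "(\<lambda>x. cjacobian f (\<gamma> x) $ i $ j) field_differentiable at x0" if x0: "x0 \<in> X" for x0
  proof -
    let ?e = "axis j 1 :: complex ^ 'n"
    have ne: "norm (t *s ?e) = norm t" for t :: complex
    proof -
      have "t *s ?e = axis j t" by (simp add: vec_eq_iff axis_def)
      then show ?thesis by (simp add: norm_axis)
    qed
    have nth_cont: "isCont (\<lambda>x. \<gamma> x $ k) x" if "x \<in> X" for k x
      using \<gamma> X that by (meson continuous_on_eq_continuous_at holomorphic_on_imp_continuous_on)
    have cont\<gamma>: "continuous_on X \<gamma>"
      by (intro continuous_at_imp_continuous_on ballI)
        (simp add: isCont_def vec_tendstoI[OF isContD[OF nth_cont]])
    obtain r0 where r0: "r0 > 0" "cball (\<gamma> x0) r0 \<subseteq> S"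
      using S sub x0 open_contains_cball by blast
    \<comment> \<open>Half of \<open>r0\<close> is spent on moving the base point along the curve
      and half on the step in direction \<open>j\<close>, so that both together stay in the ball of
      radius \<open>r0\<close>.\<close>
    define r where "r = r0 / 2"
    have r: "r > 0" using r0 by (simp add: r_def)
    obtain \<delta> where \<delta>: "\<delta> > 0" "ball x0 \<delta> \<subseteq> X" "\<And>x. x \<in> ball x0 \<delta> \<Longrightarrow> dist (\<gamma> x) (\<gamma> x0) < r"
    proof -
      obtain d1 where "d1 > 0" "ball x0 d1 \<subseteq> X" using X x0 open_contains_ball by blast
      moreover obtain d2 where "d2 > 0" "\<And>x. dist x x0 < d2 \<Longrightarrow> dist (\<gamma> x) (\<gamma> x0) < r"
        using cont\<gamma> X x0 r unfolding continuous_on_eq_continuous_at[OF X] continuous_at_eps_delta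
        by metis
      ultimately show ?thesis by (intro that[of "min d1 d2"]) (auto simp: dist_commute)
    qed
    have inS: "\<gamma> x + t *s ?e \<in> cball (\<gamma> x0) r0" if "x \<in> ball x0 \<delta>" "norm t < r" for x t
    proof -
      have "norm (\<gamma> x + t *s ?e - \<gamma> x0) \<le> norm (\<gamma> x - \<gamma> x0) + norm (t *s ?e)"
        using norm_triangle_ineq[of "\<gamma> x - \<gamma> x0" "t *s ?e"] by (simp add: algebra_simps)
      then show ?thesis
        using \<delta>(3)[OF that(1)] that(2) ne[of t] by (simp add: dist_norm r_def norm_minus_commute)
    qed
    have holf: "holo_at f y" if "y \<in> cball (\<gamma> x0) r0" for y
      using f r0 that by (auto simp: holo_on_iff)
    have "compact ((\<lambda>y. f y $ i) ` cball (\<gamma> x0) r0)"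
    proof (intro compact_continuous_image continuous_at_imp_continuous_on ballI compact_cball)
      fix y assume "y \<in> cball (\<gamma> x0) r0"
      then have "isCont f y" using holf holo_at_isCont by blast
      then show "isCont (\<lambda>y. f y $ i) y" by (rule isCont_vec_nth)
    qed
    then have "bounded ((\<lambda>y. f y $ i) ` cball (\<gamma> x0) r0)" by (rule compact_imp_bounded)
    then obtain M where M: "\<And>y. y \<in> cball (\<gamma> x0) r0 \<Longrightarrow> norm (f y $ i) \<le> M"
      unfolding bounded_iff by blast
    define g where "g = (\<lambda>x t. f (\<gamma> x + t *s ?e) $ i)"
    have g0: "(g x has_field_derivative cjacobian f (\<gamma> x) $ i $ j) (at 0)" if "x \<in> ball x0 \<delta>" for x
      using cjacobian_entry[OF holf[OF inS[OF that, of 0]]] r by (simp add: g_def)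
    have gt: "(g x has_field_derivative (cjacobian f (\<gamma> x + t *s ?e) *v ?e) $ i) (at t)"
      if "x \<in> ball x0 \<delta>" "norm t < r" for x t
      unfolding g_def
      by (rule holo_at_curve[where \<gamma> = "\<lambda>t. \<gamma> x + t *s ?e", OF holf[OF inS[OF that]]])
        (auto intro!: derivative_eq_intros)
    have gx: "(\<lambda>x. g x t) holomorphic_on ball x0 \<delta>" if "norm t < r" for t
      unfolding holomorphic_on_open[OF open_ball]
    proof
      fix x assume x: "x \<in> ball x0 \<delta>"
      have "((\<lambda>x. (\<gamma> x + t *s ?e) $ k) has_field_derivative (\<chi> k. deriv (\<lambda>x. \<gamma> x $ k) x) $ k) (at x)" for k
        using holomorphic_derivI[OF \<gamma> X, of x k] x \<delta>(2) by (auto intro!: derivative_eq_intros)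
      from holo_at_curve[where \<gamma> = "\<lambda>x. \<gamma> x + t *s ?e", OF holf[OF inS[OF x that]] this]
      show "\<exists>f'. ((\<lambda>x. g x t) has_field_derivative f') (at x)"
        unfolding g_def by blast
    qed
    have bound: "norm (g x t - g x 0 - cjacobian f (\<gamma> x) $ i $ j * t) \<le> 32 * M / r\<^sup>2 * (norm t)\<^sup>2"
      if "x \<in> ball x0 \<delta>" "norm t \<le> r / 2" for x t
    proof -
      have "g x holomorphic_on ball 0 r"
        unfolding holomorphic_on_open[OF open_ball]
      proof
        fix u :: complex assume "u \<in> ball 0 r"
        then have "norm u < r" by simp
        from gt[OF that(1) this] show "\<exists>f'. (g x has_field_derivative f') (at u)" ..
      qed
      moreover have "norm (g x t) \<le> M" if "norm t < r" for t
        unfolding g_def by (rule M[OF inS[OF \<open>x \<in> ball x0 \<delta>\<close> that]])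
      ultimately show ?thesis
        using difference_quotient_bound[of "g x" r M t] that(2) r DERIV_imp_deriv[OF g0[OF that(1)]] by simp
    qed
    \<comment> \<open>Starting the sequence at \<open>N\<close> keeps every step
      \<open>1 / (n + N)\<close> within \<open>r / 2\<close>, the range in which
      \<open>bound\<close> holds.\<close>
    obtain N :: nat where N: "N > 0" "1 / N < r / 2"
      using real_arch_inverse[of "r / 2"] r by (auto simp: inverse_eq_divide)
    define K where "K = 32 * M / r\<^sup>2"
    define F where "F = (\<lambda>n x. of_nat (n + N) * (g x (1 / of_nat (n + N)) - g x 0))"
    have small: "norm (1 / of_nat (n + N) :: complex) \<le> r / 2" for n
    proof -
      have "1 / real (n + N) \<le> 1 / N" using N by (intro divide_left_mono) auto
      then show ?thesis using N by (simp add: norm_divide flip: of_nat_add)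
    qed
    have close: "norm (F n x - cjacobian f (\<gamma> x) $ i $ j) \<le> K * inverse (real (n + N))"
      if "x \<in> ball x0 \<delta>" for n x
    proof -
      let ?t = "1 / of_nat (n + N) :: complex"
      have nt: "of_nat (n + N) * ?t = 1" "norm ?t = inverse (real (n + N))" using N
        by (simp_all add: norm_divide inverse_eq_divide flip: of_nat_add)
      have "F n x - cjacobian f (\<gamma> x) $ i $ j
          = of_nat (n + N) * (g x ?t - g x 0 - cjacobian f (\<gamma> x) $ i $ j * ?t)"
        unfolding F_def using nt(1) N by (simp add: right_diff_distrib mult.left_commute del: of_nat_add)
      then have "norm (F n x - cjacobian f (\<gamma> x) $ i $ j)
          = real (n + N) * norm (g x ?t - g x 0 - cjacobian f (\<gamma> x) $ i $ j * ?t)"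
        by (simp add: norm_mult del: of_nat_add)
      also have "\<dots> \<le> real (n + N) * (K * (norm ?t)\<^sup>2)"
        unfolding K_def using bound[OF that small] by (intro mult_left_mono) auto
      also have "\<dots> = K * inverse (real (n + N))"
        using N unfolding nt by (simp add: power2_eq_square del: of_nat_add)
      finally show ?thesis .
    qed
    have K0: "(\<lambda>n. K * inverse (real (n + N))) \<longlonglongrightarrow> 0"
      using LIMSEQ_ignore_initial_segment[OF tendsto_mult_right_zero[OF lim_inverse_n, of K]] by simp
    have "(\<lambda>x. cjacobian f (\<gamma> x) $ i $ j) holomorphic_on ball x0 \<delta>"
    proof (rule holomorphic_uniform_sequence[OF open_ball])
      show "F n holomorphic_on ball x0 \<delta>" for n
        unfolding F_def
        by (intro holomorphic_intros gx) (use small[of n] r in auto)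
      fix x assume x: "x \<in> ball x0 \<delta>"
      obtain d where d: "d > 0" "cball x d \<subseteq> ball x0 \<delta>"
        using x open_ball open_contains_cball by blast
      have "uniform_limit (cball x d) F (\<lambda>x. cjacobian f (\<gamma> x) $ i $ j) sequentially"
      proof (rule uniform_limitI)
        fix e :: real assume "e > 0"
        then have "\<forall>\<^sub>F n in sequentially. K * inverse (real (n + N)) < e"
          using order_tendstoD(2)[OF K0] by blast
        then show "\<forall>\<^sub>F n in sequentially. \<forall>y\<in>cball x d. dist (F n y) (cjacobian f (\<gamma> y) $ i $ j) < e"
        proof eventually_elim
          case (elim n)
          show ?case
          proof
            fix y assume "y \<in> cball x d"
            then have "y \<in> ball x0 \<delta>" using d(2) by blast
            from le_less_trans[OF close[OF this] elim]
            show "dist (F n y) (cjacobian f (\<gamma> y) $ i $ j) < e" by (simp only: dist_norm)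
          qed
        qed
      qed
      then show "\<exists>d>0. cball x d \<subseteq> ball x0 \<delta> \<and>
          uniform_limit (cball x d) F (\<lambda>x. cjacobian f (\<gamma> x) $ i $ j) sequentially"
        using d by blast
    qed
    then show ?thesis
      using \<delta>(1) by (intro holomorphic_on_imp_differentiable_at[OF _ open_ball]) auto
  qed
  then show ?thesis
    using field_differentiable_at_within holomorphic_on_def by blast
qed

section \<open>Charts of the maximal atlas\<close>

lemma holo_atlas_inj: "holo_atlas A \<Longrightarrow> (U, \<phi>) \<in> A \<Longrightarrow> inj_on \<phi> U"
  unfolding holo_atlas_def by blast

lemma carrier_ofI: "(U, \<phi>) \<in> A \<Longrightarrow> p \<in> U \<Longrightarrow> p \<in> carrier_of A"
  unfolding carrier_of_def by blast

lemma carrier_ofE: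
  assumes "p \<in> carrier_of A"
  obtains U \<phi> where "(U, \<phi>) \<in> A" "p \<in> U"
  using assms unfolding carrier_of_def by blast

lemma openin_chart_preimage:
  "(U, \<phi>) \<in> A \<Longrightarrow> open S \<Longrightarrow> openin (atlas_topology A) {p \<in> U. \<phi> p \<in> S}"
  unfolding atlas_topology_def by (rule topology_generated_by_Basis) blast

lemma openin_chart_domain: "(U, \<phi>) \<in> A \<Longrightarrow> openin (atlas_topology A) U"
  using openin_chart_preimage[of U \<phi> A UNIV] by simp

lemma topspace_atlas: "topspace (atlas_topology A) = carrier_of A"
proof -
  have "(\<Union>{{p \<in> U. \<phi> p \<in> S} |U \<phi> S. (U, \<phi>) \<in> A \<and> open S}) = carrier_of A"
  proof (intro equalityI subsetI)
    fix p assume "p \<in> \<Union>{{p \<in> U. \<phi> p \<in> S} |U \<phi> S. (U, \<phi>) \<in> A \<and> open S}"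
    then show "p \<in> carrier_of A" by (auto intro: carrier_ofI)
  next
    fix p assume "p \<in> carrier_of A"
    then obtain U \<phi> where U: "(U, \<phi>) \<in> A" "p \<in> U" by (rule carrier_ofE)
    then have "{p \<in> U. \<phi> p \<in> UNIV} \<in> {{p \<in> U. \<phi> p \<in> S} |U \<phi> S. (U, \<phi>) \<in> A \<and> open S}"
      using open_UNIV by blast
    then show "p \<in> \<Union>{{p \<in> U. \<phi> p \<in> S} |U \<phi> S. (U, \<phi>) \<in> A \<and> open S}"
      using U(2) by (intro UnionI) auto
  qed
  then show ?thesis
    unfolding atlas_topology_def topology_generated_by_topspace .
qed

lemma continuous_map_atlasI:
  assumes "\<And>x. x \<in> topspace X \<Longrightarrow> f x \<in> carrier_of A"
    and "\<And>U \<phi> S. (U, \<phi>) \<in> A \<Longrightarrow> open S \<Longrightarrow> openin X {x \<in> topspace X. f x \<in> U \<and> \<phi> (f x) \<in> S}"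
  shows "continuous_map X (atlas_topology A) f"
  unfolding atlas_topology_def
proof (rule continuous_on_generated_topo)
  fix V assume "V \<in> {{p \<in> U. \<phi> p \<in> S} |U \<phi> S. (U, \<phi>) \<in> A \<and> open S}"
  then obtain U \<phi> S where V: "V = {p \<in> U. \<phi> p \<in> S}" "(U, \<phi>) \<in> A" "open S" by blast
  have "f -` V \<inter> topspace X = {x \<in> topspace X. f x \<in> U \<and> \<phi> (f x) \<in> S}"
    unfolding V by blast
  then show "openin X (f -` V \<inter> topspace X)"
    using assms(2)[OF V(2,3)] by simp
next
  show "f ` topspace X \<subseteq> \<Union>{{p \<in> U. \<phi> p \<in> S} |U \<phi> S. (U, \<phi>) \<in> A \<and> open S}"
  proof
    fix y assume "y \<in> f ` topspace X"
    then have "y \<in> carrier_of A" using assms(1) by blast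
    then show "y \<in> \<Union>{{p \<in> U. \<phi> p \<in> S} |U \<phi> S. (U, \<phi>) \<in> A \<and> open S}"
      using topspace_atlas[of A] unfolding atlas_topology_def topology_generated_by_topspace by simp
  qed
qed

lemma continuous_map_chart:
  assumes "(U, \<phi>) \<in> A"
  shows "continuous_map (subtopology (atlas_topology A) U) euclidean \<phi>"
  unfolding continuous_map_def
proof (intro conjI allI impI)
  fix S assume "openin euclidean (S :: (complex ^ 'b) set)"
  then have "openin (atlas_topology A) {p \<in> U. \<phi> p \<in> S}"
    by (intro openin_chart_preimage[OF assms]) simp
  moreover have "{p \<in> topspace (subtopology (atlas_topology A) U). \<phi> p \<in> S} = {p \<in> U. \<phi> p \<in> S} \<inter> U"
    using assms by (auto simp: topspace_atlas carrier_ofI)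
  ultimately show "openin (subtopology (atlas_topology A) U) {p \<in> topspace (subtopology (atlas_topology A) U). \<phi> p \<in> S}"
    unfolding openin_subtopology by blast
qed simp

text \<open>The topology is generated by a subbasis; this shows that openness can be tested in the
  charts. Injectivity of a chart handles intersections, and continuity of the transition maps
  handles the generating sets.\<close>

lemma openin_atlas_iff:
  assumes A: "holo_atlas A"
  shows "openin (atlas_topology A) W \<longleftrightarrow> W \<subseteq> carrier_of A \<and> (\<forall>(U, \<phi>)\<in>A. open (\<phi> ` (U \<inter> W)))"
proof
  assume W: "openin (atlas_topology A) W"
  have "open (\<phi> ` (U \<inter> W))" if U: "(U, \<phi>) \<in> A" for U \<phi>
  proof -
    note inj = holo_atlas_inj[OF A U]
    have "generate_topology_on {{p \<in> U. \<phi> p \<in> S} |U \<phi> S. (U, \<phi>) \<in> A \<and> open S} W"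
      using W unfolding atlas_topology_def openin_topology_generated_by_iff .
    then show ?thesis
    proof induction
      case (Int a b)
      have "\<phi> ` (U \<inter> (a \<inter> b)) = \<phi> ` (U \<inter> a) \<inter> \<phi> ` (U \<inter> b)"
        using inj unfolding inj_on_def by auto
      then show ?case using Int by auto
    next
      case (UN K)
      have "\<phi> ` (U \<inter> \<Union>K) = (\<Union>k\<in>K. \<phi> ` (U \<inter> k))" by blast
      then show ?case using UN by auto
    next
      case (Basis s)
      then obtain V \<psi> S where V: "s = {p \<in> V. \<psi> p \<in> S}" "(V, \<psi>) \<in> A" "open S" by blast
      have op: "open (\<phi> ` (U \<inter> V))" and h: "holo_on (\<psi> \<circ> inv_into U \<phi>) (\<phi> ` (U \<inter> V))"
        using A U V(2) unfolding holo_atlas_def by blast+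
      have "\<phi> ` (U \<inter> s) = (\<psi> \<circ> inv_into U \<phi>) -` S \<inter> \<phi> ` (U \<inter> V)"
        unfolding V using inj by (auto simp: inv_into_f_f)
      then show ?case
        using continuous_open_preimage[OF holo_on_continuous[OF h] op V(3)] by (simp add: Int_commute)
    qed simp
  qed
  moreover have "W \<subseteq> carrier_of A" using openin_subset[OF W] by (simp add: topspace_atlas)
  ultimately show "W \<subseteq> carrier_of A \<and> (\<forall>(U, \<phi>)\<in>A. open (\<phi> ` (U \<inter> W)))" by blast
next
  assume W: "W \<subseteq> carrier_of A \<and> (\<forall>(U, \<phi>)\<in>A. open (\<phi> ` (U \<inter> W)))"
  have "W = (\<Union>(U, \<phi>)\<in>A. {p \<in> U. \<phi> p \<in> \<phi> ` (U \<inter> W)})" (is "_ = ?R")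
  proof
    show "W \<subseteq> ?R" using W unfolding carrier_of_def by blast
    show "?R \<subseteq> W"
      using holo_atlas_inj[OF A] unfolding inj_on_def by fastforce
  qed
  moreover have "openin (atlas_topology A) ?R"
    using W by (intro openin_Union) (auto intro!: openin_chart_preimage)
  ultimately show "openin (atlas_topology A) W" by simp
qed

text \<open>A set open for the larger atlas is open in every chart of \<open>A\<close> by
  \<open>openin_atlas_iff\<close>, so nothing new becomes open. Charts of the maximal atlas may thus
  be used like charts of \<open>A\<close>.\<close>

lemma compatible_topology:
  assumes "c \<in> compatible_charts A"
  shows "atlas_topology (insert c A) = atlas_topology A"
proof -
  have c: "fst c \<subseteq> carrier_of A" "holo_atlas (insert c A)"
    using assms unfolding compatible_charts_def by auto
  have A: "holo_atlas A" using c(2) unfolding holo_atlas_def by blast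
  have car: "carrier_of (insert c A) = carrier_of A"
    using c(1) unfolding carrier_of_def by (cases c) auto
  have "openin (atlas_topology (insert c A)) W" if "openin (atlas_topology A) W" for W
  proof -
    have "generate_topology_on {{p \<in> U. \<phi> p \<in> S} |U \<phi> S. (U, \<phi>) \<in> A \<and> open S} W"
      using that unfolding atlas_topology_def openin_topology_generated_by_iff .
    then have "generate_topology_on {{p \<in> U. \<phi> p \<in> S} |U \<phi> S. (U, \<phi>) \<in> insert c A \<and> open S} W"
    proof induction
      case (Basis s)
      then show ?case by (intro generate_topology_on.Basis) blast
    qed (auto intro: generate_topology_on.intros)
    then show ?thesis unfolding atlas_topology_def openin_topology_generated_by_iff .
  qed
  moreover have "openin (atlas_topology A) W" if "openin (atlas_topology (insert c A)) W" for W
    using that unfolding openin_atlas_iff[OF A] openin_atlas_iff[OF c(2)] car by blast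
  ultimately show ?thesis unfolding topology_eq by blast
qed

lemma compatible_charts_holo_atlas: "c \<in> compatible_charts A \<Longrightarrow> holo_atlas A"
  unfolding compatible_charts_def holo_atlas_def by blast

context
  fixes A :: "('a, 'n::finite) atlas" and c
  assumes c: "c \<in> compatible_charts A"
begin

lemma compatible_inj: "inj_on (snd c) (fst c)"
  using c unfolding compatible_charts_def holo_atlas_def by (cases c) auto

lemma compatible_openin: "openin (atlas_topology A) (fst c)"
  using openin_chart_domain[of "fst c" "snd c" "insert c A"] compatible_topology[OF c] by simp

lemma compatible_open_image:
  assumes "openin (atlas_topology A) W"
  shows "open (snd c ` (fst c \<inter> W))"
proof -
  have "holo_atlas (insert c A)" using c unfolding compatible_charts_def by auto
  moreover have "(fst c, snd c) \<in> insert c A" by simp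
  ultimately show ?thesis
    using assms openin_atlas_iff[of "insert c A" W] compatible_topology[OF c] by auto
qed

lemma compatible_sub_carrier: "fst c \<subseteq> carrier_of A"
  using c unfolding compatible_charts_def by auto

lemma compatible_holo:
  assumes "(U, \<phi>) \<in> A"
  shows "holo_on (\<phi> \<circ> inv_into (fst c) (snd c)) (snd c ` (fst c \<inter> U))"
    "holo_on (snd c \<circ> inv_into U \<phi>) (\<phi> ` (U \<inter> fst c))"
proof -
  have "holo_atlas (insert c A)" "(fst c, snd c) \<in> insert c A" "(U, \<phi>) \<in> insert c A"
    using c assms unfolding compatible_charts_def by auto
  then show "holo_on (\<phi> \<circ> inv_into (fst c) (snd c)) (snd c ` (fst c \<inter> U))"
    "holo_on (snd c \<circ> inv_into U \<phi>) (\<phi> ` (U \<inter> fst c))"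
    unfolding holo_atlas_def by blast+
qed

end

text \<open>Both charts are compatible with \<open>A\<close> but are not assumed compatible with
  each other, so the transition is factored through a chart of \<open>A\<close> around
  \<open>p\<close>.\<close>

lemma compatible_transition_holo:
  assumes c: "c \<in> compatible_charts A" and d: "d \<in> compatible_charts A"
    and p: "p \<in> fst c" "p \<in> fst d"
  shows "holo_at (snd c \<circ> inv_into (fst d) (snd d)) (snd d p)"
proof -
  have "p \<in> carrier_of A" using compatible_sub_carrier[OF c] p by blast
  then obtain U \<phi> where U: "(U, \<phi>) \<in> A" "p \<in> U" by (rule carrier_ofE)
  note A = compatible_charts_holo_atlas[OF c]
  have inv: "inv_into (fst d) (snd d) (snd d p) = p"
    using p compatible_inj[OF d] by (simp add: inv_into_f_f)
  have h1: "holo_at (\<phi> \<circ> inv_into (fst d) (snd d)) (snd d p)"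
    using compatible_holo(1)[OF d U(1)] p U(2) unfolding holo_on_iff by blast
  have h2: "holo_at (snd c \<circ> inv_into U \<phi>) (\<phi> p)"
    using compatible_holo(2)[OF c U(1)] p U(2) unfolding holo_on_iff by blast
  have h: "holo_at (\<lambda>x. (snd c \<circ> inv_into U \<phi>) ((\<phi> \<circ> inv_into (fst d) (snd d)) x)) (snd d p)"
    by (rule holo_at_compose[OF _ h1]) (use h2 inv in \<open>simp add: comp_def\<close>)
  show ?thesis
  proof (rule holo_at_cong[OF h])
    show "open (snd d ` (fst d \<inter> (fst c \<inter> U)))"
      by (intro compatible_open_image[OF d] openin_Int compatible_openin[OF c] openin_chart_domain[OF U(1)])
    show "snd d p \<in> snd d ` (fst d \<inter> (fst c \<inter> U))" using p U by blast
    fix y assume "y \<in> snd d ` (fst d \<inter> (fst c \<inter> U))"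
    then show "(snd c \<circ> inv_into U \<phi>) ((\<phi> \<circ> inv_into (fst d) (snd d)) y)
        = (snd c \<circ> inv_into (fst d) (snd d)) y"
      using compatible_inj[OF d] holo_atlas_inj[OF A U(1)] by (auto simp: inv_into_f_f)
  qed
qed

text \<open>The chain rule yields the cocycle law of the tangent bundle. The two sides agree only on
  the triple overlap, which is why the Jacobians are compared on that open set.\<close>

lemma compatible_cjacobian_chain:
  assumes c: "c \<in> compatible_charts A" and d: "d \<in> compatible_charts A" and e: "e \<in> compatible_charts A"
    and p: "p \<in> fst c" "p \<in> fst d" "p \<in> fst e"
  shows "cjacobian (snd c \<circ> inv_into (fst e) (snd e)) (snd e p) =
    cjacobian (snd c \<circ> inv_into (fst d) (snd d)) (snd d p) **
    cjacobian (snd d \<circ> inv_into (fst e) (snd e)) (snd e p)"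
proof -
  note inj = compatible_inj[OF d] compatible_inj[OF e]
  have eq: "(snd d \<circ> inv_into (fst e) (snd e)) (snd e p) = snd d p"
    using p inj by (simp add: inv_into_f_f)
  have hde: "holo_at (snd d \<circ> inv_into (fst e) (snd e)) (snd e p)"
    by (rule compatible_transition_holo[OF d e p(2,3)])
  have hcd: "holo_at (snd c \<circ> inv_into (fst d) (snd d)) ((snd d \<circ> inv_into (fst e) (snd e)) (snd e p))"
    unfolding eq by (rule compatible_transition_holo[OF c d p(1,2)])
  have "cjacobian (snd c \<circ> inv_into (fst e) (snd e)) (snd e p) =
    cjacobian (\<lambda>x. (snd c \<circ> inv_into (fst d) (snd d)) ((snd d \<circ> inv_into (fst e) (snd e)) x)) (snd e p)"
  proof (rule cjacobian_cong[OF holo_at_compose[OF hcd hde]])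
    show "open (snd e ` (fst e \<inter> (fst c \<inter> fst d)))"
      by (intro compatible_open_image[OF e] openin_Int compatible_openin c d)
    show "snd e p \<in> snd e ` (fst e \<inter> (fst c \<inter> fst d))" using p by blast
    fix y assume "y \<in> snd e ` (fst e \<inter> (fst c \<inter> fst d))"
    then show "(snd c \<circ> inv_into (fst d) (snd d)) ((snd d \<circ> inv_into (fst e) (snd e)) y)
        = (snd c \<circ> inv_into (fst e) (snd e)) y"
      using inj by (auto simp: inv_into_f_f)
  qed
  then show ?thesis
    using cjacobian_compose[OF hde hcd] unfolding eq by (simp add: comp_def)
qed

lemma compatible_cjacobian_self:
  assumes c: "c \<in> compatible_charts A" and p: "p \<in> fst c"
  shows "cjacobian (snd c \<circ> inv_into (fst c) (snd c)) (snd c p) = mat 1"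
proof -
  have "cjacobian (snd c \<circ> inv_into (fst c) (snd c)) (snd c p) = cjacobian (\<lambda>x. x) (snd c p)"
  proof (rule cjacobian_cong)
    show "holo_at (\<lambda>x. x) (snd c p)" by (intro holo_atI) simp
    show "open (snd c ` (fst c \<inter> fst c))" by (intro compatible_open_image[OF c] compatible_openin[OF c])
    show "snd c p \<in> snd c ` (fst c \<inter> fst c)" using p by blast
  qed (auto simp: f_inv_into_f)
  then show ?thesis by (simp add: cjacobian_ident)
qed

text \<open>Inverses of charts rather than charts: the coordinates on the resolution are given by
  explicit formulas from an open set of coordinates into the threefold.\<close>

definition holo_param :: "('a, 'n::finite) atlas \<Rightarrow> (complex ^ 'n) set \<Rightarrow> (complex ^ 'n \<Rightarrow> 'a) \<Rightarrow> bool" where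
  "holo_param A \<Omega> G \<longleftrightarrow> open \<Omega> \<and> inj_on G \<Omega> \<and>
     continuous_map (top_of_set \<Omega>) (atlas_topology A) G \<and>
     (\<forall>(U, \<phi>)\<in>A. \<forall>w\<in>\<Omega>. G w \<in> U \<longrightarrow>
        (\<exists>J. ((\<lambda>w. \<phi> (G w)) has_derivative (*v) J) (at w) \<and> invertible J))"

lemma holo_param_inj: "holo_param A \<Omega> G \<Longrightarrow> inj_on G \<Omega>"
  unfolding holo_param_def by (elim conjE)

lemma holo_param_cont: "holo_param A \<Omega> G \<Longrightarrow> continuous_map (top_of_set \<Omega>) (atlas_topology A) G"
  unfolding holo_param_def by (elim conjE)

lemma holo_paramI:
  assumes "open \<Omega>" "inj_on G \<Omega>" "continuous_map (top_of_set \<Omega>) (atlas_topology A) G"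
    and "\<And>U \<phi> w. (U, \<phi>) \<in> A \<Longrightarrow> w \<in> \<Omega> \<Longrightarrow> G w \<in> U \<Longrightarrow>
        \<exists>J. ((\<lambda>w. \<phi> (G w)) has_derivative (*v) J) (at w) \<and> invertible J"
  shows "holo_param A \<Omega> G"
  unfolding holo_param_def using assms(1,2,3) by (intro conjI) (auto simp only: split_beta intro!: assms(4))

lemma holo_param_open: "holo_param A \<Omega> G \<Longrightarrow> open \<Omega>"
  unfolding holo_param_def by (elim conjE)

lemma holo_paramD:
  assumes "holo_param A \<Omega> G" "(U, \<phi>) \<in> A" "w \<in> \<Omega>" "G w \<in> U"
  shows "\<exists>J. ((\<lambda>w. \<phi> (G w)) has_derivative (*v) J) (at w) \<and> invertible J"
proof -
  have "\<forall>(U, \<phi>)\<in>A. \<forall>w\<in>\<Omega>. G w \<in> U \<longrightarrow>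
      (\<exists>J. ((\<lambda>w. \<phi> (G w)) has_derivative (*v) J) (at w) \<and> invertible J)"
    using assms(1) unfolding holo_param_def by (elim conjE)
  from bspec[OF this assms(2)] have "\<forall>w\<in>\<Omega>. G w \<in> U \<longrightarrow>
      (\<exists>J. ((\<lambda>w. \<phi> (G w)) has_derivative (*v) J) (at w) \<and> invertible J)"
    by (simp only: prod.case)
  from mp[OF bspec[OF this assms(3)] assms(4)] show ?thesis .
qed

lemma holo_param_sub_carrier: "holo_param A \<Omega> G \<Longrightarrow> w \<in> \<Omega> \<Longrightarrow> G w \<in> carrier_of A"
  using continuous_map_image_subset_topspace[OF holo_param_cont] by (fastforce simp: topspace_atlas)

definition param_chart :: "(complex ^ 'n::finite) set \<Rightarrow> (complex ^ 'n \<Rightarrow> 'a) \<Rightarrow> 'a set \<times> ('a \<Rightarrow> complex ^ 'n)" where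
  "param_chart \<Omega> G = (G ` \<Omega>, inv_into \<Omega> G)"

lemma fst_param_chart [simp]: "fst (param_chart \<Omega> G) = G ` \<Omega>"
  by (simp add: param_chart_def)

lemma snd_param_chart: "inj_on G \<Omega> \<Longrightarrow> w \<in> \<Omega> \<Longrightarrow> snd (param_chart \<Omega> G) (G w) = w"
  by (simp add: param_chart_def inv_into_f_f)

lemma inv_param_chart:
  assumes "inj_on G \<Omega>" "w \<in> \<Omega>"
  shows "inv_into (fst (param_chart \<Omega> G)) (snd (param_chart \<Omega> G)) w = G w"
  using assms snd_param_chart[OF assms(1)]
  by (intro inv_into_f_eq) (auto simp: inj_on_def)

lemma openin_param_preimage:
  assumes G: "continuous_map (top_of_set \<Omega>) T G" and "open \<Omega>" "openin T W"
  shows "open {w \<in> \<Omega>. G w \<in> W}"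
  using openin_continuous_map_preimage[OF G assms(3)] assms(2) by (auto simp: openin_open_eq)

text \<open>Openness of the image and continuity of the inverse come from invariance of domain. A
  continuous inverse of a map with invertible derivative is differentiable with the inverse
  derivative, so no continuity of the derivative is required.\<close>

lemma param_chart_compatible:
  assumes A: "holo_atlas A" and P: "holo_param A \<Omega> G"
  shows "param_chart \<Omega> G \<in> compatible_charts A"
proof -
  let ?c = "inv_into \<Omega> G"
  note \<Omega> = holo_param_open[OF P] and inj = holo_param_inj[OF P] and cont = holo_param_cont[OF P]
    and der = holo_paramD[OF P]
  have car: "G ` \<Omega> \<subseteq> carrier_of A"
    using continuous_map_image_subset_topspace[OF cont] by (simp add: topspace_atlas)
  have cG: "?c (G w) = w" if "w \<in> \<Omega>" for w using that inj by (simp add: inv_into_f_f)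
  have injc: "inj_on ?c (G ` \<Omega>)" by (intro inj_on_inv_into) simp
  have imc: "?c ` (G ` \<Omega> \<inter> U) = {w \<in> \<Omega>. G w \<in> U}" for U
    using cG by (force simp: image_iff)
  have invc: "inv_into (G ` \<Omega>) ?c w = G w" if "w \<in> \<Omega>" for w
    using injc cG[OF that] that inj by (intro inv_into_f_eq) auto
  have trans: "open (\<phi> ` (U \<inter> G ` \<Omega>)) \<and> holo_on (?c \<circ> inv_into U \<phi>) (\<phi> ` (U \<inter> G ` \<Omega>)) \<and>
      open (?c ` (G ` \<Omega> \<inter> U)) \<and> holo_on (\<phi> \<circ> inv_into (G ` \<Omega>) ?c) (?c ` (G ` \<Omega> \<inter> U))"
    if U: "(U, \<phi>) \<in> A" for U \<phi>
  proof -
    note inj\<phi> = holo_atlas_inj[OF A U]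
    define W where "W = {w \<in> \<Omega>. G w \<in> U}"
    define f where "f = (\<lambda>w. \<phi> (G w))"
    have W: "open W" unfolding W_def
      by (rule openin_param_preimage[OF cont \<Omega> openin_chart_domain[OF U]])
    have df: "\<exists>J. (f has_derivative (*v) J) (at w) \<and> invertible J" if "w \<in> W" for w
      using der[OF U, of w] that unfolding W_def f_def by blast
    have contf: "continuous_on W f"
      using df by (meson continuous_at_imp_continuous_on has_derivative_continuous)
    have injf: "inj_on f W"
      using inj inj\<phi> unfolding f_def W_def inj_on_def by blast
    have imf: "\<phi> ` (U \<inter> G ` \<Omega>) = f ` W" unfolding f_def W_def by auto
    \<comment> \<open>The coordinate expression \<open>f\<close> of the parametrisation is a
      continuous injection between open sets of the same dimension.\<close>
    have opf: "open (f ` W)" by (rule invariance_of_domain[OF contf W injf])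
    obtain g where g: "homeomorphism W (f ` W) f g"
      using invariance_of_domain_homeomorphism[OF W contf _ injf] by auto
    have gf: "g (f w) = w" if "w \<in> W" for w using g that by (simp add: homeomorphism_def)
    have geq: "(?c \<circ> inv_into U \<phi>) y = g y" if y: "y \<in> f ` W" for y
    proof -
      obtain w where w: "w \<in> W" "y = f w" using y by blast
      then have "inv_into U \<phi> y = G w" using inj\<phi> unfolding f_def W_def by (auto simp: inv_into_f_f)
      then show ?thesis using w gf cG unfolding W_def by auto
    qed
    have hg: "holo_at g y" if y: "y \<in> f ` W" for y
    proof -
      obtain w where w: "w \<in> W" "y = f w" using y by blast
      obtain J where J: "(f has_derivative (*v) J) (at w)" "invertible J" using df[OF w(1)] by blast
      obtain J' where J': "J' ** J = mat 1" using J(2) unfolding invertible_def by blast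
      have "(g has_derivative (*v) J') (at y)"
      proof (rule has_derivative_inverse_basic)
        show "(f has_derivative (*v) J) (at (g y))" using J w gf by simp
        show "(*v) J' \<circ> (*v) J = id" using J' by (simp add: fun_eq_iff matrix_vector_mul_assoc)
        have "continuous_on (f ` W) g" using g by (simp add: homeomorphism_def)
        then show "continuous (at y) g" using opf y continuous_on_eq_continuous_at by blast
        show "f (g z) = z" if "z \<in> f ` W" for z using gf that by auto
      qed (use opf y bounded_linear_matrix_vector in auto)
      then show ?thesis by blast
    qed
    have "holo_on (?c \<circ> inv_into U \<phi>) (f ` W)"
      unfolding holo_on_iff using holo_at_cong[OF hg opf] geq by metis
    moreover have "holo_on (\<phi> \<circ> inv_into (G ` \<Omega>) ?c) W"
      unfolding holo_on_iff
    proof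
      fix w assume w: "w \<in> W"
      have "holo_at f w" using df[OF w] by blast
      then show "holo_at (\<phi> \<circ> inv_into (G ` \<Omega>) ?c) w"
        by (rule holo_at_cong[OF _ W w]) (auto simp: invc f_def W_def)
    qed
    ultimately show ?thesis
      using W opf unfolding imf imc W_def[symmetric] by blast
  qed
  have self: "open (?c ` (G ` \<Omega>))" "holo_on (?c \<circ> inv_into (G ` \<Omega>) ?c) (?c ` (G ` \<Omega>))"
  proof -
    have im: "?c ` G ` \<Omega> = \<Omega>" using imc[of UNIV] by simp
    then show "open (?c ` (G ` \<Omega>))" using \<Omega> by simp
    show "holo_on (?c \<circ> inv_into (G ` \<Omega>) ?c) (?c ` (G ` \<Omega>))"
      unfolding im holo_on_iff
    proof
      fix w assume w: "w \<in> \<Omega>"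
      have "holo_at (\<lambda>w. w) w" by (intro holo_atI) simp
      then show "holo_at (?c \<circ> inv_into (G ` \<Omega>) ?c) w"
        by (rule holo_at_cong[OF _ \<Omega> w]) (simp add: invc cG)
    qed
  qed
  have "holo_atlas (insert (G ` \<Omega>, ?c) A)"
    using A injc self trans unfolding holo_atlas_def by (auto split: prod.splits) 
  then show ?thesis
    using car unfolding compatible_charts_def param_chart_def by simp
qed

section \<open>Restricted, conjugate and product atlases\<close>

lemma topology_eqI_id:
  assumes "topspace X = topspace Y" "continuous_map X Y (\<lambda>x. x)" "continuous_map Y X (\<lambda>x. x)"
  shows "X = Y"
proof -
  have "openin Y S" if S: "openin X S" for S
    using openin_continuous_map_preimage[OF assms(3) S] openin_subset[OF S] assms(1)
    by (simp add: Collect_conj_eq inf_absorb2)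
  moreover have "openin X S" if S: "openin Y S" for S
    using openin_continuous_map_preimage[OF assms(2) S] openin_subset[OF S] assms(1)
    by (simp add: Collect_conj_eq inf_absorb2)
  ultimately show ?thesis unfolding topology_eq by blast
qed

lemma carrier_restrict_atlas: "carrier_of (restrict_atlas A W) = carrier_of A \<inter> W"
  unfolding carrier_of_def restrict_atlas_def by auto

lemma restrict_atlasI: "(U, \<phi>) \<in> A \<Longrightarrow> (U \<inter> W, \<phi>) \<in> restrict_atlas A W"
  unfolding restrict_atlas_def by blast

text \<open>With its analogues for conjugate and product atlases, this turns the continuity
  assertions about the auxiliary atlases of a small resolution into statements about subspaces and
  products.\<close>

lemma restrict_atlas_topology: "atlas_topology (restrict_atlas A W) = subtopology (atlas_topology A) W"
proof (rule topology_eqI_id)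
  show "topspace (atlas_topology (restrict_atlas A W)) = topspace (subtopology (atlas_topology A) W)"
    by (simp add: topspace_atlas carrier_restrict_atlas)
  have "continuous_map (atlas_topology (restrict_atlas A W)) (atlas_topology A) (\<lambda>x. x)"
  proof (rule continuous_map_atlasI)
    show "x \<in> carrier_of A" if "x \<in> topspace (atlas_topology (restrict_atlas A W))" for x
      using that by (simp add: topspace_atlas carrier_restrict_atlas)
    fix U \<phi> S assume U: "(U, \<phi>) \<in> A" and S: "open (S :: (complex ^ 'b) set)"
    have "{x \<in> topspace (atlas_topology (restrict_atlas A W)). x \<in> U \<and> \<phi> x \<in> S} = {x \<in> U \<inter> W. \<phi> x \<in> S}"
      using U by (auto simp: topspace_atlas carrier_restrict_atlas carrier_ofI)
    then show "openin (atlas_topology (restrict_atlas A W))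
        {x \<in> topspace (atlas_topology (restrict_atlas A W)). x \<in> U \<and> \<phi> x \<in> S}"
      using openin_chart_preimage[OF restrict_atlasI[OF U] S] by simp
  qed
  then show "continuous_map (atlas_topology (restrict_atlas A W)) (subtopology (atlas_topology A) W) (\<lambda>x. x)"
    by (auto simp: continuous_map_in_subtopology topspace_atlas carrier_restrict_atlas)
  show "continuous_map (subtopology (atlas_topology A) W) (atlas_topology (restrict_atlas A W)) (\<lambda>x. x)"
  proof (rule continuous_map_atlasI)
    show "x \<in> carrier_of (restrict_atlas A W)" if "x \<in> topspace (subtopology (atlas_topology A) W)" for x
      using that by (simp add: topspace_atlas carrier_restrict_atlas)
    fix U \<phi> S assume U: "(U, \<phi>) \<in> restrict_atlas A W" and S: "open (S :: (complex ^ 'b) set)"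
    then obtain U' where U': "U = U' \<inter> W" "(U', \<phi>) \<in> A" unfolding restrict_atlas_def by blast
    have "{x \<in> topspace (subtopology (atlas_topology A) W). x \<in> U \<and> \<phi> x \<in> S} = {x \<in> U'. \<phi> x \<in> S} \<inter> W"
      using U' by (auto simp: topspace_atlas carrier_ofI)
    then show "openin (subtopology (atlas_topology A) W)
        {x \<in> topspace (subtopology (atlas_topology A) W). x \<in> U \<and> \<phi> x \<in> S}"
      unfolding openin_subtopology using openin_chart_preimage[OF U'(2) S] by blast
  qed
qed

definition vconj :: "complex ^ 'n \<Rightarrow> complex ^ 'n::finite" where
  "vconj x = (\<chi> i. cnj (x $ i))"

lemma vconj_nth [simp]: "vconj x $ i = cnj (x $ i)"
  by (simp add: vconj_def)

lemma vconj_vconj [simp]: "vconj (vconj x) = x"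
  by (simp add: vec_eq_iff)

lemma bounded_linear_vconj: "bounded_linear vconj"
  by (simp add: linear_conv_bounded_linear[symmetric] linear_iff vec_eq_iff)

lemma continuous_on_vconj: "continuous_on S vconj"
  using bounded_linear_vconj linear_continuous_on by blast

lemma open_vconj_image: "open S \<Longrightarrow> open (vconj ` S)"
proof -
  assume "open S"
  then have "open (vconj -` S)"
    by (rule open_vimage) (rule continuous_on_vconj)
  moreover have "vconj ` S = vconj -` S"
    by (force simp: image_iff)
  ultimately show ?thesis by simp
qed

lemma conj_atlas_alt: "conj_atlas A = (\<lambda>(U, \<phi>). (U, vconj \<circ> \<phi>)) ` A"
  unfolding conj_atlas_def vconj_def comp_def by auto

lemma conj_conj_atlas [simp]: "conj_atlas (conj_atlas A) = A"
  unfolding conj_atlas_alt image_image by (force simp: comp_def)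

lemma carrier_conj_atlas: "carrier_of (conj_atlas A) = carrier_of A"
  unfolding carrier_of_def conj_atlas_alt by force

lemma continuous_map_conj_atlas:
  "continuous_map (atlas_topology A) (atlas_topology (conj_atlas A)) (\<lambda>x. x)"
proof (rule continuous_map_atlasI)
  fix U \<phi> S assume U: "(U, \<phi>) \<in> conj_atlas A" and S: "open (S :: (complex ^ 'b) set)"
  then obtain \<psi> where \<psi>: "\<phi> = vconj \<circ> \<psi>" "(U, \<psi>) \<in> A" unfolding conj_atlas_alt by auto
  have "{x \<in> topspace (atlas_topology A). x \<in> U \<and> \<phi> x \<in> S} = {x \<in> U. \<psi> x \<in> vconj ` S}"
    using \<psi> by (force simp: topspace_atlas carrier_ofI image_iff)
  then show "openin (atlas_topology A) {x \<in> topspace (atlas_topology A). x \<in> U \<and> \<phi> x \<in> S}"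
    using openin_chart_preimage[OF \<psi>(2) open_vconj_image[OF S]] by simp
qed (simp add: topspace_atlas carrier_conj_atlas)

lemma conj_atlas_topology: "atlas_topology (conj_atlas A) = atlas_topology A"
  using continuous_map_conj_atlas[of A] continuous_map_conj_atlas[of "conj_atlas A"]
  by (intro topology_eqI_id) (simp_all add: topspace_atlas carrier_conj_atlas)

definition vjoin :: "complex ^ 'n \<Rightarrow> complex ^ 'm \<Rightarrow> complex ^ ('n::finite + 'm::finite)" where
  "vjoin x y = (\<chi> i. case i of Inl j \<Rightarrow> x $ j | Inr k \<Rightarrow> y $ k)"

lemma vjoin_nth [simp]: "vjoin x y $ Inl j = x $ j" "vjoin x y $ Inr k = y $ k"
  by (simp_all add: vjoin_def)

lemma prod_atlas_alt:
  "prod_atlas A B = {(U \<times> V, \<lambda>(p, q). vjoin (\<phi> p) (\<psi> q)) |U \<phi> V \<psi>. (U, \<phi>) \<in> A \<and> (V, \<psi>) \<in> B}"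
  unfolding prod_atlas_def vjoin_def ..

lemma prod_atlasI:
  "(U, \<phi>) \<in> A \<Longrightarrow> (V, \<psi>) \<in> B \<Longrightarrow> (U \<times> V, \<lambda>(p, q). vjoin (\<phi> p) (\<psi> q)) \<in> prod_atlas A B"
  unfolding prod_atlas_alt by blast

lemma carrier_prod_atlas: "carrier_of (prod_atlas A B) = carrier_of A \<times> carrier_of B"
proof (intro equalityI subsetI)
  fix x assume "x \<in> carrier_of (prod_atlas A B)"
  then show "x \<in> carrier_of A \<times> carrier_of B"
    unfolding prod_atlas_alt by (elim carrier_ofE) (auto intro: carrier_ofI)
next
  fix x assume "x \<in> carrier_of A \<times> carrier_of B"
  then obtain p q where x: "x = (p, q)" "p \<in> carrier_of A" "q \<in> carrier_of B" by blast
  obtain U \<phi> where U: "(U, \<phi>) \<in> A" "p \<in> U" using x(2) by (rule carrier_ofE)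
  obtain V \<psi> where V: "(V, \<psi>) \<in> B" "q \<in> V" using x(3) by (rule carrier_ofE)
  show "x \<in> carrier_of (prod_atlas A B)"
    by (rule carrier_ofI[OF prod_atlasI[OF U(1) V(1)]]) (simp add: x U V)
qed

lemma continuous_on_vjoin: "continuous_on UNIV (\<lambda>(x, y). vjoin x y)"
  unfolding case_prod_beta vjoin_def
proof (rule continuous_on_vec_lambda)
  show "continuous_on UNIV (\<lambda>z. case i of Inl j \<Rightarrow> fst z $ j | Inr k \<Rightarrow> snd z $ k)"
    for i :: "'a + 'b" by (cases i) (auto intro!: continuous_intros)
qed

lemma prod_atlas_topology:
  fixes A :: "('a, 'n::finite) atlas" and B :: "('b, 'm::finite) atlas"
  shows "atlas_topology (prod_atlas A B) = prod_topology (atlas_topology A) (atlas_topology B)"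
    (is "?L = ?R")
proof (rule topology_eqI_id)
  show "topspace ?L = topspace ?R"
    by (simp add: topspace_atlas carrier_prod_atlas)
  show "continuous_map ?R ?L (\<lambda>x. x)"
  proof (rule continuous_map_atlasI)
    show "x \<in> carrier_of (prod_atlas A B)" if "x \<in> topspace ?R" for x
      using that by (simp add: topspace_atlas carrier_prod_atlas)
    fix N h S assume N: "(N, h) \<in> prod_atlas A B" and S: "open (S :: (complex ^ ('n + 'm)) set)"
    obtain U \<phi> V \<psi> where UV: "N = U \<times> V" "h = (\<lambda>(p, q). vjoin (\<phi> p) (\<psi> q))" "(U, \<phi>) \<in> A" "(V, \<psi>) \<in> B"
      using N unfolding prod_atlas_alt by blast
    have "continuous_map (prod_topology (subtopology (atlas_topology A) U) (subtopology (atlas_topology B) V))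
        (prod_topology euclidean euclidean) (\<lambda>(p, q). (\<phi> p, \<psi> q))"
      unfolding continuous_map_prod_top by (intro disjI2 conjI continuous_map_chart UV)
    then have "continuous_map (subtopology ?R N) euclidean (\<lambda>(p, q). (\<phi> p, \<psi> q))"
      by (simp add: UV(1) subtopology_Times euclidean_product_topology)
    then have "continuous_map (subtopology ?R N) euclidean ((\<lambda>(x, y). vjoin x y) \<circ> (\<lambda>(p, q). (\<phi> p, \<psi> q)))"
      by (rule continuous_map_compose) (use continuous_on_vjoin in \<open>simp add: continuous_map_iff_continuous2\<close>)
    moreover have "(\<lambda>(x, y). vjoin x y) \<circ> (\<lambda>(p, q). (\<phi> p, \<psi> q)) = h"
      unfolding UV by auto
    ultimately have "openin (subtopology ?R N) {x \<in> topspace (subtopology ?R N). h x \<in> S}"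
      using openin_continuous_map_preimage[of "subtopology ?R N" euclidean h S] S by simp
    moreover have "openin ?R N"
      unfolding UV(1) openin_prod_Times_iff
      by (intro disjI2 conjI openin_chart_domain[OF UV(3)] openin_chart_domain[OF UV(4)])
    ultimately have "openin ?R {x \<in> topspace (subtopology ?R N). h x \<in> S}"
      by (rule openin_trans_full)
    moreover have "{x \<in> topspace (subtopology ?R N). h x \<in> S} = {x \<in> topspace ?R. x \<in> N \<and> h x \<in> S}"
      by auto
    ultimately show "openin ?R {x \<in> topspace ?R. x \<in> N \<and> h x \<in> S}" by simp
  qed
  have "continuous_map ?L (atlas_topology A) fst"
  proof (rule continuous_map_atlasI)
    show "fst x \<in> carrier_of A" if "x \<in> topspace ?L" for x
      using that by (auto simp: topspace_atlas carrier_prod_atlas)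
    fix U \<phi> S assume U: "(U, \<phi>) \<in> A" and S: "open (S :: (complex ^ 'n) set)"
    let ?S = "(\<lambda>z::complex ^ ('n + 'm). \<chi> j. z $ Inl j) -` S"
    have S': "open ?S"
      by (rule open_vimage[OF S continuous_on_vec_lambda]) (intro continuous_intros)
    have "{x \<in> topspace ?L. fst x \<in> U \<and> \<phi> (fst x) \<in> S} =
        (\<Union>(V, \<psi>)\<in>B. {x \<in> U \<times> V. (\<lambda>(p, q). vjoin (\<phi> p) (\<psi> q)) x \<in> ?S})"
      using U by (auto simp: topspace_atlas carrier_prod_atlas carrier_ofI elim!: carrier_ofE)
    moreover have "openin ?L \<dots>"
      using openin_chart_preimage[OF prod_atlasI[OF U] S'] by (intro openin_Union) (auto simp only:)
    ultimately show "openin ?L {x \<in> topspace ?L. fst x \<in> U \<and> \<phi> (fst x) \<in> S}" by simp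
  qed
  moreover have "continuous_map ?L (atlas_topology B) snd"
  proof (rule continuous_map_atlasI)
    show "snd x \<in> carrier_of B" if "x \<in> topspace ?L" for x
      using that by (auto simp: topspace_atlas carrier_prod_atlas)
    fix V \<psi> S assume V: "(V, \<psi>) \<in> B" and S: "open (S :: (complex ^ 'm) set)"
    let ?S = "(\<lambda>z::complex ^ ('n + 'm). \<chi> j. z $ Inr j) -` S"
    have S': "open ?S"
      by (rule open_vimage[OF S continuous_on_vec_lambda]) (intro continuous_intros)
    have "{x \<in> topspace ?L. snd x \<in> V \<and> \<psi> (snd x) \<in> S} =
        (\<Union>(U, \<phi>)\<in>A. {x \<in> U \<times> V. (\<lambda>(p, q). vjoin (\<phi> p) (\<psi> q)) x \<in> ?S})"
      using V by (auto simp: topspace_atlas carrier_prod_atlas carrier_ofI elim!: carrier_ofE)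
    moreover have "openin ?L \<dots>"
      using openin_chart_preimage[OF prod_atlasI[OF _ V] S'] by (intro openin_Union) (auto simp only:)
    ultimately show "openin ?L {x \<in> topspace ?L. snd x \<in> V \<and> \<psi> (snd x) \<in> S}" by simp
  qed
  ultimately show "continuous_map ?L ?R (\<lambda>x. x)"
    by (simp add: continuous_map_pairwise comp_def)
qed

section \<open>The projective line\<close>

abbreviation psi1 :: "complex ^ 1 \<Rightarrow> cp1" where "psi1 x \<equiv> cp1_pt (x $ 1) 1"
abbreviation psi2 :: "complex ^ 1 \<Rightarrow> cp1" where "psi2 x \<equiv> cp1_pt 1 (x $ 1)"

lemma CP1_alt: "CP1 = {(range psi1, inv psi1), (range psi2, inv psi2)}"
  unfolding CP1_def by simp

lemma vec1_eq_iff: "(x::complex ^ 1) = y \<longleftrightarrow> x $ 1 = y $ 1"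
  by (simp add: vec_eq_iff forall_1)

lemma cp1_pt_scale:
  assumes c: "c \<noteq> 0"
  shows "cp1_pt (c * s) (c * t) = cp1_pt s t"
proof (intro equalityI subsetI)
  fix y assume "y \<in> cp1_pt (c * s) (c * t)"
  then obtain k where "k \<noteq> 0" "y = (k * (c * s), k * (c * t))" unfolding cp1_pt_def by blast
  then have "k * c \<noteq> 0 \<and> y = ((k * c) * s, (k * c) * t)" using c by (simp add: mult.assoc)
  then show "y \<in> cp1_pt s t" unfolding cp1_pt_def by blast
next
  fix y assume "y \<in> cp1_pt s t"
  then obtain k where "k \<noteq> 0" "y = (k * s, k * t)" unfolding cp1_pt_def by blast
  then have "k / c \<noteq> 0 \<and> y = ((k / c) * (c * s), (k / c) * (c * t))" using c by simp
  then show "y \<in> cp1_pt (c * s) (c * t)" unfolding cp1_pt_def by blast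
qed

lemma mem_cp1_pt: "(s, t) \<in> cp1_pt s t"
  unfolding cp1_pt_def by (auto intro!: exI[of _ 1])

text \<open>Both pairs must be nonzero: \<open>cp1_pt 0 0\<close> is the singleton of the origin and
  not a point of the line.\<close>

lemma cp1_pt_eq_iff:
  assumes "(s, t) \<noteq> (0, 0)" "(s', t') \<noteq> (0, 0)"
  shows "cp1_pt s t = cp1_pt s' t' \<longleftrightarrow> s * t' = s' * t"
proof
  assume "cp1_pt s t = cp1_pt s' t'"
  then have "(s', t') \<in> cp1_pt s t" using mem_cp1_pt by simp
  then show "s * t' = s' * t" unfolding cp1_pt_def by auto
next
  assume eq: "s * t' = s' * t"
  show "cp1_pt s t = cp1_pt s' t'"
  proof (cases "t = 0")
    case True
    then have "s \<noteq> 0" "t' = 0" using assms eq by auto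
    then show ?thesis using True assms cp1_pt_scale[of "s' / s" s t] by simp
  next
    case False
    then have "t' \<noteq> 0" using assms eq by auto
    moreover have "s' = (t' / t) * s" using False eq by (simp add: field_simps)
    ultimately show ?thesis using False cp1_pt_scale[of "t' / t" s t] by simp
  qed
qed

lemma inj_psi1: "inj psi1"
  by (rule injI) (simp add: cp1_pt_eq_iff vec1_eq_iff)

lemma inj_psi2: "inj psi2"
  by (rule injI) (simp add: cp1_pt_eq_iff vec1_eq_iff)

lemma psi_affine:
  "t \<noteq> 0 \<Longrightarrow> cp1_pt s t = psi1 (vec (s / t))" "s \<noteq> 0 \<Longrightarrow> cp1_pt s t = psi2 (vec (t / s))"
  by (auto simp: cp1_pt_eq_iff)

lemma range_psi1:
  assumes nz: "(s, t) \<noteq> (0, 0)"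
  shows "cp1_pt s t \<in> range psi1 \<longleftrightarrow> t \<noteq> 0"
proof
  assume "cp1_pt s t \<in> range psi1"
  then obtain x :: "complex ^ 1" where "cp1_pt s t = cp1_pt (x $ 1) 1" by (elim imageE)
  then have "s = x $ 1 * t" using cp1_pt_eq_iff[OF nz, of "x $ 1" 1] by simp
  then show "t \<noteq> 0" using nz by auto
next
  assume "t \<noteq> 0"
  from psi_affine(1)[OF this] show "cp1_pt s t \<in> range psi1" by (rule image_eqI) simp
qed

lemma range_psi2:
  assumes nz: "(s, t) \<noteq> (0, 0)"
  shows "cp1_pt s t \<in> range psi2 \<longleftrightarrow> s \<noteq> 0"
proof
  assume "cp1_pt s t \<in> range psi2"
  then obtain x :: "complex ^ 1" where "cp1_pt s t = cp1_pt 1 (x $ 1)" by (elim imageE)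
  then have "t = s * x $ 1" using cp1_pt_eq_iff[OF nz, of 1 "x $ 1"] by (simp add: mult.commute)
  then show "s \<noteq> 0" using nz by auto
next
  assume "s \<noteq> 0"
  from psi_affine(2)[OF this] show "cp1_pt s t \<in> range psi2" by (rule image_eqI) simp
qed

lemma inv_psi1: "t \<noteq> 0 \<Longrightarrow> inv psi1 (cp1_pt s t) = vec (s / t)"
  using psi_affine(1)[of t s] inv_f_f[OF inj_psi1, of "vec (s / t)"] by simp

lemma inv_psi2: "s \<noteq> 0 \<Longrightarrow> inv psi2 (cp1_pt s t) = vec (t / s)"
  using psi_affine(2)[of s t] inv_f_f[OF inj_psi2, of "vec (t / s)"] by simp

lemma carrier_CP1: "carrier_of CP1 = {cp1_pt s t |s t. (s, t) \<noteq> (0, 0)}"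
proof -
  have "carrier_of CP1 = range psi1 \<union> range psi2"
    unfolding carrier_of_def CP1_alt by auto
  also have "\<dots> = {cp1_pt s t |s t. (s, t) \<noteq> (0, 0)}" (is "_ = ?R")
  proof (rule equalityI)
    show "range psi1 \<union> range psi2 \<subseteq> ?R"
      by (intro Un_least image_subsetI CollectI exI) auto
    show "?R \<subseteq> range psi1 \<union> range psi2"
    proof
      fix P assume "P \<in> ?R"
      then obtain s t where "P = cp1_pt s t" "(s, t) \<noteq> (0, 0)" by (elim CollectE exE conjE)
      then show "P \<in> range psi1 \<union> range psi2"
        using range_psi1[of s t] range_psi2[of s t] by (cases "t = 0") simp_all
    qed
  qed
  finally show ?thesis .
qed

lemma cp1_pt_carrier [simp]: "cp1_pt s t \<in> carrier_of CP1 \<longleftrightarrow> (s, t) \<noteq> (0, 0)"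
proof
  assume "cp1_pt s t \<in> carrier_of CP1"
  then obtain s' t' where "cp1_pt s t = cp1_pt s' t'" and nz: "(s', t') \<noteq> (0, 0)"
    unfolding carrier_CP1 by (elim CollectE exE conjE)
  then have "(s', t') \<in> cp1_pt s t" using mem_cp1_pt[of s' t'] by simp
  then show "(s, t) \<noteq> (0, 0)" using nz unfolding cp1_pt_def by auto
next
  assume "(s, t) \<noteq> (0, 0)"
  then show "cp1_pt s t \<in> carrier_of CP1"
    unfolding carrier_CP1 by (intro CollectI exI[of _ s] exI[of _ t]) simp
qed

lemma carrier_CP1_E:
  assumes "P \<in> carrier_of CP1"
  obtains s t where "P = cp1_pt s t" "(s, t) \<noteq> (0, 0)"
  using assms that unfolding carrier_CP1 by (elim CollectE exE conjE)

lemma openin_preimage_on: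
  assumes f: "continuous_map X euclidean f" and h: "continuous_on T h" and T: "open T" and S: "open S"
  shows "openin X {x \<in> topspace X. f x \<in> T \<and> h (f x) \<in> S}"
proof -
  have "open (T \<inter> h -` S)" using continuous_open_preimage[OF h T S] .
  then show ?thesis
    using openin_continuous_map_preimage[OF f, of "T \<inter> h -` S"] by simp
qed

lemma continuous_map_cp1_pt:
  assumes f: "continuous_map X euclidean f" and g: "continuous_map X euclidean g"
    and nz: "\<And>x. x \<in> topspace X \<Longrightarrow> (f x, g x) \<noteq> (0, 0)"
  shows "continuous_map X (atlas_topology CP1) (\<lambda>x. cp1_pt (f x) (g x))"
proof (rule continuous_map_atlasI)
  show "cp1_pt (f x) (g x) \<in> carrier_of CP1" if "x \<in> topspace X" for x
    using nz[OF that] by simp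
  have fg: "continuous_map X euclidean (\<lambda>x. (f x, g x))"
    using continuous_map_pairedI[OF f g] by (simp add: euclidean_product_topology)
  fix U \<phi> S assume U: "(U, \<phi>) \<in> CP1" and S: "open (S :: (complex ^ 1) set)"
  have T1: "open {z::complex\<times>complex. snd z \<noteq> 0}" "open {z::complex\<times>complex. fst z \<noteq> 0}"
    by (auto intro!: open_Collect_neq continuous_intros)
  have c1: "continuous_on {z::complex\<times>complex. snd z \<noteq> 0} (\<lambda>z. vec (fst z / snd z) :: complex ^ 1)"
    and c2: "continuous_on {z::complex\<times>complex. fst z \<noteq> 0} (\<lambda>z. vec (snd z / fst z) :: complex ^ 1)"
    unfolding vec_def by (auto intro!: continuous_intros)
  from U consider "U = range psi1" "\<phi> = inv psi1" | "U = range psi2" "\<phi> = inv psi2"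
    unfolding CP1_alt by blast
  then show "openin X {x \<in> topspace X. cp1_pt (f x) (g x) \<in> U \<and> \<phi> (cp1_pt (f x) (g x)) \<in> S}"
  proof cases
    case 1
    have "{x \<in> topspace X. cp1_pt (f x) (g x) \<in> U \<and> \<phi> (cp1_pt (f x) (g x)) \<in> S} =
      {x \<in> topspace X. (f x, g x) \<in> {z. snd z \<noteq> 0} \<and> vec (fst (f x, g x) / snd (f x, g x)) \<in> S}"
      unfolding 1 by (intro Collect_cong conj_cong refl) (simp_all add: range_psi1[OF nz] inv_psi1)
    then show ?thesis using openin_preimage_on[OF fg c1 T1(1) S] by simp
  next
    case 2
    have "{x \<in> topspace X. cp1_pt (f x) (g x) \<in> U \<and> \<phi> (cp1_pt (f x) (g x)) \<in> S} =
      {x \<in> topspace X. (f x, g x) \<in> {z. fst z \<noteq> 0} \<and> vec (snd (f x, g x) / fst (f x, g x)) \<in> S}"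
      unfolding 2 by (intro Collect_cong conj_cong refl) (simp_all add: range_psi2[OF nz] inv_psi2)
    then show ?thesis using openin_preimage_on[OF fg c2 T1(2) S] by simp
  qed
qed

text \<open>The preimage of an open set is the union of its parts in the two affine charts, which
  are open by the two hypotheses.\<close>

lemma continuous_map_from_CP1:
  assumes "continuous_map euclidean Y (\<lambda>z. f (cp1_pt z 1))" "continuous_map euclidean Y (\<lambda>z. f (cp1_pt 1 z))"
  shows "continuous_map (atlas_topology CP1) Y f"
  unfolding continuous_map_def
proof (intro conjI allI impI)
  have "f P \<in> topspace Y" if "P \<in> carrier_of CP1" for P
    using that
  proof (rule carrier_CP1_E)
    fix s t assume P: "P = cp1_pt s t" "(s, t) \<noteq> (0, 0)"
    show ?thesis
    proof (cases "t = 0")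
      case True
      then have "P = cp1_pt 1 (t / s)" using psi_affine(2)[of s t] P by simp
      then show ?thesis using continuous_map_image_subset_topspace[OF assms(2)] by auto
    next
      case False
      then have "P = cp1_pt (s / t) 1" using psi_affine(1)[of t s] P by simp
      then show ?thesis using continuous_map_image_subset_topspace[OF assms(1)] by auto
    qed
  qed
  then show "f \<in> topspace (atlas_topology CP1) \<rightarrow> topspace Y"
    by (simp add: topspace_atlas)
  fix V assume V: "openin Y V"
  have o: "open {z. f (cp1_pt z 1) \<in> V}" "open {z. f (cp1_pt 1 z) \<in> V}"
    using openin_continuous_map_preimage[OF assms(1) V] openin_continuous_map_preimage[OF assms(2) V] by auto
  have o1: "open {x::complex ^ 1. f (cp1_pt (x $ 1) 1) \<in> V}"
    using open_vimage[OF o(1), of "\<lambda>x. x $ 1"] by (simp add: continuous_intros vimage_def)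
  have o2: "open {x::complex ^ 1. f (cp1_pt 1 (x $ 1)) \<in> V}"
    using open_vimage[OF o(2), of "\<lambda>x. x $ 1"] by (simp add: continuous_intros vimage_def)
  have "{P \<in> topspace (atlas_topology CP1). f P \<in> V} =
      {P \<in> range psi1. inv psi1 P \<in> {x. f (cp1_pt (x $ 1) 1) \<in> V}} \<union>
      {P \<in> range psi2. inv psi2 P \<in> {x. f (cp1_pt 1 (x $ 1)) \<in> V}}" (is "?L = ?R")
  proof
    show "?L \<subseteq> ?R"
    proof
      fix P assume P: "P \<in> ?L"
      then have "P \<in> range psi1 \<or> P \<in> range psi2"
        unfolding topspace_atlas carrier_of_def CP1_alt by auto
      then show "P \<in> ?R" using P inv_f_f[OF inj_psi1] inv_f_f[OF inj_psi2] by auto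
    qed
    show "?R \<subseteq> ?L" using inv_f_f[OF inj_psi1] inv_f_f[OF inj_psi2] by (auto simp: topspace_atlas)
  qed
  moreover have "openin (atlas_topology CP1) ?R"
    by (intro openin_Un openin_chart_preimage) (use o1 o2 in \<open>simp_all add: CP1_alt\<close>)
  ultimately show "openin (atlas_topology CP1) {P \<in> topspace (atlas_topology CP1). f P \<in> V}" by simp
qed

lemma continuous_map_psi:
  "continuous_map euclidean (atlas_topology CP1) (\<lambda>z. cp1_pt z 1)"
  "continuous_map euclidean (atlas_topology CP1) (\<lambda>z. cp1_pt 1 z)"
  by (rule continuous_map_cp1_pt; simp)+

lemma compact_space_CP1: "compact_space (atlas_topology CP1)"
proof -
  \<comment> \<open>Dividing by the coordinate of larger modulus puts every point into one of two
    closed unit discs.\<close>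
  let ?K = "(\<lambda>z. cp1_pt z 1) ` cball 0 1 \<union> (\<lambda>z. cp1_pt 1 z) ` cball 0 1"
  have "compactin (atlas_topology CP1) ?K"
    by (intro compactin_Un image_compactin[OF _ continuous_map_psi(1)] image_compactin[OF _ continuous_map_psi(2)])
      auto
  moreover have "?K = topspace (atlas_topology CP1)"
  proof
    show "?K \<subseteq> topspace (atlas_topology CP1)" by (auto simp: topspace_atlas)
    show "topspace (atlas_topology CP1) \<subseteq> ?K"
    proof
      fix P assume "P \<in> topspace (atlas_topology CP1)"
      then obtain s t where P: "P = cp1_pt s t" "(s, t) \<noteq> (0, 0)"
        unfolding topspace_atlas by (rule carrier_CP1_E)
      show "P \<in> ?K"
      proof (cases "norm s \<le> norm t")
        case True
        then have "t \<noteq> 0" "norm (s / t) \<le> 1" using P(2) by (auto simp: norm_divide divide_le_eq_1)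
        then show ?thesis using psi_affine(1)[of t s] P(1) by auto
      next
        case False
        then have "s \<noteq> 0" "norm (t / s) \<le> 1" using P(2) by (auto simp: norm_divide divide_le_eq_1)
        then show ?thesis using psi_affine(2)[of s t] P(1) by auto
      qed
    qed
  qed
  ultimately show ?thesis unfolding compact_space_def by simp
qed

lemma Hausdorff_space_CP1: "Hausdorff_space (atlas_topology CP1)"
proof -
  \<comment> \<open>This is the second column of the orthogonal projection onto the complex line
    through the point. It depends only on the line and determines it, giving a continuous injection
    into a Hausdorff space.\<close>
  define k where "k = (\<lambda>y::complex \<times> complex. let n = of_real ((norm (fst y))\<^sup>2 + (norm (snd y))\<^sup>2) in
    (fst y * cnj (snd y) / n, snd y * cnj (snd y) / n))"
  define K where "K = (\<lambda>P::cp1. k (SOME y. y \<in> P))"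
  have kc: "k (c * s, c * t) = k (s, t)" if "c \<noteq> 0" for c s t
  proof -
    have e: "complex_of_real ((norm (c * s))\<^sup>2 + (norm (c * t))\<^sup>2) =
        (c * cnj c) * of_real ((norm s)\<^sup>2 + (norm t)\<^sup>2)"
      by (simp add: norm_mult power_mult_distrib algebra_simps complex_norm_square[symmetric])
    have "(c * x * cnj (c * t)) / ((c * cnj c) * n) = x * cnj t / n" for x n
      using that by (simp add: mult_ac divide_simps)
    then show ?thesis unfolding k_def Let_def fst_conv snd_conv e by simp
  qed
  have K: "K (cp1_pt s t) = k (s, t)" for s t
  proof -
    have "(SOME y. y \<in> cp1_pt s t) \<in> cp1_pt s t" using mem_cp1_pt someI_ex by metis
    then obtain c where "c \<noteq> 0" "(SOME y. y \<in> cp1_pt s t) = (c * s, c * t)"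
      unfolding cp1_pt_def by blast
    then show ?thesis unfolding K_def by (simp add: kc)
  qed
  have nz: "complex_of_real ((norm s)\<^sup>2 + (norm t)\<^sup>2) \<noteq> 0" if "(s, t) \<noteq> (0, 0)" for s t :: complex
    using that unfolding of_real_eq_0_iff by (simp add: sum_power2_eq_zero_iff)
  have "continuous_map (atlas_topology CP1) euclidean K"
    by (rule continuous_map_from_CP1; unfold K k_def Let_def fst_conv snd_conv continuous_map_iff_continuous2)
      (intro continuous_intros ballI nz; simp)+
  moreover have "inj_on K (topspace (atlas_topology CP1))"
  proof (rule inj_onI)
    fix P P' assume PP: "P \<in> topspace (atlas_topology CP1)" "P' \<in> topspace (atlas_topology CP1)" and eq: "K P = K P'"
    obtain s t where P1: "P = cp1_pt s t" "(s, t) \<noteq> (0, 0)"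
      using PP(1) unfolding topspace_atlas by (rule carrier_CP1_E)
    obtain s' t' where P2: "P' = cp1_pt s' t'" "(s', t') \<noteq> (0, 0)"
      using PP(2) unfolding topspace_atlas by (rule carrier_CP1_E)
    note P = P1 P2
    define n where "n = complex_of_real ((norm s)\<^sup>2 + (norm t)\<^sup>2)"
    define n' where "n' = complex_of_real ((norm s')\<^sup>2 + (norm t')\<^sup>2)"
    have nn: "n \<noteq> 0" "n' \<noteq> 0" using nz P unfolding n_def n'_def by blast+
    have "k (s, t) = k (s', t')" using eq K P by simp
    then have e: "s * cnj t / n = s' * cnj t' / n'" "t * cnj t / n = t' * cnj t' / n'"
      unfolding k_def Let_def fst_conv snd_conv n_def n'_def by auto
    have "s * t' = s' * t"
    proof (cases "t = 0")
      case True
      then have "t' = 0" using e(2) nn by auto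
      then show ?thesis using True by simp
    next
      case False
      then have t': "t' \<noteq> 0" using e(2) nn by auto
      have "(s * cnj t / n) * (t' * cnj t' / n') = (s' * cnj t' / n') * (t * cnj t / n)"
        using e by simp
      then have "(s * t') * (cnj t * cnj t' / (n * n')) = (s' * t) * (cnj t * cnj t' / (n * n'))"
        by (simp add: mult_ac)
      then show ?thesis using nn False t' by simp
    qed
    then show "P = P'" using P cp1_pt_eq_iff by simp
  qed
  ultimately show ?thesis
    by (rule Hausdorff_space_injective_preimage[OF Hausdorff_space_euclidean])
qed

section \<open>Split bundles on the projective line\<close>

lemma inv_into_range_psi1: "inv_into (range psi1) (inv psi1) x = psi1 x"
  by (rule inv_into_f_eq[OF inj_on_inv_into]) (auto intro: inv_f_f[OF inj_psi1])

lemma inv_into_range_psi2: "inv_into (range psi2) (inv psi2) x = psi2 x"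
  by (rule inv_into_f_eq[OF inj_on_inv_into]) (auto intro: inv_f_f[OF inj_psi2])

lemma inv_image_range:
  assumes "inj f"
  shows "inv f ` (range f \<inter> D) = {x. f x \<in> D}"
proof (intro equalityI subsetI)
  fix x assume "x \<in> {x. f x \<in> D}"
  then have "f x \<in> range f \<inter> D" by simp
  then show "x \<in> inv f ` (range f \<inter> D)"
    by (rule rev_image_eqI) (simp add: inv_f_f[OF assms])
qed (auto simp: inv_f_f[OF assms])

lemmas inv_psi1_image = inv_image_range[OF inj_psi1]
lemmas inv_psi2_image = inv_image_range[OF inj_psi2]

text \<open>Functions on \<open>complex ^ 1\<close> are translated into functions of one complex
  variable, so that the one-variable theory applies to bundles on the projective line.\<close>

lemma holo_at_vec1:
  fixes f :: "complex ^ 1 \<Rightarrow> complex ^ 'm::finite"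
  shows "holo_at f x \<longleftrightarrow> (\<forall>i. (\<lambda>z. f (vec z) $ i) field_differentiable at (x $ 1))"
proof
  assume f: "holo_at f x"
  have x: "vec (x $ 1) = x" by (simp add: vec1_eq_iff)
  have "((\<lambda>z. (vec z :: complex ^ 1) $ j) has_field_derivative vec 1 $ j) (at (x $ 1))" for j
    by (auto intro!: derivative_eq_intros)
  from holo_at_curve[where \<gamma> = vec, OF _ this] f x
  show "\<forall>i. (\<lambda>z. f (vec z) $ i) field_differentiable at (x $ 1)"
    unfolding field_differentiable_def by metis
next
  assume "\<forall>i. (\<lambda>z. f (vec z) $ i) field_differentiable at (x $ 1)"
  then have "cdiff (\<lambda>x. f (vec (x $ 1)) $ i) x" for i
    by (intro cdiff_field[where g = "\<lambda>z. f (vec z) $ i"]) simp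
  moreover have "(vec (y $ 1) :: complex ^ 1) = y" for y by (simp add: vec1_eq_iff)
  ultimately show "holo_at f x" by (intro holo_atI) simp
qed

definition holo_cp1 :: "(cp1 \<Rightarrow> complex) \<Rightarrow> cp1 set \<Rightarrow> bool" where
  "holo_cp1 f D \<longleftrightarrow>
     (\<forall>z. cp1_pt z 1 \<in> D \<longrightarrow> (\<lambda>z. f (cp1_pt z 1)) field_differentiable at z) \<and>
     (\<forall>z. cp1_pt 1 z \<in> D \<longrightarrow> (\<lambda>z. f (cp1_pt 1 z)) field_differentiable at z)"

lemma holo_matrix_on_CP1_iff: "holo_matrix_on CP1 g D \<longleftrightarrow> (\<forall>r c. holo_cp1 (\<lambda>P. g P $ r $ c) D)"
proof -
  have all1: "(\<forall>x::complex ^ 1. Q (x $ 1)) \<longleftrightarrow> (\<forall>z. Q z)" for Q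
    by (metis vec_component)
  have 1: "holo_on (\<lambda>x. \<chi> r. g (inv_into (range psi1) (inv psi1) x) $ r $ c) (inv psi1 ` (range psi1 \<inter> D))
      \<longleftrightarrow> (\<forall>r z. cp1_pt z 1 \<in> D \<longrightarrow> (\<lambda>z. g (cp1_pt z 1) $ r $ c) field_differentiable at z)" for c
    unfolding holo_on_iff inv_psi1_image inv_into_range_psi1 holo_at_vec1 mem_Collect_eq Ball_def
    by (simp add: all1[where Q = "\<lambda>z. cp1_pt z 1 \<in> D \<longrightarrow> (\<forall>i. (\<lambda>z. g (cp1_pt z 1) $ i $ c) field_differentiable at z)"]) blast
  have 2: "holo_on (\<lambda>x. \<chi> r. g (inv_into (range psi2) (inv psi2) x) $ r $ c) (inv psi2 ` (range psi2 \<inter> D))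
      \<longleftrightarrow> (\<forall>r z. cp1_pt 1 z \<in> D \<longrightarrow> (\<lambda>z. g (cp1_pt 1 z) $ r $ c) field_differentiable at z)" for c
    unfolding holo_on_iff inv_psi2_image inv_into_range_psi2 holo_at_vec1 mem_Collect_eq Ball_def
    by (simp add: all1[where Q = "\<lambda>z. cp1_pt 1 z \<in> D \<longrightarrow> (\<forall>i. (\<lambda>z. g (cp1_pt 1 z) $ i $ c) field_differentiable at z)"]) blast
  show ?thesis
    unfolding holo_matrix_on_def holo_cp1_def CP1_alt by (simp add: 1 2) blast
qed

lemma holo_cp1_subset: "holo_cp1 f D \<Longrightarrow> D' \<subseteq> D \<Longrightarrow> holo_cp1 f D'"
  unfolding holo_cp1_def by blast

lemma holo_cp1_const: "holo_cp1 (\<lambda>P. c) D"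
  unfolding holo_cp1_def by simp

lemma holo_cp1_mult: "holo_cp1 f D \<Longrightarrow> holo_cp1 g D \<Longrightarrow> holo_cp1 (\<lambda>P. f P * g P) D"
  unfolding holo_cp1_def by (simp add: field_differentiable_mult)

lemma holo_cp1_sum: "(\<And>i. i \<in> I \<Longrightarrow> holo_cp1 (f i) D) \<Longrightarrow> holo_cp1 (\<lambda>P. \<Sum>i\<in>I. f i P) D"
  unfolding holo_cp1_def by (auto intro!: field_differentiable_sum)

lemma field_differentiable_cong_open:
  assumes "f field_differentiable at z" "open S" "z \<in> S" "\<And>w. w \<in> S \<Longrightarrow> f w = g w"
  shows "g field_differentiable at z"
  using assms unfolding field_differentiable_def by (meson has_field_derivative_transform_within_open)

text \<open>The formulas \<open>p\<close> and \<open>q\<close> need to agree with \<open>f\<close>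
  only on \<open>D\<close>; as \<open>D\<close> is open, this is a neighbourhood of each of its
  points.\<close>

lemma holo_cp1_ratio:
  assumes "\<And>z. cp1_pt z 1 \<in> D \<Longrightarrow> f (cp1_pt z 1) = p z \<and> p field_differentiable at z"
    "\<And>z. cp1_pt 1 z \<in> D \<Longrightarrow> f (cp1_pt 1 z) = q z \<and> q field_differentiable at z"
    "openin (atlas_topology CP1) D"
  shows "holo_cp1 f D"
proof -
  have o: "open {z. cp1_pt z 1 \<in> D}" "open {z. cp1_pt 1 z \<in> D}"
    using openin_continuous_map_preimage[OF continuous_map_psi(1) assms(3)]
      openin_continuous_map_preimage[OF continuous_map_psi(2) assms(3)] by auto
  show ?thesis
    unfolding holo_cp1_def
  proof (intro conjI allI impI)
    fix z assume z: "cp1_pt z 1 \<in> D"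
    show "(\<lambda>z. f (cp1_pt z 1)) field_differentiable at z"
      by (rule field_differentiable_cong_open[OF conjunct2[OF assms(1)[OF z]] o(1)])
        (simp_all add: z conjunct1[OF assms(1)])
  next
    fix z assume z: "cp1_pt 1 z \<in> D"
    show "(\<lambda>z. f (cp1_pt 1 z)) field_differentiable at z"
      by (rule field_differentiable_cong_open[OF conjunct2[OF assms(2)[OF z]] o(2)])
        (simp_all add: z conjunct1[OF assms(2)])
  qed
qed

lemma holo_matrix_mult:
  assumes "holo_matrix_on CP1 g D" "holo_matrix_on CP1 h D'"
  shows "holo_matrix_on CP1 (\<lambda>P. g P ** h P) (D \<inter> D')"
  unfolding holo_matrix_on_CP1_iff matrix_matrix_mult_def vec_lambda_beta
proof (intro allI holo_cp1_sum holo_cp1_mult)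
  show "holo_cp1 (\<lambda>P. g P $ r $ k) (D \<inter> D')" for r k
    by (rule holo_cp1_subset[of _ D]) (use assms(1) in \<open>simp_all add: holo_matrix_on_CP1_iff\<close>)
  show "holo_cp1 (\<lambda>P. h P $ k $ c) (D \<inter> D')" for k c
    by (rule holo_cp1_subset[of _ D']) (use assms(2) in \<open>simp_all add: holo_matrix_on_CP1_iff\<close>)
qed

lemma holo_matrix_on_subset: "holo_matrix_on CP1 g D \<Longrightarrow> D' \<subseteq> D \<Longrightarrow> holo_matrix_on CP1 g D'"
  unfolding holo_matrix_on_CP1_iff using holo_cp1_subset by blast

lemma openin_range_psi: "openin (atlas_topology CP1) (range psi1)" "openin (atlas_topology CP1) (range psi2)"
  by (rule openin_chart_domain[of _ "inv psi1"], simp add: CP1_alt)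
    (rule openin_chart_domain[of _ "inv psi2"], simp add: CP1_alt)

lemma split_trans:
  assumes "(s, t) \<noteq> (0, 0)" "i \<in> {fst, snd}" "j \<in> {fst, snd}"
  shows "btrans (split_bundle d) i j (cp1_pt s t) = (\<chi> r c. if r = c then (j (s, t) / i (s, t)) powi d r else 0)"
proof -
  have "(SOME y. y \<in> cp1_pt s t) \<in> cp1_pt s t" using mem_cp1_pt someI_ex by metis
  then obtain c where c: "c \<noteq> 0" "(SOME y. y \<in> cp1_pt s t) = (c * s, c * t)"
    unfolding cp1_pt_def by blast
  have "j (c * s, c * t) / i (c * s, c * t) = j (s, t) / i (s, t)"
    using assms c(1) by auto
  then show ?thesis by (simp add: split_bundle_def Let_def c(2) cong: if_cong)
qed

lemma split_index: "bindex (split_bundle d) = {fst, snd}"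
  by (simp add: split_bundle_def)

text \<open>The order is crossed: where the first homogeneous coordinate is nonzero the point is
  \<open>cp1_pt 1 x\<close>, in the range of \<open>psi2\<close>, and \<open>snd\<close> belongs to
  \<open>psi1\<close>.\<close>

lemma split_dom: "bdom (split_bundle d) fst = range psi2" "bdom (split_bundle d) snd = range psi1"
proof -
  have "P \<in> bdom (split_bundle d) fst \<longleftrightarrow> P \<in> range psi2"
    "P \<in> bdom (split_bundle d) snd \<longleftrightarrow> P \<in> range psi1" for P
  proof -
    have r: "P \<in> carrier_of CP1" if "P \<in> range psi1 \<or> P \<in> range psi2" using that by auto
    show "P \<in> bdom (split_bundle d) fst \<longleftrightarrow> P \<in> range psi2"
      "P \<in> bdom (split_bundle d) snd \<longleftrightarrow> P \<in> range psi1"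
    proof (atomize (full), cases "P \<in> carrier_of CP1")
      case True
      then obtain s t where P: "P = cp1_pt s t" "(s, t) \<noteq> (0, 0)" by (rule carrier_CP1_E)
      have "(\<exists>y\<in>cp1_pt s t. fst y \<noteq> 0) \<longleftrightarrow> s \<noteq> 0" "(\<exists>y\<in>cp1_pt s t. snd y \<noteq> 0) \<longleftrightarrow> t \<noteq> 0"
      proof -
        have "fst y \<noteq> 0 \<longleftrightarrow> s \<noteq> 0" "snd y \<noteq> 0 \<longleftrightarrow> t \<noteq> 0" if "y \<in> cp1_pt s t" for y
          using that unfolding cp1_pt_def by auto
        then show "(\<exists>y\<in>cp1_pt s t. fst y \<noteq> 0) \<longleftrightarrow> s \<noteq> 0" "(\<exists>y\<in>cp1_pt s t. snd y \<noteq> 0) \<longleftrightarrow> t \<noteq> 0"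
          using mem_cp1_pt[of s t] by blast+
      qed
      then show "(P \<in> bdom (split_bundle d) fst \<longleftrightarrow> P \<in> range psi2) \<and>
          (P \<in> bdom (split_bundle d) snd \<longleftrightarrow> P \<in> range psi1)"
        using True unfolding split_bundle_def P by (simp add: range_psi1[OF P(2)] range_psi2[OF P(2)])
    next
      case False
      then show "(P \<in> bdom (split_bundle d) fst \<longleftrightarrow> P \<in> range psi2) \<and>
          (P \<in> bdom (split_bundle d) snd \<longleftrightarrow> P \<in> range psi1)"
        using r unfolding split_bundle_def by auto
    qed
  qed
  then show "bdom (split_bundle d) fst = range psi2" "bdom (split_bundle d) snd = range psi1" by blast+
qed

lemma fst_neq_snd: "(fst :: complex \<times> complex \<Rightarrow> complex) \<noteq> snd"
  by (metis fst_conv snd_conv zero_neq_one)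

lemma carrier_CP1_psi: "carrier_of CP1 = range psi1 \<union> range psi2"
  unfolding carrier_of_def CP1_alt by auto

lemma range_psi_Int_E:
  assumes "P \<in> range psi1" "P \<in> range psi2"
  obtains x where "x \<noteq> 0" "P = cp1_pt x 1" "P = cp1_pt 1 (1 / x)"
proof -
  obtain v :: "complex ^ 1" where v: "P = cp1_pt (v $ 1) 1" using assms(1) by (elim imageE)
  then have nz: "v $ 1 \<noteq> 0" using assms(2) range_psi2[of "v $ 1" 1] by simp
  then have "P = cp1_pt 1 (1 / v $ 1)" unfolding v by (subst cp1_pt_eq_iff) auto
  then show ?thesis using that nz v by blast
qed

lemma holo_bundle_split: "holo_bundle CP1 (split_bundle (d :: 2 \<Rightarrow> int))"
proof -
  let ?F = "split_bundle d"
  have ne: "i (s, t) \<noteq> 0" if "cp1_pt s t \<in> bdom ?F i" "(s, t) \<noteq> (0, 0)" "i \<in> {fst, snd}" for i s t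
    using that split_dom[of d] range_psi1[OF that(2)] range_psi2[OF that(2)] by auto
  have car: "bdom ?F i \<subseteq> carrier_of CP1" if "i \<in> {fst, snd}" for i
    using that split_dom[of d] carrier_CP1_psi by auto
  have op: "openin (atlas_topology CP1) (bdom ?F i)" if "i \<in> {fst, snd}" for i
    using that split_dom[of d] openin_range_psi by auto
  have holo: "holo_matrix_on CP1 (btrans ?F i j) (bdom ?F i \<inter> bdom ?F j)"
    if ij: "i \<in> {fst, snd}" "j \<in> {fst, snd}" for i j
    unfolding holo_matrix_on_CP1_iff
  proof (intro allI)
    fix r c :: 2
    show "holo_cp1 (\<lambda>P. btrans ?F i j P $ r $ c) (bdom ?F i \<inter> bdom ?F j)"
    proof (rule holo_cp1_ratio)
      show "openin (atlas_topology CP1) (bdom ?F i \<inter> bdom ?F j)" using op ij by blast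
      fix z
      have D: "(\<lambda>z. if r = c then (u z / w z) powi d r else 0) field_differentiable at z"
        if "u field_differentiable at z" "w field_differentiable at z" "u z \<noteq> 0" "w z \<noteq> 0"
        for u w :: "complex \<Rightarrow> complex"
      proof -
        have "(\<lambda>z. u z / w z) field_differentiable at z"
          by (rule field_differentiable_divide) (use that in auto)
        then obtain k where "((\<lambda>z. u z / w z) has_field_derivative k) (at z)"
          unfolding field_differentiable_def by blast
        from DERIV_power_int[OF this] that have "(\<lambda>z. (u z / w z) powi d r) field_differentiable at z"
          unfolding field_differentiable_def by auto
        then show ?thesis by (cases "r = c") auto
      qed
      have proj: "(\<lambda>z. i (z, 1)) field_differentiable at z" "(\<lambda>z. i (1, z)) field_differentiable at z"
        if "i \<in> {fst, snd}" for i :: "complex \<times> complex \<Rightarrow> complex" using that by auto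
      show "btrans ?F i j (cp1_pt z 1) $ r $ c = (if r = c then (j (z, 1) / i (z, 1)) powi d r else 0) \<and>
          (\<lambda>z. if r = c then (j (z, 1) / i (z, 1)) powi d r else 0) field_differentiable at z"
        if "cp1_pt z 1 \<in> bdom ?F i \<inter> bdom ?F j"
        using that ij by (intro conjI D proj ne) (auto simp: split_trans)
      show "btrans ?F i j (cp1_pt 1 z) $ r $ c = (if r = c then (j (1, z) / i (1, z)) powi d r else 0) \<and>
          (\<lambda>z. if r = c then (j (1, z) / i (1, z)) powi d r else 0) field_differentiable at z"
        if "cp1_pt 1 z \<in> bdom ?F i \<inter> bdom ?F j"
        using that ij by (intro conjI D proj ne) (auto simp: split_trans)
    qed
  qed
  have coc: "btrans ?F i j P ** btrans ?F j k P = btrans ?F i k P"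
    if ijk: "i \<in> {fst, snd}" "j \<in> {fst, snd}" "k \<in> {fst, snd}"
      and P: "P \<in> bdom ?F i" "P \<in> bdom ?F j" "P \<in> bdom ?F k" for i j k P
  proof -
    obtain s t where st: "P = cp1_pt s t" "(s, t) \<noteq> (0, 0)"
      using P(1) car[OF ijk(1)] carrier_CP1_E by blast
    have n: "i (s, t) \<noteq> 0" "j (s, t) \<noteq> 0" "k (s, t) \<noteq> 0"
      using P ijk st ne by blast+
    have "(j (s, t) / i (s, t)) powi e * (k (s, t) / j (s, t)) powi e = (k (s, t) / i (s, t)) powi e" for e
      using n by (simp flip: power_int_mult_distrib)
    then show ?thesis
      unfolding st split_trans[OF st(2) ijk(1,2)] split_trans[OF st(2) ijk(2,3)] split_trans[OF st(2) ijk(1,3)]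
      by (simp add: vec_eq_iff matrix_matrix_mult_def forall_2 sum_2)
  qed
  have self: "btrans ?F i i P = mat 1" if i: "i \<in> {fst, snd}" and P: "P \<in> bdom ?F i" for i P
  proof -
    obtain s t where st: "P = cp1_pt s t" "(s, t) \<noteq> (0, 0)"
      using P(1) car[OF i] carrier_CP1_E by blast
    have "i (s, t) \<noteq> 0" using P i st ne by blast
    then show ?thesis unfolding st split_trans[OF st(2) i i] by (simp add: vec_eq_iff mat_def)
  qed
  have inv: "invertible (btrans ?F i j P)" if "i \<in> {fst, snd}" "j \<in> {fst, snd}" "P \<in> bdom ?F i" "P \<in> bdom ?F j" for i j P
    unfolding invertible_def using coc self that by metis
  show ?thesis
    unfolding holo_bundle_def split_index
  proof (intro conjI ballI)
    show "(\<Union>i\<in>{fst, snd}. bdom ?F i) = carrier_of CP1"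
      using split_dom[of d] carrier_CP1_psi by auto
  qed (use op holo inv coc in \<open>auto simp del: insert_iff\<close>)
qed

text \<open>The cocycle law makes this matrix idempotent, and an invertible idempotent is the
  identity.\<close>

lemma bundle_trans_self:
  assumes E: "holo_bundle A E" and i: "i \<in> bindex E" and p: "p \<in> bdom E i"
  shows "btrans E i i p = mat 1"
proof -
  have "invertible (btrans E i i p)" "btrans E i i p ** btrans E i i p = btrans E i i p"
    using E i p unfolding holo_bundle_def by blast+
  then show ?thesis
    by (metis invertible_def matrix_mul_assoc matrix_mul_lid)
qed

lemma bundle_cocycle:
  assumes "holo_bundle A E" "i \<in> bindex E" "j \<in> bindex E" "k \<in> bindex E"
    and "p \<in> bdom E i" "p \<in> bdom E j" "p \<in> bdom E k"
  shows "btrans E i j p ** btrans E j k p = btrans E i k p"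
  using assms unfolding holo_bundle_def by blast

text \<open>The bundle may have many more trivialisations than the two that cover the line. It is
  enough to give the isomorphism in those two; the cocycle law extends it to all others.\<close>

lemma bundle_iso_splitI:
  fixes E :: "('i, cp1, 2) vbundle" and d :: "2 \<Rightarrow> int"
  assumes E: "holo_bundle CP1 E" and i3: "i3 \<in> bindex E" and i2: "i2 \<in> bindex E"
    and dom: "bdom E i3 = range psi1" "bdom E i2 = range psi2"
    and M1: "holo_matrix_on CP1 M1 (range psi1)" "\<And>P. P \<in> range psi1 \<Longrightarrow> invertible (M1 P)"
    and M2: "holo_matrix_on CP1 M2 (range psi2)" "\<And>P. P \<in> range psi2 \<Longrightarrow> invertible (M2 P)"
    and T: "\<And>x. x \<noteq> 0 \<Longrightarrow> btrans E i2 i3 (cp1_pt x 1) ** M1 (cp1_pt x 1) =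
      M2 (cp1_pt x 1) ** btrans (split_bundle d) fst snd (cp1_pt x 1)"
  shows "bundle_iso CP1 E (split_bundle d)"
proof -
  let ?F = "split_bundle d"
  define c where "c = (\<lambda>k::complex \<times> complex \<Rightarrow> complex. if k = fst then i2 else i3)"
  define M where "M = (\<lambda>k::complex \<times> complex \<Rightarrow> complex. if k = fst then M2 else M1)"
  note F = holo_bundle_split[of d]
  have cM [simp]: "c fst = i2" "c snd = i3" "M fst = M2" "M snd = M1"
    using fst_neq_snd unfolding c_def M_def by auto
  have ci: "c k \<in> bindex E" if "k \<in> {fst, snd}" for k using that i2 i3 by auto
  have cd: "bdom E (c k) = bdom ?F k" if "k \<in> {fst, snd}" for k
    using that dom split_dom[of d] by auto
  have Mh: "holo_matrix_on CP1 (M k) (bdom ?F k)" if "k \<in> {fst, snd}" for k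
    using that M1 M2 split_dom[of d] by auto
  have Mi: "invertible (M k P)" if "k \<in> {fst, snd}" "P \<in> bdom ?F k" for k P
    using that M1 M2 split_dom[of d] by auto
  have key: "M k P ** btrans ?F k l P = btrans E (c k) (c l) P ** M l P"
    if k: "k \<in> {fst, snd}" and l: "l \<in> {fst, snd}" and P: "P \<in> bdom ?F k" "P \<in> bdom ?F l" for k l P
  proof (cases "k = l")
    case True
    have "btrans ?F k k P = mat 1" "btrans E (c k) (c k) P = mat 1"
      using bundle_trans_self[OF F, of k P] bundle_trans_self[OF E ci[OF k], of P] k P cd[OF k]
      by (auto simp: split_index)
    then show ?thesis using True by simp
  next
    case False
    \<comment> \<open>For different indices the point lies in both affine charts. The order
      \<open>fst\<close>, \<open>snd\<close> is the hypothesis \<open>T\<close>; the opposite order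
      follows by inverting both transition matrices.\<close>
    then have in12: "P \<in> range psi1" "P \<in> range psi2" using k l P split_dom[of d] by auto
    obtain x where x: "x \<noteq> 0" "P = cp1_pt x 1" using in12 by (rule range_psi_Int_E)
    have T': "btrans E i2 i3 P ** M1 P = M2 P ** btrans ?F fst snd P" using T[OF x(1)] x(2) by simp
    show ?thesis
    proof (cases "k = fst")
      case True
      then show ?thesis using False l T' by auto
    next
      case False
      then have kl: "k = snd" "l = fst" using k l \<open>k \<noteq> l\<close> by auto
      have e: "btrans E i3 i2 P ** btrans E i2 i3 P = mat 1"
        using bundle_cocycle[OF E i3 i2 i3] bundle_trans_self[OF E i3] dom in12 by auto
      have f: "btrans ?F fst snd P ** btrans ?F snd fst P = mat 1"
        using bundle_cocycle[OF F, of fst snd fst P] bundle_trans_self[OF F, of fst P] in12 split_dom[of d]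
        by (auto simp: split_index)
      have "btrans E i3 i2 P ** M2 P = btrans E i3 i2 P ** (M2 P ** (btrans ?F fst snd P ** btrans ?F snd fst P))"
        unfolding f by simp
      also have "\<dots> = btrans E i3 i2 P ** ((M2 P ** btrans ?F fst snd P) ** btrans ?F snd fst P)"
        by (simp add: matrix_mul_assoc)
      also have "\<dots> = (btrans E i3 i2 P ** btrans E i2 i3 P) ** (M1 P ** btrans ?F snd fst P)"
        unfolding T'[symmetric] by (simp add: matrix_mul_assoc)
      finally show ?thesis unfolding kl e by simp
    qed
  qed
  \<comment> \<open>The isomorphism in an arbitrary trivialisation \<open>i\<close> is first carried
    to the chosen trivialisation \<open>c k\<close> and then expressed by
    \<open>M k\<close>.\<close>
  define h where "h = (\<lambda>i k P. btrans E i (c k) P ** M k P)"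
  have hh: "holo_matrix_on CP1 (h i k) (bdom E i \<inter> bdom ?F k)"
    if "i \<in> bindex E" "k \<in> {fst, snd}" for i k
  proof -
    have "holo_matrix_on CP1 (btrans E i (c k)) (bdom E i \<inter> bdom E (c k))"
      using E that(1) ci[OF that(2)] unfolding holo_bundle_def by blast
    from holo_matrix_mult[OF this Mh[OF that(2)]] show ?thesis
      unfolding h_def cd[OF that(2)] by (rule holo_matrix_on_subset) blast
  qed
  have hi: "invertible (h i k P)"
    if "i \<in> bindex E" "k \<in> {fst, snd}" "P \<in> bdom E i" "P \<in> bdom ?F k" for i k P
  proof -
    have "invertible (btrans E i (c k) P)"
      using E that ci[OF that(2)] cd[OF that(2)] unfolding holo_bundle_def by blast
    then show ?thesis unfolding h_def using Mi[OF that(2,4)] invertible_mult by blast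
  qed
  have hc: "btrans E i j P ** h j l P = h i k P ** btrans ?F k l P"
    if "i \<in> bindex E" "j \<in> bindex E" "k \<in> {fst, snd}" "l \<in> {fst, snd}"
      "P \<in> bdom E i" "P \<in> bdom E j" "P \<in> bdom ?F k" "P \<in> bdom ?F l" for i j k l P
  proof -
    have P: "P \<in> bdom E (c k)" "P \<in> bdom E (c l)" using that cd by auto
    have "h i k P ** btrans ?F k l P = btrans E i (c k) P ** (M k P ** btrans ?F k l P)"
      unfolding h_def by (simp add: matrix_mul_assoc)
    also have "\<dots> = (btrans E i (c k) P ** btrans E (c k) (c l) P) ** M l P"
      unfolding key[OF that(3,4,7,8)] by (simp add: matrix_mul_assoc)
    also have "\<dots> = btrans E i (c l) P ** M l P"
      by (simp add: bundle_cocycle[OF E that(1) ci[OF that(3)] ci[OF that(4)] that(5) P])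
    also have "\<dots> = btrans E i j P ** h j l P"
      unfolding h_def matrix_mul_assoc
      by (simp add: bundle_cocycle[OF E that(1,2) ci[OF that(4)] that(5,6) P(2)])
    finally show ?thesis ..
  qed
  show ?thesis
    unfolding bundle_iso_def split_index
    by (intro conjI E F exI[of _ h] ballI hh hi hc) (simp_all del: insert_iff)
qed

section \<open>Rank two bundles with an upper triangular transition matrix\<close>

definition mk2 :: "complex \<Rightarrow> complex \<Rightarrow> complex \<Rightarrow> complex \<Rightarrow> complex ^ 2 ^ 2" where
  "mk2 a b c d = (\<chi> i j. if i = 1 then (if j = 1 then a else b) else (if j = 1 then c else d))"

lemma mk2_nth [simp]: "mk2 a b c d $ 1 $ 1 = a" "mk2 a b c d $ 1 $ 2 = b"
  "mk2 a b c d $ 2 $ 1 = c" "mk2 a b c d $ 2 $ 2 = d"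
  by (simp_all add: mk2_def)

lemma mk2_mult: "mk2 a b c d ** mk2 a' b' c' d' =
    mk2 (a * a' + b * c') (a * b' + b * d') (c * a' + d * c') (c * b' + d * d')"
  by (simp add: vec_eq_iff forall_2 matrix_matrix_mult_def sum_2)

lemma invertible_mk2: "a * d - b * c \<noteq> 0 \<Longrightarrow> invertible (mk2 a b c d)"
  by (simp add: invertible_det_nz det_2)

lemma holo_matrix_mk2:
  assumes "holo_cp1 a D" "holo_cp1 b D" "holo_cp1 c D" "holo_cp1 d D"
  shows "holo_matrix_on CP1 (\<lambda>P. mk2 (a P) (b P) (c P) (d P)) D"
  using assms by (simp add: holo_matrix_on_CP1_iff forall_2)

lemma holo_cp1_affine:
  "holo_cp1 (\<lambda>P. inv psi1 P $ 1) (range psi1)" "holo_cp1 (\<lambda>P. inv psi2 P $ 1) (range psi2)"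
proof -
  have nz1: "z \<noteq> 0" if "cp1_pt 1 z \<in> range psi1" for z using that range_psi1[of 1 z] by simp
  have nz2: "z \<noteq> 0" if "cp1_pt z 1 \<in> range psi2" for z using that range_psi2[of z 1] by simp
  have d: "(\<lambda>z. 1 / z) field_differentiable at z" if "z \<noteq> 0" for z :: complex
    by (intro field_differentiable_divide) (use that in auto)
  show "holo_cp1 (\<lambda>P. inv psi1 P $ 1) (range psi1)"
    by (rule holo_cp1_ratio[where p = "\<lambda>z. z" and q = "\<lambda>z. 1 / z"])
      (use nz1 d openin_range_psi in \<open>simp_all add: inv_psi1\<close>)
  show "holo_cp1 (\<lambda>P. inv psi2 P $ 1) (range psi2)"
    by (rule holo_cp1_ratio[where p = "\<lambda>z. 1 / z" and q = "\<lambda>z. z"])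
      (use nz2 d openin_range_psi in \<open>simp_all add: inv_psi2\<close>)
qed

context
  fixes E :: "('i, cp1, 2) vbundle" and i3 i2 :: 'i and a b c :: complex
  assumes E: "holo_bundle CP1 E" and i3: "i3 \<in> bindex E" and i2: "i2 \<in> bindex E"
    and dom: "bdom E i3 = range psi1" "bdom E i2 = range psi2"
    and T: "\<And>x. x \<noteq> 0 \<Longrightarrow> btrans E i2 i3 (cp1_pt x 1) = mk2 a (b / x) 0 (c / x\<^sup>2)"
    and ac: "a \<noteq> 0" "c \<noteq> 0"
begin

lemma bundle_iso_split_0_2:
  assumes "b = 0"
  shows "bundle_iso CP1 E (split_bundle (\<lambda>i. if i = 1 then 0 else 2))"
proof (rule bundle_iso_splitI[OF E i3 i2 dom, where ?M1.0 = "\<lambda>P. mk2 1 0 0 1" and ?M2.0 = "\<lambda>P. mk2 a 0 0 c"])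
  fix x :: complex assume x: "x \<noteq> 0"
  have "btrans (split_bundle (\<lambda>i::2. if i = 1 then 0 else 2)) fst snd (cp1_pt x 1) = mk2 1 0 0 (1 / x\<^sup>2)"
    using x by (subst split_trans) (auto simp: vec_eq_iff forall_2 power_divide)
  then show "btrans E i2 i3 (cp1_pt x 1) ** mk2 1 0 0 1 =
      mk2 a 0 0 c ** btrans (split_bundle (\<lambda>i. if i = 1 then 0 else 2)) fst snd (cp1_pt x 1)"
    unfolding T[OF x] by (simp add: mk2_mult assms)
qed (use ac in \<open>auto intro!: holo_matrix_mk2 holo_cp1_const invertible_mk2\<close>)

text \<open>The columns of \<open>M1\<close> are \<open>(0, 1)\<close> and
  \<open>(- b / a, x)\<close>. The transition matrix maps them to \<open>1 / x\<close> times
  \<open>(b, c y)\<close> and \<open>1 / x\<close> times \<open>(0, c)\<close> with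
  \<open>y = 1 / x\<close>: the entry \<open>- b / a\<close> is chosen to cancel
  \<open>b / x * x\<close>. The common factor \<open>1 / x\<close> is the transition function of
  \<open>O(1)\<close>, and the determinants \<open>b / a\<close> and \<open>b c\<close> are nonzero
  because \<open>b\<close> is.\<close>

lemma bundle_iso_split_1_1:
  assumes "b \<noteq> 0"
  shows "bundle_iso CP1 E (split_bundle (\<lambda>i. 1))"
proof (rule bundle_iso_splitI[OF E i3 i2 dom,
      where ?M1.0 = "\<lambda>P. mk2 0 (- b / a) 1 (inv psi1 P $ 1)" and ?M2.0 = "\<lambda>P. mk2 b 0 (c * inv psi2 P $ 1) c"])
  fix x :: complex assume x: "x \<noteq> 0"
  have "btrans (split_bundle (\<lambda>i::2. 1)) fst snd (cp1_pt x 1) = mk2 (1 / x) 0 0 (1 / x)"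
    using x by (subst split_trans) (auto simp: vec_eq_iff forall_2)
  then show "btrans E i2 i3 (cp1_pt x 1) ** mk2 0 (- b / a) 1 (inv psi1 (cp1_pt x 1) $ 1) =
      mk2 b 0 (c * inv psi2 (cp1_pt x 1) $ 1) c ** btrans (split_bundle (\<lambda>i. 1)) fst snd (cp1_pt x 1)"
    unfolding T[OF x] using x ac by (simp add: mk2_mult inv_psi1 inv_psi2 power2_eq_square)
qed (use ac assms in \<open>auto intro!: holo_matrix_mk2 holo_cp1_const holo_cp1_mult holo_cp1_affine invertible_mk2\<close>)

end

text \<open>\<open>(B, A)\<close> and \<open>(B', A')\<close> are the components in the two frames
  of a section vanishing at both ends. As \<open>A'\<close> vanishes at 0, \<open>A\<close> grows at
  most linearly, hence \<open>A x = k x\<close>. Then \<open>B\<close> tends to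
  \<open>- b k / a\<close> at infinity, so it is this constant; \<open>B 0 = 0\<close> and
  \<open>b\<close> nonzero force \<open>k = 0\<close>.\<close>

lemma no_vanishing_section:
  fixes A B A' B' :: "complex \<Rightarrow> complex"
  assumes hol: "A holomorphic_on UNIV" "B holomorphic_on UNIV" "A' holomorphic_on UNIV" "B' holomorphic_on UNIV"
    and rel: "\<And>x. x \<noteq> 0 \<Longrightarrow> A' (1 / (\<alpha> * x)) = c / x\<^sup>2 * A x"
      "\<And>x. x \<noteq> 0 \<Longrightarrow> B' (1 / (\<alpha> * x)) = a * B x + b / x * A x"
    and zero: "A 0 = 0" "B 0 = 0" "A' 0 = 0" "B' 0 = 0"
    and nz: "\<alpha> \<noteq> 0" "a \<noteq> 0" "c \<noteq> 0" "b \<noteq> 0"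
  shows "A x = 0 \<and> B x = 0"
proof -
  have y0: "((\<lambda>x. 1 / (\<alpha> * x)) \<longlongrightarrow> 0) at_infinity"
    using tendsto_mult[OF tendsto_const[of "1 / \<alpha>"] tendsto_inverse_0] by (simp add: divide_inverse)
  have ev: "\<forall>\<^sub>F x in at_infinity. (x::complex) \<noteq> 0"
    unfolding eventually_at_infinity by (auto intro!: exI[of _ 1])
  then have fl: "filterlim (\<lambda>x. 1 / (\<alpha> * x)) (at 0) at_infinity"
    unfolding filterlim_at using y0 nz by (auto elim: eventually_mono)
  obtain D where "(A' has_field_derivative D) (at 0)"
    using hol(3) by (meson UNIV_I field_differentiable_def holomorphic_on_imp_differentiable_at open_UNIV)
  then have "((\<lambda>y. A' y / y) \<longlongrightarrow> D) (at 0)"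
    using zero by (simp add: DERIV_def)
  from filterlim_compose[OF this fl]
  have "((\<lambda>x. A' (1 / (\<alpha> * x)) / (1 / (\<alpha> * x)) * (1 / (\<alpha> * c))) \<longlongrightarrow> D * (1 / (\<alpha> * c))) at_infinity"
    by (intro tendsto_mult tendsto_const)
  \<comment> \<open>With \<open>y = 1 / (\<alpha> x)\<close> the relation for \<open>A'\<close>
    reads \<open>A' y / y = \<alpha> c * (A x / x)\<close>, so the derivative of \<open>A'\<close>
    at 0 gives the limit of \<open>A x / x\<close>.\<close>
  then have Al: "((\<lambda>x. A x / x) \<longlongrightarrow> D * (1 / (\<alpha> * c))) at_infinity"
  proof (rule Lim_transform_eventually)
    show "\<forall>\<^sub>F x in at_infinity. A' (1 / (\<alpha> * x)) / (1 / (\<alpha> * x)) * (1 / (\<alpha> * c)) = A x / x"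
      using ev by eventually_elim (use nz in \<open>simp add: rel power2_eq_square\<close>)
  qed
  define L where "L = D * (1 / (\<alpha> * c))"
  have "\<forall>\<^sub>F x in at_infinity. norm (A x / x) < norm L + 1"
    using order_tendstoD(2)[OF tendsto_norm[OF Al], of "norm L + 1"] unfolding L_def by simp
  then obtain R where R: "\<And>x. R \<le> norm x \<Longrightarrow> norm (A x / x) < norm L + 1"
    unfolding eventually_at_infinity by blast
  have grow: "norm (A x) \<le> (norm L + 1) * norm x ^ 1" if "max R 1 \<le> norm x" for x
  proof -
    have "norm x > 0" using that by linarith
    then show ?thesis using R[of x] that by (simp add: norm_divide divide_less_eq)
  qed
  define k where "k = deriv A 0"
  \<comment> \<open>Linear growth makes \<open>A\<close> a polynomial of degree at most one, and
    \<open>A 0 = 0\<close> removes the constant term.\<close>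
  have Ak: "A x = k * x" for x
    using Liouville_polynomial[OF hol(1) grow, where \<xi> = x and A = "max R 1"] zero unfolding k_def by simp
  have B'0: "(B' \<longlongrightarrow> 0) (at 0)"
    using hol(4) zero by (metis continuous_on_eq_continuous_at holomorphic_on_imp_continuous_on isCont_def open_UNIV UNIV_I)
  from filterlim_compose[OF this fl]
  have "((\<lambda>x. (B' (1 / (\<alpha> * x)) - b * k) / a) \<longlongrightarrow> (0 - b * k) / a) at_infinity"
    by (intro tendsto_divide tendsto_diff tendsto_const) (use nz in auto)
  then have "(B \<longlongrightarrow> (0 - b * k) / a) at_infinity"
  proof (rule Lim_transform_eventually)
    show "\<forall>\<^sub>F x in at_infinity. (B' (1 / (\<alpha> * x)) - b * k) / a = B x"
      using ev by eventually_elim (use nz in \<open>simp add: rel Ak\<close>)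
  qed
  then have Bc: "B x = (0 - b * k) / a" for x
    by (rule Liouville_weak[OF hol(2)])
  have "k = 0" using Bc[of 0] zero nz by simp
  then show ?thesis using Ak Bc by simp
qed

text \<open>A function invariant under scaling of homogeneous coordinates descends to points; by
  \<open>cp1_fun_eq\<close> the chosen representative is then immaterial.\<close>

definition cp1_fun :: "(complex \<times> complex \<Rightarrow> complex) \<Rightarrow> cp1 \<Rightarrow> complex" where
  "cp1_fun W P = W (SOME y. y \<in> P)"

lemma cp1_fun_eq:
  assumes "\<And>k s t. k \<noteq> 0 \<Longrightarrow> W (k * s, k * t) = W (s, t)"
  shows "cp1_fun W (cp1_pt s t) = W (s, t)"
proof -
  have "(SOME y. y \<in> cp1_pt s t) \<in> cp1_pt s t" using mem_cp1_pt someI_ex by metis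
  then obtain k where "k \<noteq> 0" "(SOME y. y \<in> cp1_pt s t) = (k * s, k * t)"
    unfolding cp1_pt_def by blast
  then show ?thesis unfolding cp1_fun_def by (simp add: assms)
qed

lemma holo_cp1_cong:
  assumes "holo_cp1 f D" "openin (atlas_topology CP1) D" "\<And>P. P \<in> D \<Longrightarrow> g P = f P"
  shows "holo_cp1 g D"
proof -
  have o: "open {z. cp1_pt z 1 \<in> D}" "open {z. cp1_pt 1 z \<in> D}"
    using openin_continuous_map_preimage[OF continuous_map_psi(1) assms(2)]
      openin_continuous_map_preimage[OF continuous_map_psi(2) assms(2)] by auto
  show ?thesis
    unfolding holo_cp1_def
  proof (intro conjI allI impI)
    fix z assume z: "cp1_pt z 1 \<in> D"
    have "(\<lambda>z. f (cp1_pt z 1)) field_differentiable at z"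
      using assms(1) z unfolding holo_cp1_def by blast
    then show "(\<lambda>z. g (cp1_pt z 1)) field_differentiable at z"
      by (rule field_differentiable_cong_open[OF _ o(1)]) (simp_all add: z assms(3))
  next
    fix z assume z: "cp1_pt 1 z \<in> D"
    have "(\<lambda>z. f (cp1_pt 1 z)) field_differentiable at z"
      using assms(1) z unfolding holo_cp1_def by blast
    then show "(\<lambda>z. g (cp1_pt 1 z)) field_differentiable at z"
      by (rule field_differentiable_cong_open[OF _ o(2)]) (simp_all add: z assms(3))
  qed
qed

text \<open>Holomorphy of a curve in the projective line is tested against local holomorphic
  functions. This avoids charts on the line, which is convenient as the curves arise from the
  inverse of an unspecified embedding.\<close>

definition holo_curve :: "(complex \<Rightarrow> cp1) \<Rightarrow> bool" where
  "holo_curve \<rho> \<longleftrightarrow> (\<forall>f D x. openin (atlas_topology CP1) D \<and> holo_cp1 f D \<and> \<rho> x \<in> D \<longrightarrow>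
     (\<lambda>x. f (\<rho> x)) field_differentiable at x)"

text \<open>The second summand of \<open>O \<oplus> O(2)\<close> has a section \<open>(y \<and> p)(y \<and> q)\<close> vanishing at the two given
  points.  In the frames of \<open>E\<close> it consists of entire functions of the affine coordinate, and
  \<open>b \<noteq> 0\<close> would force them to vanish identically.\<close>

lemma not_bundle_iso_split_0_2:
  fixes E :: "('i, cp1, 2) vbundle"
  assumes iso: "bundle_iso CP1 E (split_bundle (\<lambda>i. if i = 1 then 0 else 2))"
    and i3: "i3 \<in> bindex E" and i2: "i2 \<in> bindex E"
    and \<rho>3: "\<And>x. \<rho>3 x \<in> bdom E i3" and \<rho>2: "\<And>y. \<rho>2 y \<in> bdom E i2"
    and curve: "holo_curve \<rho>3" "holo_curve \<rho>2"
    and glue: "\<And>x. x \<noteq> 0 \<Longrightarrow> \<rho>3 x = \<rho>2 (1 / (\<alpha> * x))"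
    and dist: "\<rho>3 1 \<noteq> \<rho>3 0" "\<rho>3 1 \<noteq> \<rho>2 0"
    and T: "\<And>x. x \<noteq> 0 \<Longrightarrow> btrans E i2 i3 (\<rho>3 x) = mk2 a (b / x) 0 (c / x\<^sup>2)"
    and nz: "\<alpha> \<noteq> 0" "a \<noteq> 0" "c \<noteq> 0"
  shows "b = 0"
proof (rule ccontr)
  assume b: "b \<noteq> 0"
  let ?F = "split_bundle (\<lambda>i::2. if i = 1 then 0 else 2)"
  have E: "holo_bundle CP1 E" and F: "holo_bundle CP1 ?F" using iso unfolding bundle_iso_def by blast+
  obtain h where
    H1: "\<forall>i\<in>bindex E. \<forall>k\<in>{fst, snd}. holo_matrix_on CP1 (h i k) (bdom E i \<inter> bdom ?F k) \<and>
        (\<forall>P\<in>bdom E i \<inter> bdom ?F k. invertible (h i k P))"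
    and H2: "\<forall>i\<in>bindex E. \<forall>j\<in>bindex E. \<forall>k\<in>{fst, snd}. \<forall>l\<in>{fst, snd}.
        \<forall>P\<in>bdom E i \<inter> bdom E j \<inter> bdom ?F k \<inter> bdom ?F l. btrans E i j P ** h j l P = h i k P ** btrans ?F k l P"
    using iso unfolding bundle_iso_def split_index by (elim conjE exE) (rule that)
  have hh: "holo_matrix_on CP1 (h i k) (bdom E i \<inter> bdom ?F k)"
    if "i \<in> bindex E" "k \<in> {fst, snd}" for i k
    using bspec[OF bspec[OF H1 that(1)] that(2)] by (rule conjunct1)
  have hi: "invertible (h i k P)"
    if "i \<in> bindex E" "k \<in> {fst, snd}" "P \<in> bdom E i \<inter> bdom ?F k" for i k P
    using bspec[OF conjunct2[OF bspec[OF bspec[OF H1 that(1)] that(2)]] that(3)] .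
  have hc: "btrans E i j P ** h j l P = h i k P ** btrans ?F k l P"
    if "i \<in> bindex E" "j \<in> bindex E" "k \<in> {fst, snd}" "l \<in> {fst, snd}"
      "P \<in> bdom E i \<inter> bdom E j \<inter> bdom ?F k \<inter> bdom ?F l" for i j k l P
    using bspec[OF bspec[OF bspec[OF bspec[OF bspec[OF H2 that(1)] that(2)] that(3)] that(4)] that(5)] .
  have Eop: "openin (atlas_topology CP1) (bdom E i)" and Ecar: "bdom E i \<subseteq> carrier_of CP1" if "i \<in> bindex E" for i
    using E that unfolding holo_bundle_def by blast+
  have Fop: "openin (atlas_topology CP1) (bdom ?F k)" if "k \<in> {fst, snd}" for k
    using F that unfolding holo_bundle_def split_index by blast
  obtain p0 p1 where p: "\<rho>3 0 = cp1_pt p0 p1" "(p0, p1) \<noteq> (0, 0)"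
    using \<rho>3 Ecar[OF i3] carrier_CP1_E by blast
  obtain q0 q1 where q: "\<rho>2 0 = cp1_pt q0 q1" "(q0, q1) \<noteq> (0, 0)"
    using \<rho>2 Ecar[OF i2] carrier_CP1_E by blast
  define W where "W = (\<lambda>y. (fst y * p1 - p0 * snd y) * (fst y * q1 - q0 * snd y))"
  define S where "S = (\<lambda>k::complex \<times> complex \<Rightarrow> complex. cp1_fun (\<lambda>y. W y / (k y)\<^sup>2))"
  have Seq: "S k (cp1_pt s t) = W (s, t) / (k (s, t))\<^sup>2" if "k \<in> {fst, snd}" for k s t
    unfolding S_def
  proof (rule cp1_fun_eq)
    fix m s t :: complex assume m: "m \<noteq> 0"
    have "W (m * s, m * t) = m\<^sup>2 * W (s, t)" unfolding W_def by (simp add: power2_eq_square algebra_simps)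
    moreover have "(k (m * s, m * t))\<^sup>2 = m\<^sup>2 * (k (s, t))\<^sup>2" using that by (auto simp: power_mult_distrib)
    ultimately show "W (m * s, m * t) / (k (m * s, m * t))\<^sup>2 = W (s, t) / (k (s, t))\<^sup>2"
      using m by simp
  qed
  have knz: "k (s, t) \<noteq> 0" if "cp1_pt s t \<in> bdom ?F k" "k \<in> {fst, snd}" "(s, t) \<noteq> (0, 0)" for k s t
  proof -
    have "s \<noteq> 0" if "k = fst"
      using \<open>cp1_pt s t \<in> bdom ?F k\<close> unfolding that split_dom range_psi2[OF \<open>(s, t) \<noteq> (0, 0)\<close>] .
    moreover have "t \<noteq> 0" if "k = snd"
      using \<open>cp1_pt s t \<in> bdom ?F k\<close> unfolding that split_dom range_psi1[OF \<open>(s, t) \<noteq> (0, 0)\<close>] .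
    ultimately show ?thesis using that(2) by auto
  qed
  have Shol: "holo_cp1 (S k) (bdom ?F k)" if k: "k \<in> {fst, snd}" for k
  proof (rule holo_cp1_ratio[OF _ _ Fop[OF k]])
    fix z
    have W: "(\<lambda>z. W (z, 1)) field_differentiable at z" "(\<lambda>z. W (1, z)) field_differentiable at z"
      unfolding W_def fst_conv snd_conv
      by (intro field_differentiable_mult field_differentiable_diff field_differentiable_const field_differentiable_ident)+
    have kd: "(\<lambda>z. (k (z, 1))\<^sup>2) field_differentiable at z" "(\<lambda>z. (k (1, z))\<^sup>2) field_differentiable at z"
      using k by (auto simp: power2_eq_square intro!: field_differentiable_mult)
    show "S k (cp1_pt z 1) = W (z, 1) / (k (z, 1))\<^sup>2 \<and>
        (\<lambda>z. W (z, 1) / (k (z, 1))\<^sup>2) field_differentiable at z" if "cp1_pt z 1 \<in> bdom ?F k"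
      by (intro conjI Seq[OF k] field_differentiable_divide W kd) (use knz[OF that k] in simp)
    show "S k (cp1_pt 1 z) = W (1, z) / (k (1, z))\<^sup>2 \<and>
        (\<lambda>z. W (1, z) / (k (1, z))\<^sup>2) field_differentiable at z" if "cp1_pt 1 z \<in> bdom ?F k"
      by (intro conjI Seq[OF k] field_differentiable_divide W kd) (use knz[OF that k] in simp)
  qed
  \<comment> \<open>Column 2 of the isomorphism is the \<open>O(2)\<close> summand, so these are the
    components in the frame \<open>i\<close> of \<open>E\<close> of the section with local
    expression \<open>S k\<close>.\<close>
  define e where "e = (\<lambda>i k P r. h i k P $ r $ (2::2) * S k P)"
  have eind: "e i k P r = e i l P r"
    if i: "i \<in> bindex E" and k: "k \<in> {fst, snd}" and l: "l \<in> {fst, snd}"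
      and P: "P \<in> bdom E i" "P \<in> bdom ?F k" "P \<in> bdom ?F l" for i k l P r
  proof -
    obtain s t where st: "P = cp1_pt s t" "(s, t) \<noteq> (0, 0)"
      using P(1) Ecar[OF i] carrier_CP1_E by blast
    have n: "k (s, t) \<noteq> 0" "l (s, t) \<noteq> 0" using P st k l knz by blast+
    have "h i l P = h i k P ** btrans ?F k l P"
      using hc[OF i i k l, of P] bundle_trans_self[OF E i P(1)] P by simp
    then have "h i l P $ r $ 2 = (h i k P ** btrans ?F k l P) $ r $ 2" by simp
    also have "\<dots> = h i k P $ r $ 2 * (l (s, t) / k (s, t))\<^sup>2"
      unfolding st split_trans[OF st(2) k l] by (simp add: matrix_matrix_mult_def sum_2)
    finally show ?thesis
      unfolding e_def st Seq[OF k] Seq[OF l] using n by (simp add: power_divide)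
  qed
  have echange: "e i k P r = btrans E i j P $ r $ 1 * e j k P 1 + btrans E i j P $ r $ 2 * e j k P 2"
    if i: "i \<in> bindex E" and j: "j \<in> bindex E" and k: "k \<in> {fst, snd}"
      and P: "P \<in> bdom E i" "P \<in> bdom E j" "P \<in> bdom ?F k" for i j k P r
  proof -
    have "btrans ?F k k P = mat 1" using bundle_trans_self[OF F _ P(3)] k by (simp add: split_index)
    then have "h i k P = btrans E i j P ** h j k P"
      using hc[OF i j k k, of P] P by simp
    then show ?thesis unfolding e_def by (simp add: matrix_matrix_mult_def sum_2 algebra_simps)
  qed
  \<comment> \<open>A trivialisation of the split bundle is selected at each point. By
    \<open>eind\<close> the components do not depend on the selection, so the functions \<epsilon>
    are still holomorphic.\<close>
  define K :: "cp1 \<Rightarrow> complex \<times> complex \<Rightarrow> complex" where "K = (\<lambda>P. if P \<in> range psi1 then snd else fst)"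
  have K: "K P \<in> {fst, snd}" "P \<in> carrier_of CP1 \<Longrightarrow> P \<in> bdom ?F (K P)" for P
    unfolding K_def carrier_CP1_psi by (simp_all add: split_dom) blast
  define \<epsilon> where "\<epsilon> = (\<lambda>i r P. e i (K P) P r)"
  have \<epsilon>hol: "(\<lambda>x. \<epsilon> i r (\<rho> x)) holomorphic_on UNIV"
    if i: "i \<in> bindex E" and \<rho>: "holo_curve \<rho>" "\<And>x. \<rho> x \<in> bdom E i" for i r \<rho>
    unfolding holomorphic_on_def
  proof
    fix x
    define k where "k = K (\<rho> x)"
    have k: "k \<in> {fst, snd}" "\<rho> x \<in> bdom ?F k"
      using K \<rho>(2)[of x] Ecar[OF i] unfolding k_def by blast+
    have op: "openin (atlas_topology CP1) (bdom E i \<inter> bdom ?F k)"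
      using Eop[OF i] Fop[OF k(1)] by blast
    have hol: "holo_cp1 (\<lambda>P. e i k P r) (bdom E i \<inter> bdom ?F k)"
      unfolding e_def
      by (intro holo_cp1_mult holo_cp1_subset[OF Shol[OF k(1)]])
        (use hh[OF i k(1)] in \<open>simp_all add: holo_matrix_on_CP1_iff\<close>)
    have "holo_cp1 (\<epsilon> i r) (bdom E i \<inter> bdom ?F k)"
    proof (rule holo_cp1_cong[OF hol op])
      fix P assume P: "P \<in> bdom E i \<inter> bdom ?F k"
      show "\<epsilon> i r P = e i k P r"
        unfolding \<epsilon>_def by (rule eind[OF i K(1) k(1)]) (use P K(2)[of P] Ecar[OF i] in auto)
    qed
    moreover have "\<rho> x \<in> bdom E i \<inter> bdom ?F k" using \<rho>(2) k(2) by blast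
    ultimately have "(\<lambda>x. \<epsilon> i r (\<rho> x)) field_differentiable at x"
      using \<rho>(1) op unfolding holo_curve_def by blast
    then show "(\<lambda>x. \<epsilon> i r (\<rho> x)) field_differentiable at x within UNIV" by simp
  qed
  have rel: "\<epsilon> i2 r (\<rho>2 (1 / (\<alpha> * x))) = mk2 a (b / x) 0 (c / x\<^sup>2) $ r $ 1 * \<epsilon> i3 1 (\<rho>3 x)
      + mk2 a (b / x) 0 (c / x\<^sup>2) $ r $ 2 * \<epsilon> i3 2 (\<rho>3 x)" if "x \<noteq> 0" for x r
  proof -
    have in2: "\<rho>3 x \<in> bdom E i2" using \<rho>2 glue[OF that] by simp
    show ?thesis
      unfolding glue[OF that, symmetric] \<epsilon>_def T[OF that, symmetric]
      by (rule echange[OF i2 i3 K(1) in2 \<rho>3 K(2)]) (use \<rho>3 Ecar[OF i3] in blast)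
  qed
  have zero3: "\<epsilon> i3 r (\<rho>3 0) = 0" for r
    unfolding \<epsilon>_def e_def p(1) Seq[OF K(1)] by (simp add: W_def)
  have zero2: "\<epsilon> i2 r (\<rho>2 0) = 0" for r
    unfolding \<epsilon>_def e_def q(1) Seq[OF K(1)] by (simp add: W_def)
  have van: "\<epsilon> i3 2 (\<rho>3 1) = 0 \<and> \<epsilon> i3 1 (\<rho>3 1) = 0"
    by (rule no_vanishing_section[where A = "\<lambda>x. \<epsilon> i3 2 (\<rho>3 x)" and B = "\<lambda>x. \<epsilon> i3 1 (\<rho>3 x)"
          and A' = "\<lambda>y. \<epsilon> i2 2 (\<rho>2 y)" and B' = "\<lambda>y. \<epsilon> i2 1 (\<rho>2 y)" and \<alpha> = \<alpha> and a = a and b = b and c = c])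
      (use \<epsilon>hol[OF i3 curve(1) \<rho>3] \<epsilon>hol[OF i2 curve(2) \<rho>2] rel zero3 zero2 nz b in \<open>simp_all\<close>)
  obtain s t where st: "\<rho>3 1 = cp1_pt s t" "(s, t) \<noteq> (0, 0)"
    using \<rho>3 Ecar[OF i3] carrier_CP1_E by blast
  define k where "k = K (\<rho>3 1)"
  have k: "k \<in> {fst, snd}" "\<rho>3 1 \<in> bdom ?F k"
    using K \<rho>3[of 1] Ecar[OF i3] unfolding k_def by blast+
  \<comment> \<open>By \<open>dist\<close> the point \<open>\<rho>3 1\<close> differs from both
    zeros of the section. Since the components in \<open>E\<close> vanish there nevertheless, a
    whole column of the invertible matrix \<open>h\<close> would be zero.\<close>
  have "W (s, t) \<noteq> 0"
    using dist cp1_pt_eq_iff[OF st(2) p(2)] cp1_pt_eq_iff[OF st(2) q(2)] unfolding st p(1) q(1) W_def by auto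
  moreover have "k (s, t) \<noteq> 0" using knz k st by simp
  ultimately have "S k (\<rho>3 1) \<noteq> 0" unfolding st(1) Seq[OF k(1)] by simp
  then have "h i3 k (\<rho>3 1) $ 2 $ 2 = 0" "h i3 k (\<rho>3 1) $ 1 $ 2 = 0"
    using van unfolding \<epsilon>_def e_def k_def[symmetric] by auto
  then have "det (h i3 k (\<rho>3 1)) = 0" by (simp add: det_2)
  moreover have "invertible (h i3 k (\<rho>3 1))" by (rule hi[OF i3 k(1)]) (use \<rho>3 k in blast)
  ultimately show False by (simp add: invertible_det_nz)
qed

section \<open>Normal bundles of curves covered by two charts\<close>

text \<open>\<open>holo_map\<close> speaks only of the charts of \<open>A\<close>. For a chart of
  the maximal atlas the coordinate expression is factored through a chart of \<open>A\<close> near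
  the point.\<close>

lemma holo_map_CP1_chart:
  assumes \<theta>: "holo_map CP1 A \<theta>" and d: "d \<in> compatible_charts A"
    and \<psi>: "\<psi> = (\<lambda>z. cp1_pt z 1) \<or> \<psi> = (\<lambda>z. cp1_pt 1 z)" and z: "\<theta> (\<psi> z) \<in> fst d"
  shows "(\<lambda>z. snd d (\<theta> (\<psi> z)) $ k) field_differentiable at z"
proof -
  note A = compatible_charts_holo_atlas[OF d]
  define psi where "psi = (\<lambda>x::complex ^ 1. \<psi> (x $ 1))"
  have psi: "inj psi" "(range psi, inv psi) \<in> CP1"
    using \<psi> inj_psi1 inj_psi2 unfolding psi_def CP1_alt by auto
  have ivp: "inv_into (range psi) (inv psi) x = psi x" for x
    by (rule inv_into_f_eq[OF inj_on_inv_into]) (auto intro: inv_f_f[OF psi(1)])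
  have cont\<psi>: "continuous_map euclidean (atlas_topology CP1) \<psi>"
    using \<psi> continuous_map_psi by auto
  have "\<theta> (\<psi> z) \<in> carrier_of A" using compatible_sub_carrier[OF d] z by blast
  then obtain U \<phi> where U: "(U, \<phi>) \<in> A" "\<theta> (\<psi> z) \<in> U" by (rule carrier_ofE)
  have "holo_on (\<phi> \<circ> \<theta> \<circ> inv_into (range psi) (inv psi)) (inv psi ` {p \<in> range psi. \<theta> p \<in> U})"
    using \<theta> psi(2) U(1) unfolding holo_map_def by blast
  moreover have "inv psi ` {p \<in> range psi. \<theta> p \<in> U} = {x. \<theta> (psi x) \<in> U}"
    using inv_image_range[OF psi(1), of "{p. \<theta> p \<in> U}"] by (simp add: Int_def)
  moreover have "\<phi> \<circ> \<theta> \<circ> inv_into (range psi) (inv psi) = (\<lambda>x. \<phi> (\<theta> (psi x)))"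
    by (simp add: fun_eq_iff ivp)
  ultimately have "\<forall>x\<in>{x. \<theta> (psi x) \<in> U}. holo_at (\<lambda>x. \<phi> (\<theta> (psi x))) x"
    unfolding holo_on_iff by (simp only:)
  then have h1: "holo_at (\<lambda>x. \<phi> (\<theta> (psi x))) (vec z)"
    by (rule bspec) (use U(2) in \<open>simp add: psi_def\<close>)
  have h2: "holo_at (snd d \<circ> inv_into U \<phi>) (\<phi> (\<theta> (psi (vec z))))"
    using compatible_holo(2)[OF d U(1)] U(2) z unfolding holo_on_iff psi_def by simp
  have "openin (atlas_topology A) (U \<inter> fst d)"
    by (intro openin_Int openin_chart_domain[OF U(1)] compatible_openin[OF d])
  then have "openin (atlas_topology CP1) {p \<in> topspace (atlas_topology CP1). \<theta> p \<in> U \<inter> fst d}"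
    using \<theta> unfolding holo_map_def by (intro openin_continuous_map_preimage) auto
  from openin_continuous_map_preimage[OF cont\<psi> this]
  have "open {z. \<theta> (\<psi> z) \<in> U \<inter> fst d}"
    using continuous_map_image_subset_topspace[OF cont\<psi>] by (simp add: image_subset_iff)
  then have op: "open {x::complex ^ 1. \<theta> (psi x) \<in> U \<inter> fst d}"
    using open_vimage[of "{z. \<theta> (\<psi> z) \<in> U \<inter> fst d}" "\<lambda>x::complex ^ 1. x $ 1"]
    by (simp add: psi_def vimage_def continuous_intros)
  have "holo_at (\<lambda>x. snd d (\<theta> (psi x))) (vec z)"
  proof (rule holo_at_cong[OF holo_at_compose[OF h2 h1] op])
    show "vec z \<in> {x. \<theta> (psi x) \<in> U \<inter> fst d}" using U z by (simp add: psi_def)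
    fix y assume "y \<in> {x. \<theta> (psi x) \<in> U \<inter> fst d}"
    then show "(snd d \<circ> inv_into U \<phi>) (\<phi> (\<theta> (psi y))) = snd d (\<theta> (psi y))"
      using holo_atlas_inj[OF A U(1)] by (simp add: inv_into_f_f)
  qed
  then show ?thesis unfolding holo_at_vec1 psi_def by simp
qed

lemma open_curve_preimage:
  assumes \<theta>: "continuous_map (atlas_topology CP1) T \<theta>" and W: "openin T W"
    and \<psi>: "\<psi> = (\<lambda>z. cp1_pt z 1) \<or> \<psi> = (\<lambda>z. cp1_pt 1 z)"
  shows "open {z. \<theta> (\<psi> z) \<in> W}"
proof -
  have "continuous_map euclidean (atlas_topology CP1) \<psi>" using \<psi> continuous_map_psi by auto
  then have "continuous_map euclidean T (\<theta> \<circ> \<psi>)" using \<theta> continuous_map_compose by blast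
  from openin_continuous_map_preimage[OF this W] show ?thesis by simp
qed

lemma normal_index_simps: "normal_index 1 = 2" "normal_index 2 = 3"
  by (simp_all add: normal_index_def)

lemma adapted_vanish:
  "c \<in> adapted_charts A L \<Longrightarrow> p \<in> L \<Longrightarrow> p \<in> fst c \<Longrightarrow> snd c p $ 2 = 0 \<and> snd c p $ 3 = 0"
  unfolding adapted_charts_def by (cases c) auto

lemma adapted_mem:
  "c \<in> adapted_charts A L \<Longrightarrow> p \<in> fst c \<Longrightarrow> snd c p $ 2 = 0 \<Longrightarrow> snd c p $ 3 = 0 \<Longrightarrow> p \<in> L"
  unfolding adapted_charts_def by (cases c) auto

lemma adapted_chartsI:
  "c \<in> compatible_charts A \<Longrightarrow> L \<inter> fst c = {p \<in> fst c. snd c p $ 2 = 0 \<and> snd c p $ 3 = 0} \<Longrightarrow>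
    c \<in> adapted_charts A L"
  unfolding adapted_charts_def by (cases c) simp

lemma adapted_compatible: "c \<in> adapted_charts A L \<Longrightarrow> c \<in> compatible_charts A"
  unfolding adapted_charts_def by auto

text \<open>Moving along the first coordinate axis from a point of \<open>L\<close> stays on
  \<open>L\<close>, where the last two coordinates of the other chart are zero. This is the tangency
  that makes the lower right block a transition matrix.\<close>

lemma adapted_jacobian_column:
  assumes c: "c \<in> adapted_charts A L" and d: "d \<in> adapted_charts A L"
    and p: "p \<in> L" "p \<in> fst c" "p \<in> fst d" and k: "k = 2 \<or> k = 3"
  shows "cjacobian (snd c \<circ> inv_into (fst d) (snd d)) (snd d p) $ k $ 1 = 0"
proof -
  note cc = adapted_compatible[OF c] and dc = adapted_compatible[OF d]
  let ?f = "snd c \<circ> inv_into (fst d) (snd d)" and ?x = "snd d p"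
  let ?S = "snd d ` (fst d \<inter> fst c)"
  have S: "open ?S" by (rule compatible_open_image[OF dc compatible_openin[OF cc]])
  have cont: "continuous_on UNIV (\<lambda>t. ?x + t *s axis 1 1)"
  proof -
    have "(\<lambda>t. ?x + t *s axis 1 1) = (\<lambda>t. \<chi> i. ?x $ i + t * axis 1 1 $ i)"
      by (simp add: fun_eq_iff vec_eq_iff)
    then show ?thesis by (simp only:) (intro continuous_on_vec_lambda continuous_intros)
  qed
  have op: "open {t. ?x + t *s axis 1 1 \<in> ?S}"
    using open_vimage[OF S cont] by (simp add: vimage_def)
  have "((\<lambda>t. ?f (?x + t *s axis 1 1) $ k) has_field_derivative 0) (at 0)"
  proof (rule has_field_derivative_transform_within_open[OF DERIV_const op])
    show "0 \<in> {t. ?x + t *s axis 1 1 \<in> ?S}" using p by simp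
    fix t assume "t \<in> {t. ?x + t *s axis 1 1 \<in> ?S}"
    then obtain q where q: "q \<in> fst d" "q \<in> fst c" "?x + t *s axis 1 1 = snd d q" by auto
    have "snd d q $ 2 = 0" "snd d q $ 3 = 0"
      using adapted_vanish[OF d p(1,3)] unfolding q(3)[symmetric] by (simp_all add: axis_def)
    then have "q \<in> L" using adapted_mem[OF d q(1)] by simp
    then show "0 = ?f (?x + t *s axis 1 1) $ k"
      unfolding q(3) using adapted_vanish[OF c _ q(2)] q(1) k compatible_inj[OF dc] by (auto simp: inv_into_f_f)
  qed
  then show ?thesis
    by (rule cjacobian_entry_eq[OF compatible_transition_holo[OF cc dc p(2,3)]])
qed

text \<open>Since the first column of the Jacobian vanishes below its top entry, the lower right
  block of a product is the product of the blocks.\<close>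

lemma normal_trans_mult:
  assumes c: "c \<in> adapted_charts A L" and d: "d \<in> adapted_charts A L" and e: "e \<in> adapted_charts A L"
    and p: "p \<in> L" "p \<in> fst c" "p \<in> fst d" "p \<in> fst e"
  shows "btrans (normal_bundle A L) c d p ** btrans (normal_bundle A L) d e p = btrans (normal_bundle A L) c e p"
proof -
  note chain = compatible_cjacobian_chain[OF adapted_compatible[OF c] adapted_compatible[OF d]
      adapted_compatible[OF e] p(2,3,4)]
  note z = adapted_jacobian_column[OF c d p(1,2,3)]
  show ?thesis
    unfolding normal_bundle_def vbundle.simps chain using z[of 2] z[of 3]
    by (simp add: vec_eq_iff forall_2 matrix_matrix_mult_def sum_2 sum_3 normal_index_simps)
qed

lemma normal_trans_self:
  assumes c: "c \<in> adapted_charts A L" and p: "p \<in> L" "p \<in> fst c"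
  shows "btrans (normal_bundle A L) c c p = mat 1"
  unfolding normal_bundle_def vbundle.simps compatible_cjacobian_self[OF adapted_compatible[OF c] p(2)]
  by (simp add: vec_eq_iff forall_2 normal_index_simps mat_def)

lemma normal_bundle_simps:
  "bindex (normal_bundle A L) = adapted_charts A L" "bdom (normal_bundle A L) c = L \<inter> fst c"
  by (simp_all add: normal_bundle_def)

lemma pullback_simps:
  "bindex (pullback_bundle B f E) = bindex E"
  "bdom (pullback_bundle B f E) i = {q \<in> carrier_of B. f q \<in> bdom E i}"
  "btrans (pullback_bundle B f E) i j q = btrans E i j (f q)"
  by (simp_all add: pullback_bundle_def)

text \<open>Holomorphy of the transition matrices is the substantial point and comes from
  \<open>holomorphic_cjacobian_curve\<close>, applied to the curve in each affine coordinate of the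
  line.\<close>

lemma holo_bundle_pullback_normal:
  assumes \<theta>: "holo_map CP1 A \<theta>" "\<theta> ` carrier_of CP1 = L"
    and cover: "L \<subseteq> (\<Union>c\<in>adapted_charts A L. fst c)"
  shows "holo_bundle CP1 (pullback_bundle CP1 \<theta> (normal_bundle A L))" (is "holo_bundle CP1 ?E")
proof -
  have cont: "continuous_map (atlas_topology CP1) (atlas_topology A) \<theta>"
    using \<theta>(1) unfolding holo_map_def by blast
  have dom: "bdom ?E c = {q \<in> topspace (atlas_topology CP1). \<theta> q \<in> fst c}" for c
    using \<theta>(2) by (auto simp: pullback_simps normal_bundle_simps topspace_atlas)
  have op: "openin (atlas_topology CP1) (bdom ?E c)" if "c \<in> adapted_charts A L" for c
    unfolding dom
    by (rule openin_continuous_map_preimage[OF cont compatible_openin[OF adapted_compatible[OF that]]])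
  have holo: "holo_matrix_on CP1 (btrans ?E c d) (bdom ?E c \<inter> bdom ?E d)"
    if c: "c \<in> adapted_charts A L" and d: "d \<in> adapted_charts A L" for c d
  proof -
    note cc = adapted_compatible[OF c] and dc = adapted_compatible[OF d]
    let ?f = "snd c \<circ> inv_into (fst d) (snd d)"
    let ?S = "snd d ` (fst d \<inter> fst c)"
    have S: "open ?S" by (rule compatible_open_image[OF dc compatible_openin[OF cc]])
    have f: "holo_on ?f ?S"
      unfolding holo_on_iff using compatible_transition_holo[OF cc dc] by blast
    have "(\<lambda>z. cjacobian ?f (snd d (\<theta> (\<psi> z))) $ i $ j) field_differentiable at z"
      if \<psi>: "\<psi> = (\<lambda>z. cp1_pt z 1) \<or> \<psi> = (\<lambda>z. cp1_pt 1 z)" and z: "\<theta> (\<psi> z) \<in> fst c \<inter> fst d"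
      for \<psi> z i j
    proof -
      let ?X = "{z. \<theta> (\<psi> z) \<in> fst c \<inter> fst d}"
      have X: "open ?X"
        by (rule open_curve_preimage[OF cont _ \<psi>]) (intro openin_Int compatible_openin cc dc)
      have "(\<lambda>z. cjacobian ?f (snd d (\<theta> (\<psi> z))) $ i $ j) holomorphic_on ?X"
      proof (rule holomorphic_cjacobian_curve[OF f S X])
        show "(\<lambda>z. snd d (\<theta> (\<psi> z)) $ k) holomorphic_on ?X" for k
          unfolding holomorphic_on_def
          using holo_map_CP1_chart[OF \<theta>(1) dc \<psi>] field_differentiable_at_within by blast
        show "(\<lambda>z. snd d (\<theta> (\<psi> z))) ` ?X \<subseteq> ?S" by blast
      qed
      then show ?thesis using X z holomorphic_on_imp_differentiable_at by blast
    qed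
    then show ?thesis
      unfolding holo_matrix_on_CP1_iff holo_cp1_def pullback_simps normal_bundle_def vbundle.simps vec_lambda_beta
      by (intro allI conjI impI) blast+
  qed
  have coc: "btrans ?E i j p ** btrans ?E j k p = btrans ?E i k p"
    if "i \<in> adapted_charts A L" "j \<in> adapted_charts A L" "k \<in> adapted_charts A L"
      "p \<in> bdom ?E i" "p \<in> bdom ?E j" "p \<in> bdom ?E k" for i j k p
    using that normal_trans_mult[of i A L j k "\<theta> p"] by (simp add: pullback_simps normal_bundle_simps)
  have self: "btrans ?E i i p = mat 1" if "i \<in> adapted_charts A L" "p \<in> bdom ?E i" for i p
    using that normal_trans_self[of i A L "\<theta> p"] by (simp add: pullback_simps normal_bundle_simps)
  have inv: "invertible (btrans ?E i j p)"
    if "i \<in> adapted_charts A L" "j \<in> adapted_charts A L" "p \<in> bdom ?E i" "p \<in> bdom ?E j" for i j p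
    unfolding invertible_def using coc self that by metis
  have cov: "(\<Union>i\<in>adapted_charts A L. bdom ?E i) = carrier_of CP1"
    using \<theta>(2) cover by (auto simp: dom topspace_atlas)
  have idx: "bindex ?E = adapted_charts A L" by (simp add: pullback_simps normal_bundle_simps)
  show ?thesis
    unfolding holo_bundle_def idx
    by (intro conjI ballI cov op holo inv coc) auto
qed

text \<open>In the adapted chart the embedding has only its first coordinate \<open>k\<close> left.
  This is an injective holomorphic function of one variable, so its inverse is holomorphic, and the
  inverse of \<theta> along the coordinate axis is an affine parametrisation composed with
  it.\<close>

lemma holo_curve_of_chart:
  assumes \<theta>: "holo_map CP1 A \<theta>" "inj_on \<theta> (carrier_of CP1)" "\<theta> ` carrier_of CP1 = L"
    and d: "d \<in> adapted_charts A L" and G: "\<And>x. G x \<in> L" "\<And>x. G x \<in> fst d" "\<And>x. snd d (G x) = axis 1 x"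
  shows "holo_curve (\<lambda>x. inv_into (carrier_of CP1) \<theta> (G x))" (is "holo_curve ?\<rho>")
  unfolding holo_curve_def
proof (intro allI impI, elim conjE)
  fix f D x assume D: "openin (atlas_topology CP1) D" "holo_cp1 f D" "?\<rho> x \<in> D"
  note dc = adapted_compatible[OF d]
  have cont: "continuous_map (atlas_topology CP1) (atlas_topology A) \<theta>"
    using \<theta>(1) unfolding holo_map_def by blast
  have \<rho>car: "?\<rho> x \<in> carrier_of CP1" and \<theta>\<rho>: "\<theta> (?\<rho> x) = G x" for x
    using G(1) \<theta>(3) inv_into_into f_inv_into_f by metis+
  obtain \<psi> z0 where \<psi>: "\<psi> = (\<lambda>z. cp1_pt z 1) \<or> \<psi> = (\<lambda>z. cp1_pt 1 z)" and z0: "?\<rho> x = \<psi> z0"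
  proof -
    have "?\<rho> x \<in> range psi1 \<or> ?\<rho> x \<in> range psi2" using \<rho>car carrier_CP1_psi by blast
    then show ?thesis
    proof
      assume "?\<rho> x \<in> range psi1"
      then obtain v :: "complex ^ 1" where "?\<rho> x = cp1_pt (v $ 1) 1" by (elim imageE)
      then show ?thesis by (intro that[of "\<lambda>z. cp1_pt z 1" "v $ 1"]) auto
    next
      assume "?\<rho> x \<in> range psi2"
      then obtain v :: "complex ^ 1" where "?\<rho> x = cp1_pt 1 (v $ 1)" by (elim imageE)
      then show ?thesis by (intro that[of "\<lambda>z. cp1_pt 1 z" "v $ 1"]) auto
    qed
  qed
  have \<psi>car: "\<psi> z \<in> carrier_of CP1" for z using \<psi> by auto
  have \<psi>inj: "\<psi> z = \<psi> z' \<Longrightarrow> z = z'" for z z' using \<psi> by (auto simp: cp1_pt_eq_iff)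
  define Z where "Z = {z. \<theta> (\<psi> z) \<in> fst d}"
  have Z: "open Z" unfolding Z_def by (rule open_curve_preimage[OF cont compatible_openin[OF dc] \<psi>])
  define k where "k = (\<lambda>z. snd d (\<theta> (\<psi> z)) $ 1)"
  have kG: "\<theta> (\<psi> z) = G (k z)" if "z \<in> Z" for z
  proof -
    have "\<theta> (\<psi> z) \<in> L" using \<psi>car \<theta>(3) by blast
    then have "snd d (\<theta> (\<psi> z)) $ 2 = 0 \<and> snd d (\<theta> (\<psi> z)) $ 3 = 0"
      using adapted_vanish[OF d] that unfolding Z_def by blast
    then have "snd d (\<theta> (\<psi> z)) = snd d (G (k z))"
      unfolding G(3) k_def by (simp add: vec_eq_iff forall_3 axis_def)
    then show ?thesis
      using compatible_inj[OF dc] G(2) that unfolding Z_def inj_on_def by blast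
  qed
  have k: "k holomorphic_on Z"
    unfolding k_def holomorphic_on_def Z_def
    using holo_map_CP1_chart[OF \<theta>(1) dc \<psi>] field_differentiable_at_within by blast
  have injk: "inj_on k Z"
  proof (rule inj_onI)
    fix z z' assume "z \<in> Z" "z' \<in> Z" "k z = k z'"
    then have "\<theta> (\<psi> z) = \<theta> (\<psi> z')" using kG by simp
    from inj_onD[OF \<theta>(2) this \<psi>car \<psi>car] show "z = z'" by (rule \<psi>inj)
  qed
  obtain g where g: "g holomorphic_on k ` Z" "\<And>z. z \<in> Z \<Longrightarrow> g (k z) = z"
  proof (rule holomorphic_has_inverse[OF k Z injk])
    fix g assume g: "g holomorphic_on k ` Z" "\<And>z. z \<in> Z \<Longrightarrow> g (k z) = z"
    show thesis by (rule that[OF g])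
  qed
  have z0Z: "z0 \<in> Z" "k z0 = x"
    using \<theta>\<rho>[of x] G(2,3) unfolding Z_def k_def z0 by (simp_all add: axis_def)
  have opk: "open (k ` Z)" by (rule open_mapping_thm3[OF k Z injk])
  have \<rho>g: "?\<rho> y = \<psi> (g y)" if y: "y \<in> k ` Z" for y
  proof -
    obtain z where z: "z \<in> Z" "y = k z" using y by blast
    then have "\<theta> (\<psi> z) = G y" using kG by simp
    then have "?\<rho> y = \<psi> z" using inv_into_f_f[OF \<theta>(2) \<psi>car, of z] by simp
    then show ?thesis using z g(2) by simp
  qed
  have gx: "g field_differentiable at x" "g x = z0"
    using g z0Z opk holomorphic_on_imp_differentiable_at by blast+
  have "(\<lambda>z. f (\<psi> z)) field_differentiable at z0"
    using D(2,3) \<psi> unfolding z0 holo_cp1_def by auto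
  then have "(\<lambda>y. f (\<psi> (g y))) field_differentiable at x"
    using field_differentiable_compose[of g x "\<lambda>z. f (\<psi> z)"] gx by (simp add: comp_def)
  then show "(\<lambda>x. f (?\<rho> x)) field_differentiable at x"
    by (rule field_differentiable_cong_open[OF _ opk]) (use z0Z \<rho>g in auto)
qed


section \<open>A curve that is the first coordinate axis in each of two charts\<close>

lemma axis_nth: "axis (1::3) x $ 1 = x" "axis (1::3) x $ 2 = 0" "axis (1::3) x $ 3 = 0"
  by (simp_all add: axis_def)

lemma axis_eq_iff3: "w $ 2 = 0 \<Longrightarrow> w $ 3 = 0 \<Longrightarrow> (w::complex ^ 3) = axis 1 (w $ 1)"
  by (simp add: vec_eq_iff forall_3 axis_nth)

lemma mem_closure_of: "x \<in> S \<Longrightarrow> x \<in> topspace T \<Longrightarrow> x \<in> T closure_of S"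
  using closure_of_subset_Int[of T S] by blast

lemma closure_of_line:
  assumes "continuous_map euclidean T \<phi>" "\<And>t::complex. t \<noteq> 0 \<Longrightarrow> \<phi> t \<in> S"
  shows "\<phi> 0 \<in> T closure_of S"
proof -
  have "\<phi> ` (euclidean closure_of (- {0})) \<subseteq> T closure_of (\<phi> ` (- {0}))"
    by (rule continuous_map_image_closure_subset[OF assms(1)])
  then have "\<phi> 0 \<in> T closure_of (\<phi> ` (- {0}))"
    by (auto simp: closure_complement)
  also have "\<dots> \<subseteq> T closure_of S" by (rule closure_of_mono) (use assms(2) in auto)
  finally show ?thesis .
qed

text \<open>What the computation of the normal bundle needs from the two explicit charts. The curve
  is the first axis in both, \<open>\<Phi>\<close> is the coordinate change near it,
  \<open>jac\<close> prescribes the normal block of its Jacobian, and \<open>sep\<close> says that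
  each chart misses the end of the curve lying in the other.\<close>

locale chart_pair =
  fixes A :: "('z, 3) atlas" and G3 G2 :: "complex ^ 3 \<Rightarrow> 'z" and \<Omega>3 \<Omega>2 :: "(complex ^ 3) set"
    and \<Phi> :: "complex ^ 3 \<Rightarrow> complex ^ 3" and \<alpha> a b c :: complex and L :: "'z set"
  assumes A: "holo_atlas A" and Haus: "Hausdorff_space (atlas_topology A)"
    and P3: "holo_param A \<Omega>3 G3" and P2: "holo_param A \<Omega>2 G2"
    and ax3: "\<And>x. axis 1 x \<in> \<Omega>3" and ax2: "\<And>x. axis 1 x \<in> \<Omega>2"
    and nz: "\<alpha> \<noteq> 0" "a \<noteq> 0" "c \<noteq> 0"
    and glue: "\<And>x. x \<noteq> 0 \<Longrightarrow> G3 (axis 1 x) = G2 (axis 1 (1 / (\<alpha> * x)))"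
    and sep: "G2 (axis 1 0) \<notin> G3 ` \<Omega>3" "G3 (axis 1 0) \<notin> G2 ` \<Omega>2"
    and trans: "\<And>x. x \<noteq> 0 \<Longrightarrow> \<forall>\<^sub>F w in nhds (axis 1 x). w \<in> \<Omega>3 \<and> \<Phi> w \<in> \<Omega>2 \<and> G3 w = G2 (\<Phi> w)"
    and jac: "\<And>x. x \<noteq> 0 \<Longrightarrow> cjacobian \<Phi> (axis 1 x) $ 2 $ 2 = a"
      "\<And>x. x \<noteq> 0 \<Longrightarrow> cjacobian \<Phi> (axis 1 x) $ 2 $ 3 = b / x"
      "\<And>x. x \<noteq> 0 \<Longrightarrow> cjacobian \<Phi> (axis 1 x) $ 3 $ 2 = 0"
      "\<And>x. x \<noteq> 0 \<Longrightarrow> cjacobian \<Phi> (axis 1 x) $ 3 $ 3 = c / x\<^sup>2"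
    and L: "L = atlas_topology A closure_of {G3 (axis 1 x) |x. x \<noteq> 0}"
begin

lemmas inj = holo_param_inj[OF P3] holo_param_inj[OF P2]
lemmas cont = holo_param_cont[OF P3] holo_param_cont[OF P2]

definition curve :: "cp1 \<Rightarrow> 'z" where
  "curve P = (if P \<in> range psi1 then G3 (axis 1 (inv psi1 P $ 1)) else G2 (axis 1 0))"

lemma curve_psi1: "curve (cp1_pt z 1) = G3 (axis 1 z)"
  using range_psi1[of z 1] by (simp add: curve_def inv_psi1)

text \<open>The factor \<open>1 / \<alpha>\<close> comes from \<open>glue\<close> at
  \<open>x = 1 / z\<close>: the coordinate of the second chart is
  \<open>1 / (\<alpha> x) = z / \<alpha>\<close>.\<close>

lemma curve_psi2: "curve (cp1_pt 1 z) = G2 (axis 1 (z / \<alpha>))"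
proof (cases "z = 0")
  case True
  then show ?thesis using range_psi1[of 1 0] by (simp add: curve_def)
next
  case False
  then have "cp1_pt 1 z = cp1_pt (1 / z) 1" by (simp add: cp1_pt_eq_iff)
  then show ?thesis using False glue[of "1 / z"] nz by (simp add: curve_psi1)
qed

lemma continuous_on_axis: "continuous_on S (\<lambda>z. axis 1 (z * k :: complex) :: complex ^ 3)"
proof -
  have "(\<lambda>z. axis 1 (z * k) :: complex ^ 3) = (\<lambda>z. \<chi> i. z * (axis 1 k $ i))"
    by (auto simp: fun_eq_iff vec_eq_iff axis_def)
  then show ?thesis by (simp only:) (intro continuous_on_vec_lambda continuous_intros)
qed

lemma continuous_param_axis:
  assumes "continuous_map (top_of_set \<Omega>) T G" "\<And>x. axis 1 x \<in> \<Omega>"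
  shows "continuous_map euclidean T (\<lambda>z. G (axis (1::3) (z * k :: complex)))"
proof -
  have "continuous_map euclidean (top_of_set \<Omega>) (\<lambda>z. axis 1 (z * k))"
    unfolding continuous_map_in_subtopology
    using continuous_on_axis[of UNIV k] assms(2) by (auto simp: continuous_map_iff_continuous2)
  from continuous_map_compose[OF this assms(1)] show ?thesis by (simp add: comp_def)
qed

lemma continuous_map_curve: "continuous_map (atlas_topology CP1) (atlas_topology A) curve"
  using continuous_param_axis[OF cont(1) ax3, of 1] continuous_param_axis[OF cont(2) ax2, of "1 / \<alpha>"]
  by (intro continuous_map_from_CP1) (simp_all add: curve_psi1 curve_psi2)

lemma curve_inf: "P \<in> carrier_of CP1 \<Longrightarrow> P \<notin> range psi1 \<Longrightarrow> P = cp1_pt 1 0"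
proof -
  assume P: "P \<in> carrier_of CP1" "P \<notin> range psi1"
  obtain s t where st: "P = cp1_pt s t" "(s, t) \<noteq> (0, 0)" using P(1) by (rule carrier_CP1_E)
  then have "t = 0" using P(2) range_psi1[OF st(2)] by simp
  then show ?thesis using st by (simp add: cp1_pt_eq_iff)
qed

lemma inj_on_curve: "inj_on curve (carrier_of CP1)"
proof (rule inj_onI)
  fix P P' assume P: "P \<in> carrier_of CP1" "P' \<in> carrier_of CP1" "curve P = curve P'"
  have r: "curve Q \<in> G3 ` \<Omega>3 \<longleftrightarrow> Q \<in> range psi1" for Q
    unfolding curve_def using ax3 sep(1) by simp
  show "P = P'"
  proof (cases "P \<in> range psi1")
    case True
    then have "P' \<in> range psi1" using r P(3) by metis
    then obtain v v' :: "complex ^ 1" where v: "P = cp1_pt (v $ 1) 1" "P' = cp1_pt (v' $ 1) 1"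
      using True by (elim imageE)
    have "G3 (axis 1 (v $ 1)) = G3 (axis 1 (v' $ 1))" using P(3) unfolding v curve_psi1 .
    from inj_onD[OF inj(1) this ax3 ax3] have "v $ 1 = v' $ 1" by (metis axis_nth(1))
    then show ?thesis using v by simp
  next
    case False
    then have P': "P' \<notin> range psi1" using r P(3) by metis
    show ?thesis using curve_inf[OF P(1) False] curve_inf[OF P(2) P'] by (rule HOL.trans[OF _ sym])
  qed
qed

text \<open>The image of the compact line is closed in the Hausdorff threefold, so it contains the
  closure. Conversely both ends are limits of points with nonzero coordinate.\<close>

lemma curve_image: "curve ` carrier_of CP1 = L"
proof
  have clo: "closedin (atlas_topology A) (curve ` carrier_of CP1)"
    using image_compactin[OF _ continuous_map_curve, of "carrier_of CP1"] compact_space_CP1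
    by (intro compactin_imp_closedin[OF Haus]) (simp add: compact_space_def topspace_atlas)
  have sub: "{G3 (axis 1 x) |x. x \<noteq> 0} \<subseteq> curve ` carrier_of CP1"
  proof
    fix p assume "p \<in> {G3 (axis 1 x) |x. x \<noteq> 0}"
    then obtain x where "p = curve (cp1_pt x 1)" unfolding curve_psi1 by blast
    then show "p \<in> curve ` carrier_of CP1" by (rule image_eqI) simp
  qed
  show "L \<subseteq> curve ` carrier_of CP1"
    unfolding L by (rule closure_of_minimal[OF sub clo])
  show "curve ` carrier_of CP1 \<subseteq> L"
  proof
    fix p assume "p \<in> curve ` carrier_of CP1"
    then obtain P where P: "p = curve P" "P \<in> carrier_of CP1" by blast
    show "p \<in> L"
    proof (cases "P \<in> range psi1")
      case True
      then obtain v :: "complex ^ 1" where v: "P = cp1_pt (v $ 1) 1" by (elim imageE)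
      show ?thesis
      proof (cases "v $ 1 = 0")
        case True
        have "G3 (axis 1 (0 * 1)) \<in> L"
          unfolding L by (rule closure_of_line[OF continuous_param_axis[OF cont(1) ax3]]) auto
        then show ?thesis using True unfolding P v curve_psi1 by simp
      next
        case False
        have "p \<in> topspace (atlas_topology A)"
          using continuous_map_image_subset_topspace[OF continuous_map_curve] P by (auto simp: topspace_atlas)
        moreover have "p \<in> {G3 (axis 1 x) |x. x \<noteq> 0}" using False unfolding P v curve_psi1 by blast
        ultimately show ?thesis unfolding L by (rule mem_closure_of[rotated])
      qed
    next
      case False
      have "G2 (axis 1 (0 * (1 / \<alpha>))) \<in> L"
        unfolding L
      proof (rule closure_of_line[OF continuous_param_axis[OF cont(2) ax2]])
        fix z :: complex assume "z \<noteq> 0"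
        then show "G2 (axis 1 (z * (1 / \<alpha>))) \<in> {G3 (axis 1 x) |x. x \<noteq> 0}"
          using glue[of "1 / z"] nz by (auto intro!: exI[of _ "1 / z"])
      qed
      then show ?thesis using curve_inf[OF P(2) False] curve_psi2[of 0] unfolding P by simp
    qed
  qed
qed

end

text \<open>The derivative along the axis is an invertible matrix applied to a nonzero vector,
  whence the curve is an immersion. The factor \<open>k\<close> covers both charts of the line at
  once.\<close>

lemma param_axis_holo:
  assumes P: "holo_param A \<Omega> G" and V: "(V, \<psi>) \<in> A" and x: "axis 1 (x $ 1 * k) \<in> \<Omega>" "G (axis 1 (x $ 1 * k)) \<in> V"
    and k: "k \<noteq> 0"
  shows "holo_at (\<lambda>x::complex ^ 1. \<psi> (G (axis (1::3) (x $ 1 * k)))) x \<and>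
    inj ((*v) (cjacobian (\<lambda>x::complex ^ 1. \<psi> (G (axis (1::3) (x $ 1 * k)))) x))"
proof -
  obtain J where J: "((\<lambda>w. \<psi> (G w)) has_derivative (*v) J) (at (axis 1 (x $ 1 * k)))" "invertible J"
    using holo_paramD[OF P V x] by blast
  have "((\<lambda>x::complex ^ 1. axis (1::3) (x $ 1 * k)) has_derivative (\<lambda>h. axis 1 (h $ 1 * k))) (at x)"
  proof (rule vec_has_derivative)
    fix i :: 3
    have "((\<lambda>x::complex ^ 1. x $ 1 * (axis (1::3) k $ i)) has_derivative (\<lambda>h. h $ 1 * (axis (1::3) k $ i))) (at x)"
      by (intro has_derivative_mult_left has_derivative_vec_nth[OF has_derivative_ident])
    moreover have "y * (axis (1::3) k $ i) = axis (1::3) (y * k) $ i" for y by (simp add: axis_def)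
    ultimately show "((\<lambda>x::complex ^ 1. axis (1::3) (x $ 1 * k) $ i) has_derivative (\<lambda>h. axis (1::3) (h $ 1 * k) $ i)) (at x)"
      by simp
  qed
  from has_derivative_compose[OF this J(1)]
  have d: "((\<lambda>x::complex ^ 1. \<psi> (G (axis (1::3) (x $ 1 * k)))) has_derivative (\<lambda>h. J *v axis 1 (h $ 1 * k))) (at x)" .
  define N :: "complex ^ 1 ^ 3" where "N = (\<chi> i j. axis 1 k $ i)"
  have N: "N *v h = axis 1 (h $ 1 * k)" for h
    by (simp add: N_def vec_eq_iff matrix_vector_mult_def axis_def)
  have d': "((\<lambda>x::complex ^ 1. \<psi> (G (axis (1::3) (x $ 1 * k)))) has_derivative (*v) (J ** N)) (at x)"
    by (rule has_derivative_eq_rhs[OF d]) (simp add: fun_eq_iff N flip: matrix_vector_mul_assoc)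
  have "inj ((*v) (J ** N))"
  proof (rule injI)
    fix h h' assume "(J ** N) *v h = (J ** N) *v h'"
    then have "J *v (N *v h) = J *v (N *v h')" by (simp add: matrix_vector_mul_assoc)
    moreover obtain J' where "J' ** J = mat 1" using J(2) unfolding invertible_def by blast
    ultimately have "N *v h = N *v h'" by (metis matrix_vector_mul_assoc matrix_vector_mul_lid)
    then have "h $ 1 * k = h' $ 1 * k" unfolding N by (metis axis_nth(1))
    then show "h = h'" using k by (simp add: vec1_eq_iff)
  qed
  then show ?thesis using d' cjacobian_eq[OF d'] by metis
qed

context chart_pair
begin

lemma holo_embedding_curve: "holo_embedding CP1 A curve"
proof -
  have charts: "holo_on (\<psi> \<circ> curve \<circ> inv_into U \<phi>) (\<phi> ` {p \<in> U. curve p \<in> V}) \<and>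
      (\<forall>p\<in>U. curve p \<in> V \<longrightarrow> inj ((*v) (cjacobian (\<psi> \<circ> curve \<circ> inv_into U \<phi>) (\<phi> p))))"
    if U: "(U, \<phi>) \<in> CP1" and V: "(V, \<psi>) \<in> A" for U \<phi> V \<psi>
  proof -
    obtain psi G \<Omega> k where psi: "inj psi" "U = range psi" "\<phi> = inv psi"
      and G: "\<And>x. curve (psi x) = G (axis 1 (x $ 1 * k))" "holo_param A \<Omega> G" "\<And>x. axis 1 x \<in> \<Omega>" "k \<noteq> 0"
    proof -
      from U consider "U = range psi1" "\<phi> = inv psi1" | "U = range psi2" "\<phi> = inv psi2"
        unfolding CP1_alt by blast
      then show ?thesis
      proof cases
        case 1
        show ?thesis
          by (rule that[OF inj_psi1 1, of G3 1 \<Omega>3]) (simp_all add: curve_psi1 P3 ax3)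
      next
        case 2
        show ?thesis
          by (rule that[OF inj_psi2 2, of G2 "1 / \<alpha>" \<Omega>2]) (simp_all add: curve_psi2 P2 ax2 nz)
      qed
    qed
    have ivp: "inv_into (range psi) (inv psi) x = psi x" for x
      by (rule inv_into_f_eq[OF inj_on_inv_into]) (auto intro: inv_f_f[OF psi(1)])
    have eq: "\<psi> \<circ> curve \<circ> inv_into U \<phi> = (\<lambda>x. \<psi> (G (axis 1 (x $ 1 * k))))"
      unfolding psi by (simp add: fun_eq_iff ivp G(1))
    have *: "holo_at (\<psi> \<circ> curve \<circ> inv_into U \<phi>) x \<and> inj ((*v) (cjacobian (\<psi> \<circ> curve \<circ> inv_into U \<phi>) x))"
      if "curve (psi x) \<in> V" for x
      unfolding eq using that unfolding G(1) by (intro param_axis_holo[OF G(2) V G(3) _ G(4)])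
    show ?thesis
    proof (intro conjI ballI impI)
      show "holo_on (\<psi> \<circ> curve \<circ> inv_into U \<phi>) (\<phi> ` {p \<in> U. curve p \<in> V})"
        unfolding holo_on_iff
      proof
        fix x assume "x \<in> \<phi> ` {p \<in> U. curve p \<in> V}"
        then have "curve (psi x) \<in> V" unfolding psi by (auto simp: inv_f_f[OF psi(1)])
        then show "holo_at (\<psi> \<circ> curve \<circ> inv_into U \<phi>) x" using * by blast
      qed
      fix p assume p: "p \<in> U" "curve p \<in> V"
      then obtain x where "p = psi x" unfolding psi by blast
      then show "inj ((*v) (cjacobian (\<psi> \<circ> curve \<circ> inv_into U \<phi>) (\<phi> p)))"
        using *[of x] p unfolding psi by (simp add: inv_f_f[OF psi(1)])
    qed
  qed
  \<comment> \<open>A continuous injection from a compact space into a Hausdorff space is closed,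
    hence an embedding.\<close>
  have "embedding_map (atlas_topology CP1) (atlas_topology A) curve"
    by (intro injective_closed_imp_embedding_map continuous_map_curve
        continuous_imp_closed_map_gen compact_space_CP1 Hausdorff_imp_kc_space[OF Haus])
      (simp add: topspace_atlas inj_on_curve)
  then show ?thesis
    unfolding holo_embedding_def holo_map_def using continuous_map_curve charts by blast
qed

abbreviation c3 :: "'z set \<times> ('z \<Rightarrow> complex ^ 3)" where "c3 \<equiv> param_chart \<Omega>3 G3"
abbreviation c2 :: "'z set \<times> ('z \<Rightarrow> complex ^ 3)" where "c2 \<equiv> param_chart \<Omega>2 G2"

lemma curve_in_L: "G3 (axis 1 x) \<in> L" "G2 (axis 1 x) \<in> L"
proof -
  have "curve (cp1_pt x 1) \<in> L" "curve (cp1_pt 1 (x * \<alpha>)) \<in> L"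
    unfolding curve_image[symmetric] by (rule imageI, simp)+
  then show "G3 (axis 1 x) \<in> L" "G2 (axis 1 x) \<in> L"
    using nz by (simp_all add: curve_psi1 curve_psi2)
qed

lemma L_cases:
  assumes "p \<in> L"
  obtains (fin) x where "p = G3 (axis 1 x)" | (inf) "p = G2 (axis 1 0)"
proof -
  obtain P where P: "p = curve P" "P \<in> carrier_of CP1" using assms curve_image by blast
  show ?thesis
  proof (cases "P \<in> range psi1")
    case True
    then obtain v :: "complex ^ 1" where v: "P = cp1_pt (v $ 1) 1" by (elim imageE)
    show ?thesis using fin[of "v $ 1"] P(1) unfolding v curve_psi1 by blast
  next
    case False
    show ?thesis using inf P(1) curve_inf[OF P(2) False] curve_psi2[of 0] by simp
  qed
qed

text \<open>On each chart domain the axis is all of \<open>L\<close>, because \<open>sep\<close>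
  excludes the one point of \<open>L\<close> outside that axis.\<close>

lemma adapted: "c3 \<in> adapted_charts A L" "c2 \<in> adapted_charts A L"
proof -
  have "L \<inter> G3 ` \<Omega>3 = {p \<in> G3 ` \<Omega>3. snd c3 p $ 2 = 0 \<and> snd c3 p $ 3 = 0}"
  proof (intro equalityI subsetI)
    fix p assume "p \<in> L \<inter> G3 ` \<Omega>3"
    then have p: "p \<in> L" "p \<in> G3 ` \<Omega>3" by auto
    show "p \<in> {p \<in> G3 ` \<Omega>3. snd c3 p $ 2 = 0 \<and> snd c3 p $ 3 = 0}"
      using p(1)
    proof (cases rule: L_cases)
      case (fin x)
      then show ?thesis using p(2) snd_param_chart[OF inj(1) ax3, of x] by (simp add: axis_nth)
    next
      case inf
      then show ?thesis using p(2) sep by blast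
    qed
  next
    fix p assume p: "p \<in> {p \<in> G3 ` \<Omega>3. snd c3 p $ 2 = 0 \<and> snd c3 p $ 3 = 0}"
    then obtain w where w: "w \<in> \<Omega>3" "p = G3 w" by blast
    then have "w = axis 1 (w $ 1)"
      using p snd_param_chart[OF inj(1) w(1)] by (intro axis_eq_iff3) auto
    then show "p \<in> L \<inter> G3 ` \<Omega>3" using w curve_in_L(1)[of "w $ 1"] by auto
  qed
  then show "c3 \<in> adapted_charts A L"
    by (intro adapted_chartsI param_chart_compatible[OF A P3]) simp
  have "L \<inter> G2 ` \<Omega>2 = {p \<in> G2 ` \<Omega>2. snd c2 p $ 2 = 0 \<and> snd c2 p $ 3 = 0}"
  proof (intro equalityI subsetI)
    fix p assume "p \<in> L \<inter> G2 ` \<Omega>2"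
    then have p: "p \<in> L" "p \<in> G2 ` \<Omega>2" by auto
    have "\<exists>y. p = G2 (axis 1 y)"
      using p(1)
    proof (cases rule: L_cases)
      case (fin x)
      then have "x \<noteq> 0" using p(2) sep(2) by auto
      then show ?thesis using fin glue by blast
    qed blast
    then show "p \<in> {p \<in> G2 ` \<Omega>2. snd c2 p $ 2 = 0 \<and> snd c2 p $ 3 = 0}"
      using p(2) snd_param_chart[OF inj(2) ax2] by (auto simp: axis_nth)
  next
    fix p assume p: "p \<in> {p \<in> G2 ` \<Omega>2. snd c2 p $ 2 = 0 \<and> snd c2 p $ 3 = 0}"
    then obtain w where w: "w \<in> \<Omega>2" "p = G2 w" by blast
    then have "w = axis 1 (w $ 1)"
      using p snd_param_chart[OF inj(2) w(1)] by (intro axis_eq_iff3) auto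
    then show "p \<in> L \<inter> G2 ` \<Omega>2" using w curve_in_L(2)[of "w $ 1"] by auto
  qed
  then show "c2 \<in> adapted_charts A L"
    by (intro adapted_chartsI param_chart_compatible[OF A P2]) simp
qed

text \<open>Near a point of the axis the change of charts coincides with \<open>\<Phi>\<close>, so
  the two Jacobians agree there and \<open>jac\<close> supplies the block.\<close>

lemma normal_trans:
  assumes x: "x \<noteq> 0"
  shows "btrans (normal_bundle A L) c2 c3 (G3 (axis 1 x)) = mk2 a (b / x) 0 (c / x\<^sup>2)"
proof -
  obtain N where N: "open N" "axis 1 x \<in> N" "\<And>w. w \<in> N \<Longrightarrow> w \<in> \<Omega>3 \<and> \<Phi> w \<in> \<Omega>2 \<and> G3 w = G2 (\<Phi> w)"
    using trans[OF x] unfolding eventually_nhds by blast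
  let ?f = "snd c2 \<circ> inv_into (fst c3) (snd c3)"
  have s: "snd c3 (G3 (axis 1 x)) = axis 1 x" by (rule snd_param_chart[OF inj(1) ax3])
  have "holo_at ?f (snd c3 (G3 (axis 1 x)))"
  proof (rule compatible_transition_holo[OF adapted_compatible[OF adapted(2)] adapted_compatible[OF adapted(1)]])
    show "G3 (axis 1 x) \<in> fst c2" unfolding glue[OF x] using ax2 by simp
    show "G3 (axis 1 x) \<in> fst c3" using ax3 by simp
  qed
  then have h: "holo_at ?f (axis 1 x)" unfolding s .
  have "cjacobian \<Phi> (axis 1 x) = cjacobian ?f (axis 1 x)"
  proof (rule cjacobian_cong[OF h N(1,2)])
    fix w assume "w \<in> N"
    then have w: "w \<in> \<Omega>3" "\<Phi> w \<in> \<Omega>2" "G3 w = G2 (\<Phi> w)" using N(3) by auto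
    show "?f w = \<Phi> w"
      using inv_param_chart[OF inj(1) w(1)] snd_param_chart[OF inj(2) w(2)] w(3) by simp
  qed
  then show ?thesis
    unfolding normal_bundle_def vbundle.simps s
    using jac[OF x] by (simp add: vec_eq_iff forall_2 normal_index_simps)
qed

lemma curve_bundle:
  fixes E defines "E \<equiv> pullback_bundle CP1 curve (normal_bundle A L)"
  shows "holo_bundle CP1 E" "c3 \<in> bindex E" "c2 \<in> bindex E" "bdom E c3 = range psi1" "bdom E c2 = range psi2"
    "x \<noteq> 0 \<Longrightarrow> btrans E c2 c3 (cp1_pt x 1) = mk2 a (b / x) 0 (c / x\<^sup>2)"
proof -
  have hm: "holo_map CP1 A curve" using holo_embedding_curve unfolding holo_embedding_def by blast
  have cover: "L \<subseteq> (\<Union>c\<in>adapted_charts A L. fst c)"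
  proof
    fix p assume "p \<in> L"
    then have "p \<in> fst c3 \<or> p \<in> fst c2" using ax3 ax2 by (cases rule: L_cases) auto
    then show "p \<in> (\<Union>c\<in>adapted_charts A L. fst c)" using adapted by blast
  qed
  show "holo_bundle CP1 E" unfolding E_def by (rule holo_bundle_pullback_normal[OF hm curve_image cover])
  show "c3 \<in> bindex E" "c2 \<in> bindex E" unfolding E_def by (simp_all add: pullback_simps normal_bundle_simps adapted)
  have m3: "P \<in> bdom E c3 \<longleftrightarrow> P \<in> carrier_of CP1 \<and> curve P \<in> G3 ` \<Omega>3"
    and m2: "P \<in> bdom E c2 \<longleftrightarrow> P \<in> carrier_of CP1 \<and> curve P \<in> G2 ` \<Omega>2" for P
    unfolding E_def using curve_image by (auto simp: pullback_simps normal_bundle_simps)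
  have r: "curve P \<in> G3 ` \<Omega>3 \<longleftrightarrow> P \<in> range psi1" for P
    unfolding curve_def using ax3 sep(1) by simp
  show "bdom E c3 = range psi1"
  proof (rule set_eqI)
    show "P \<in> bdom E c3 \<longleftrightarrow> P \<in> range psi1" for P
      unfolding m3 r carrier_CP1_psi by (simp only: Un_iff) argo
  qed
  have "curve P \<in> G2 ` \<Omega>2 \<longleftrightarrow> P \<in> range psi2" if P: "P \<in> carrier_of CP1" for P
  proof -
    obtain s t where st: "P = cp1_pt s t" "(s, t) \<noteq> (0, 0)" using P by (rule carrier_CP1_E)
    show ?thesis
    proof (cases "s = 0")
      case True
      then have "P = cp1_pt 0 1" using st by (simp add: cp1_pt_eq_iff)
      then show ?thesis using sep(2) range_psi2[of 0 1] by (simp add: curve_psi1)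
    next
      case False
      then have "P = cp1_pt 1 (t / s)" using st by (simp add: cp1_pt_eq_iff)
      then show ?thesis using ax2 range_psi2[of 1 "t / s"] by (simp add: curve_psi2)
    qed
  qed
  then have "P \<in> bdom E c2 \<longleftrightarrow> P \<in> carrier_of CP1 \<and> P \<in> range psi2" for P
    unfolding m2 by (rule conj_cong[OF refl])
  note h = this[unfolded carrier_CP1_psi Un_iff]
  show "bdom E c2 = range psi2"
  proof (rule set_eqI)
    show "P \<in> bdom E c2 \<longleftrightarrow> P \<in> range psi2" for P
      unfolding h by argo
  qed
  show "x \<noteq> 0 \<Longrightarrow> btrans E c2 c3 (cp1_pt x 1) = mk2 a (b / x) 0 (c / x\<^sup>2)"
    unfolding E_def by (simp add: pullback_simps curve_psi1 normal_trans)
qed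

lemma normal_split_1_1: "b \<noteq> 0 \<Longrightarrow> normal_bundle_iso_split A L (\<lambda>i. 1)"
  unfolding normal_bundle_iso_split_def
  using holo_embedding_curve curve_image bundle_iso_split_1_1[OF curve_bundle nz(2,3)] by blast

lemma normal_split_0_2: "b = 0 \<Longrightarrow> normal_bundle_iso_split A L (\<lambda>i. if i = 1 then 0 else 2)"
  unfolding normal_bundle_iso_split_def
  using holo_embedding_curve curve_image bundle_iso_split_0_2[OF curve_bundle nz(2,3)] by blast

text \<open>The embedding \<theta> witnessing the splitting need not be \<open>curve\<close>. The
  two axes are therefore pulled back through the inverse of \<theta>, which by
  \<open>holo_curve_of_chart\<close> gives holomorphic curves in the line, and the transition matrix
  along them is unchanged.\<close>

lemma normal_split_0_2_imp:
  assumes "normal_bundle_iso_split A L (\<lambda>i. if i = 1 then 0 else 2)"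
  shows "b = 0"
proof -
  obtain \<theta> where \<theta>: "holo_embedding CP1 A \<theta>" "\<theta> ` carrier_of CP1 = L"
    and iso: "bundle_iso CP1 (pullback_bundle CP1 \<theta> (normal_bundle A L)) (split_bundle (\<lambda>i. if i = 1 then 0 else 2))"
    using assms unfolding normal_bundle_iso_split_def by blast
  have hm: "holo_map CP1 A \<theta>" and emb: "embedding_map (atlas_topology CP1) (atlas_topology A) \<theta>"
    using \<theta>(1) unfolding holo_embedding_def by blast+
  have inj\<theta>: "inj_on \<theta> (carrier_of CP1)"
    using emb unfolding embedding_map_def homeomorphic_map_def topspace_atlas by blast
  define \<rho> where "\<rho> = (\<lambda>p. inv_into (carrier_of CP1) \<theta> p)"
  have \<theta>\<rho>: "\<theta> (\<rho> p) = p" and \<rho>car: "\<rho> p \<in> carrier_of CP1" if "p \<in> L" for p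
    using that \<theta>(2) inv_into_into f_inv_into_f unfolding \<rho>_def by metis+
  have ne: "\<rho> p \<noteq> \<rho> q" if "p \<in> L" "q \<in> L" "p \<noteq> q" for p q using that \<theta>\<rho> by metis
  show ?thesis
  proof (rule not_bundle_iso_split_0_2[OF iso, where ?i3.0 = c3 and ?i2.0 = c2
        and ?\<rho>3.0 = "\<lambda>x. \<rho> (G3 (axis 1 x))" and ?\<rho>2.0 = "\<lambda>x. \<rho> (G2 (axis 1 x))" and \<alpha> = \<alpha> and a = a and c = c])
    show "holo_curve (\<lambda>x. \<rho> (G3 (axis 1 x)))" unfolding \<rho>_def
      by (rule holo_curve_of_chart[OF hm inj\<theta> \<theta>(2) adapted(1)])
        (use curve_in_L ax3 snd_param_chart[OF inj(1) ax3] in auto)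
    show "holo_curve (\<lambda>x. \<rho> (G2 (axis 1 x)))" unfolding \<rho>_def
      by (rule holo_curve_of_chart[OF hm inj\<theta> \<theta>(2) adapted(2)])
        (use curve_in_L ax2 snd_param_chart[OF inj(2) ax2] in auto)
    have "axis (1::3) (1::complex) \<noteq> axis 1 0" by (metis axis_nth(1) zero_neq_one)
    then have "G3 (axis 1 1) \<noteq> G3 (axis 1 0)" using inj_onD[OF inj(1) _ ax3 ax3] by blast
    then show "\<rho> (G3 (axis 1 1)) \<noteq> \<rho> (G3 (axis 1 0))" by (intro ne curve_in_L)
    have "G3 (axis 1 1) \<noteq> G2 (axis 1 0)" using sep(1) ax3 by (metis image_eqI)
    then show "\<rho> (G3 (axis 1 1)) \<noteq> \<rho> (G2 (axis 1 0))" by (intro ne curve_in_L)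
  qed (use nz adapted glue normal_trans \<theta>\<rho> \<rho>car curve_in_L ax3 ax2 in
      \<open>simp_all add: pullback_simps normal_bundle_simps\<close>)
qed

end

section \<open>The successive blow-ups\<close>

lemma all4: "(\<forall>i::4. P i) \<longleftrightarrow> P 0 \<and> P 1 \<and> P 2 \<and> P 3"
proof -
  have "(4::4) = 0" by simp
  then show ?thesis unfolding forall_4 by metis
qed

lemma hom4_nth [simp]: "hom4 y0 y1 y2 y3 $ 0 = y0" "hom4 y0 y1 y2 y3 $ 1 = y1"
  "hom4 y0 y1 y2 y3 $ 2 = y2" "hom4 y0 y1 y2 y3 $ 3 = y3"
  by (simp_all add: hom4_def)

lemma mem_o2_pt: "(y, z) \<in> o2_pt y z"
  unfolding o2_pt_def by (auto intro!: exI[of _ 1])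

lemma o2_pt_memD: "(y', z') \<in> o2_pt y z \<Longrightarrow> \<exists>c. c \<noteq> 0 \<and> y' = c *s y \<and> z' = c\<^sup>2 * z"
  unfolding o2_pt_def by blast

lemma o2_pt_scale:
  assumes c: "c \<noteq> 0"
  shows "o2_pt (c *s y) (c\<^sup>2 * z) = o2_pt y z"
proof (intro equalityI subsetI)
  fix P assume "P \<in> o2_pt (c *s y) (c\<^sup>2 * z)"
  then obtain k where k: "k \<noteq> 0" "P = (k *s (c *s y), k\<^sup>2 * (c\<^sup>2 * z))" unfolding o2_pt_def by blast
  then have "k * c \<noteq> 0 \<and> P = ((k * c) *s y, (k * c)\<^sup>2 * z)"
    using c by (simp add: power_mult_distrib vector_smult_assoc)
  then show "P \<in> o2_pt y z" unfolding o2_pt_def by blast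
next
  fix P assume "P \<in> o2_pt y z"
  then obtain k where k: "k \<noteq> 0" "P = (k *s y, k\<^sup>2 * z)" unfolding o2_pt_def by blast
  then have "k / c \<noteq> 0 \<and> P = ((k / c) *s (c *s y), (k / c)\<^sup>2 * (c\<^sup>2 * z))"
    using c by (simp add: power_divide vector_smult_assoc)
  then show "P \<in> o2_pt (c *s y) (c\<^sup>2 * z)" unfolding o2_pt_def by blast
qed

lemma inj_o2_param: "inj (o2_param k)"
proof (rule injI)
  fix x x' assume "o2_param k x = o2_param k x'"
  then have "((\<chi> i. if i = k then 1 else x' $ i), x' $ k) \<in> o2_param k x"
    using mem_o2_pt unfolding o2_param_def by simp
  then obtain c where c: "(\<chi> i. if i = k then 1 else x' $ i) = c *s (\<chi> i. if i = k then 1 else x $ i)"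
    "x' $ k = c\<^sup>2 * x $ k"
    unfolding o2_param_def using o2_pt_memD by blast
  have n: "(if i = k then 1 else x' $ i) = c * (if i = k then 1 else x $ i)" for i
    using c(1) by (metis (mono_tags, lifting) vec_lambda_beta vector_smult_component)
  have "c = 1" using n[of k] by simp
  then have "x' $ i = x $ i" for i using n[of i] c(2) by (cases "i = k") auto
  then show "x = x'" by (simp add: vec_eq_iff)
qed

definition o2_aff :: "4 \<Rightarrow> complex ^ 4 \<Rightarrow> complex \<Rightarrow> complex ^ 4" where
  "o2_aff k y z = (\<chi> i. if i = k then z / (y $ k)\<^sup>2 else y $ i / y $ k)"

lemma o2_pt_param:
  assumes "y $ k \<noteq> 0"
  shows "o2_pt y z = o2_param k (o2_aff k y z)"
proof -
  have "o2_param k (o2_aff k y z) = o2_pt ((1 / y $ k) *s y) ((1 / y $ k)\<^sup>2 * z)"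
    unfolding o2_param_def using assms
    by (intro arg_cong2[where f = o2_pt]) (auto simp: vec_eq_iff o2_aff_def power_divide)
  then show ?thesis using o2_pt_scale[of "1 / y $ k" y z] assms by simp
qed

lemma range_o2_param: "o2_pt y z \<in> range (o2_param k) \<longleftrightarrow> y $ k \<noteq> 0"
proof
  assume "o2_pt y z \<in> range (o2_param k)"
  then obtain x where "o2_pt y z = o2_param k x" by (elim imageE)
  then have "(y, z) \<in> o2_param k x" using mem_o2_pt by metis
  then obtain c where "c \<noteq> 0" "y = c *s (\<chi> i. if i = k then 1 else x $ i)"
    unfolding o2_param_def using o2_pt_memD by blast
  then show "y $ k \<noteq> 0" by simp
next
  assume "y $ k \<noteq> 0"
  from o2_pt_param[OF this] show "o2_pt y z \<in> range (o2_param k)" by simp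
qed

lemma inv_o2_param: "y $ k \<noteq> 0 \<Longrightarrow> inv (o2_param k) (o2_pt y z) = o2_aff k y z"
  using o2_pt_param[of y k z] inv_f_f[OF inj_o2_param] by simp

lemma O2_chart: "(range (o2_param k), inv (o2_param k)) \<in> O2"
  unfolding O2_def by blast

lemma o2_pt_carrier: "y \<noteq> 0 \<Longrightarrow> o2_pt y z \<in> carrier_of O2"
proof -
  assume "y \<noteq> 0"
  then obtain k where "y $ k \<noteq> 0" by (auto simp: vec_eq_iff)
  then show ?thesis by (intro carrier_ofI[OF O2_chart[of k]]) (simp add: range_o2_param)
qed

lemma continuous_map_o2_pt:
  assumes y: "continuous_map X euclidean y" and z: "continuous_map X euclidean z"
    and nz: "\<And>x. x \<in> topspace X \<Longrightarrow> y x \<noteq> 0"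
  shows "continuous_map X (atlas_topology O2) (\<lambda>x. o2_pt (y x) (z x))"
proof (rule continuous_map_atlasI)
  show "o2_pt (y x) (z x) \<in> carrier_of O2" if "x \<in> topspace X" for x
    using o2_pt_carrier nz[OF that] by blast
  have yz: "continuous_map X euclidean (\<lambda>x. (y x, z x))"
    using continuous_map_pairedI[OF y z] by (simp add: euclidean_product_topology)
  fix U \<phi> S assume "(U, \<phi>) \<in> O2" and S: "open (S :: (complex ^ 4) set)"
  then obtain k where k: "U = range (o2_param k)" "\<phi> = inv (o2_param k)" unfolding O2_def by blast
  have T: "open {p::(complex^4)\<times>complex. fst p $ k \<noteq> 0}"
    by (auto intro!: open_Collect_neq continuous_intros)
  have c: "continuous_on {p::(complex^4)\<times>complex. fst p $ k \<noteq> 0} (\<lambda>p. o2_aff k (fst p) (snd p))"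
    unfolding o2_aff_def
  proof (rule continuous_on_vec_lambda)
    show "continuous_on {p::(complex^4)\<times>complex. fst p $ k \<noteq> 0}
      (\<lambda>p. if i = k then snd p / (fst p $ k)\<^sup>2 else fst p $ i / fst p $ k)" for i
      by (cases "i = k") (auto intro!: continuous_intros)
  qed
  have "{x \<in> topspace X. o2_pt (y x) (z x) \<in> U \<and> \<phi> (o2_pt (y x) (z x)) \<in> S} =
      {x \<in> topspace X. (y x, z x) \<in> {p. fst p $ k \<noteq> 0} \<and> o2_aff k (fst (y x, z x)) (snd (y x, z x)) \<in> S}"
    unfolding k by (intro Collect_cong conj_cong refl) (simp_all add: range_o2_param inv_o2_param)
  then show "openin X {x \<in> topspace X. o2_pt (y x) (z x) \<in> U \<and> \<phi> (o2_pt (y x) (z x)) \<in> S}"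
    using openin_preimage_on[OF yz c T S] by simp
qed

text \<open>Equality of continuous maps into a Hausdorff space passes to the closure. The version
  local to \<open>V\<close> is needed because affine coordinates are continuous only on their
  chart.\<close>

lemma eq_on_closure_of:
  assumes q: "q \<in> T closure_of S" and V: "openin T V" "q \<in> V" and Y: "Hausdorff_space Y"
    and f: "continuous_map (subtopology T V) Y f" and g: "continuous_map (subtopology T V) Y g"
    and eq: "\<And>s. s \<in> S \<Longrightarrow> s \<in> V \<Longrightarrow> f s = g s"
  shows "f q = g q"
proof (rule forall_in_closure_of_eq[OF _ Y f g])
  have "q \<in> V \<inter> T closure_of S" using q V by blast
  also have "\<dots> = (subtopology T V) closure_of S" using V(1) by (simp add: closure_of_subtopology_open)
  also have "\<dots> = (subtopology T V) closure_of (topspace (subtopology T V) \<inter> S)"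
    by (rule closure_of_restrict)
  finally show "q \<in> (subtopology T V) closure_of (topspace (subtopology T V) \<inter> S)" .
qed (use eq in auto)

lemma continuous_map_compose_on:
  assumes "continuous_map X euclidean f" "continuous_on T h" "\<And>x. x \<in> topspace X \<Longrightarrow> f x \<in> T"
  shows "continuous_map X euclidean (\<lambda>x. h (f x))"
proof -
  have "continuous_map X (top_of_set T) f"
    using assms(1,3) by (auto simp: continuous_map_in_subtopology)
  moreover have "continuous_map (top_of_set T) euclidean h" using assms(2) by simp
  ultimately show ?thesis using continuous_map_compose[of X "top_of_set T" f euclidean h] by (simp add: comp_def)
qed

lemma lform_scale: "lform l (c * x0) (c * x1) = c * lform l x0 (x1 :: complex)"
  by (simp add: lform_def algebra_simps)

lemma lform_add: "lform l (x0 + y0) (x1 + y1) = lform l x0 x1 + lform l y0 (y1 :: complex)"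
  by (simp add: lform_def algebra_simps)

lemma qform_scale: "qform Q (c * x0) (c * x1) = c\<^sup>2 * qform Q x0 (x1 :: complex)"
  by (cases Q) (simp add: qform_def algebra_simps power2_eq_square)

lemma continuous_on_lform [continuous_intros]:
  "continuous_on S f \<Longrightarrow> continuous_on S g \<Longrightarrow> continuous_on S (\<lambda>x. lform l (f x) (g x) :: complex)"
  unfolding lform_def by (intro continuous_intros)

lemma continuous_on_qform [continuous_intros]:
  "continuous_on S f \<Longrightarrow> continuous_on S g \<Longrightarrow> continuous_on S (\<lambda>x. qform Q (f x) (g x) :: complex)"
  unfolding qform_def by (cases Q) (auto intro!: continuous_intros)

locale resolution_data =
  fixes a b lam :: real and Q :: "real \<times> real \<times> real" and l1 l2 l3 l4 :: "real \<times> real"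
  assumes prod4: "\<And>x0 x1 :: complex. lform l1 x0 x1 * lform l2 x0 x1 * lform l3 x0 x1 * lform l4 x0 x1 =
      x0 * x1 * (x0 + x1) * (of_real a * x0 - of_real b * x1)"
    and nzl: "lform l1 (of_real lam) (1::complex) \<noteq> 0" "lform l2 (of_real lam) (1::complex) \<noteq> 0"
      "lform l3 (of_real lam) (1::complex) \<noteq> 0" "lform l4 (of_real lam) (1::complex) \<noteq> 0"
begin

text \<open>Local coordinates \<open>(x\<^sub>0, x\<^sub>1, v)\<close> of the resolution, with \<open>\<xi> = v l\<^sub>1 l\<^sub>2\<close> and
  \<open>\<eta> = l\<^sub>3 l\<^sub>4 / v\<close>.\<close>

definition xiF :: "complex \<Rightarrow> complex \<Rightarrow> complex \<Rightarrow> complex" where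
  "xiF x0 x1 v = v * lform l1 x0 x1 * lform l2 x0 x1"

definition etaF :: "complex \<Rightarrow> complex \<Rightarrow> complex \<Rightarrow> complex" where
  "etaF x0 x1 v = lform l3 x0 x1 * lform l4 x0 x1 / v"

definition x2F :: "complex \<Rightarrow> complex \<Rightarrow> complex \<Rightarrow> complex" where
  "x2F x0 x1 v = (xiF x0 x1 v - etaF x0 x1 v) / (2 * \<i>) - qform Q x0 x1"

definition zF :: "complex \<Rightarrow> complex \<Rightarrow> complex \<Rightarrow> complex" where
  "zF x0 x1 v = (xiF x0 x1 v + etaF x0 x1 v) / 2"

definition ptF :: "complex \<Rightarrow> complex \<Rightarrow> complex \<Rightarrow> o2" where
  "ptF x0 x1 v = o2_pt (hom4 x0 x1 (x2F x0 x1 v) 1) (zF x0 x1 v)"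

text \<open>The blow-up coordinates of the point with coordinates \<open>(x0, x1, v)\<close> are
  \<open>u = v l2\<close>, then \<open>v\<close>, then \<open>w = v / l3\<close>; the last is kept
  as a ratio since \<open>l3\<close> may vanish.\<close>

definition model1 where "model1 x0 x1 v = (ptF x0 x1 v, cp1_pt (v * lform l2 x0 x1) 1)"
definition model2 where "model2 x0 x1 v = (model1 x0 x1 v, cp1_pt v 1)"
definition model3 where "model3 x0 x1 v = (model2 x0 x1 v, cp1_pt v (lform l3 x0 x1))"

lemma xi_eta_F: "zF x0 x1 v + \<i> * (x2F x0 x1 v + qform Q x0 x1) = xiF x0 x1 v"
  "zF x0 x1 v - \<i> * (x2F x0 x1 v + qform Q x0 x1) = etaF x0 x1 v"
  unfolding zF_def x2F_def by (simp_all add: field_simps)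

lemma inv_ptF: "inv (o2_param 3) (ptF x0 x1 v) = hom4 x0 x1 (x2F x0 x1 v) (zF x0 x1 v)"
  unfolding ptF_def by (subst inv_o2_param) (simp_all add: o2_aff_def vec_eq_iff all4)

text \<open>The equation is homogeneous of weight 4, so any representative decides membership. The
  sum of squares is split into the two factors that become \<xi> and \<eta>.\<close>

lemma Z0_iff:
  "o2_pt y z \<in> Z0 a b Q \<longleftrightarrow> y \<noteq> 0 \<and>
    (z + \<i> * (y $ 2 * y $ 3 + qform Q (y $ 0) (y $ 1))) * (z - \<i> * (y $ 2 * y $ 3 + qform Q (y $ 0) (y $ 1))) =
    lform l1 (y $ 0) (y $ 1) * lform l2 (y $ 0) (y $ 1) * lform l3 (y $ 0) (y $ 1) * lform l4 (y $ 0) (y $ 1)"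
proof -
  define E where "E = (\<lambda>(y :: complex ^ 4) z. z\<^sup>2 + (y $ 2 * y $ 3 + qform Q (y $ 0) (y $ 1))\<^sup>2
       - y $ 0 * y $ 1 * (y $ 0 + y $ 1) * (of_real a * y $ 0 - of_real b * y $ 1))"
  have E: "E (c *s y) (c\<^sup>2 * z) = c ^ 4 * E y z" for c y z
    unfolding E_def by (simp add: qform_scale) (simp add: algebra_simps power2_eq_square power4_eq_xxxx)
  have "o2_pt y z \<in> Z0 a b Q \<longleftrightarrow> y \<noteq> 0 \<and> E y z = 0"
  proof
    assume "o2_pt y z \<in> Z0 a b Q"
    then obtain y' z' where y': "o2_pt y z = o2_pt y' z'" "y' \<noteq> 0" "E y' z' = 0"
      unfolding Z0_def E_def by blast
    then have "(y, z) \<in> o2_pt y' z'" using mem_o2_pt by metis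
    then obtain c where "c \<noteq> 0" "y = c *s y'" "z = c\<^sup>2 * z'" using o2_pt_memD by blast
    then show "y \<noteq> 0 \<and> E y z = 0" using y' E by simp
  next
    assume "y \<noteq> 0 \<and> E y z = 0"
    then show "o2_pt y z \<in> Z0 a b Q" unfolding Z0_def E_def by blast
  qed
  moreover have "E y z = 0 \<longleftrightarrow>
    (z + \<i> * (y $ 2 * y $ 3 + qform Q (y $ 0) (y $ 1))) * (z - \<i> * (y $ 2 * y $ 3 + qform Q (y $ 0) (y $ 1))) =
    lform l1 (y $ 0) (y $ 1) * lform l2 (y $ 0) (y $ 1) * lform l3 (y $ 0) (y $ 1) * lform l4 (y $ 0) (y $ 1)"
    unfolding prod4 E_def by (simp add: algebra_simps power2_eq_square)
  ultimately show ?thesis by simp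
qed

lemma ptF_Z0: "v \<noteq> 0 \<Longrightarrow> ptF x0 x1 v \<in> Z0 a b Q \<inter> range (o2_param 3)"
proof -
  assume v: "v \<noteq> 0"
  have nz: "hom4 x0 x1 (x2F x0 x1 v) 1 \<noteq> 0"
    by (metis hom4_nth(4) zero_index zero_neq_one)
  have "xiF x0 x1 v * etaF x0 x1 v =
      lform l1 x0 x1 * lform l2 x0 x1 * lform l3 x0 x1 * lform l4 x0 x1"
    using v by (simp add: xiF_def etaF_def)
  then have "ptF x0 x1 v \<in> Z0 a b Q"
    unfolding ptF_def Z0_iff using nz xi_eta_F[of x0 x1 v] by simp
  moreover have "ptF x0 x1 v \<in> range (o2_param 3)" unfolding ptF_def range_o2_param by simp
  ultimately show ?thesis by blast
qed

abbreviation "D3 \<equiv> {e :: complex \<times> complex \<times> complex. snd (snd e) \<noteq> 0}"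
abbreviation "T0 \<equiv> atlas_topology O2"
abbreviation "T1 \<equiv> prod_topology T0 (atlas_topology CP1)"
abbreviation "T2 \<equiv> prod_topology T1 (atlas_topology CP1)"
abbreviation "T3 \<equiv> prod_topology T2 (atlas_topology CP1)"

lemma continuous_map_model:
  assumes "continuous_map X euclidean f0" "continuous_map X euclidean f1" "continuous_map X euclidean fv"
    and nz: "\<And>x. x \<in> topspace X \<Longrightarrow> fv x \<noteq> 0"
  shows "continuous_map X T1 (\<lambda>x. model1 (f0 x) (f1 x) (fv x))"
    "continuous_map X T2 (\<lambda>x. model2 (f0 x) (f1 x) (fv x))"
    "continuous_map X T3 (\<lambda>x. model3 (f0 x) (f1 x) (fv x))"
proof -
  let ?e = "\<lambda>x. (f0 x, f1 x, fv x)"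
  have e: "continuous_map X euclidean ?e"
    using continuous_map_pairedI[OF assms(1) continuous_map_pairedI[OF assms(2,3)]]
    by (simp add: euclidean_product_topology)
  have inD: "?e x \<in> D3" if "x \<in> topspace X" for x using nz[OF that] by simp
  note on = continuous_map_compose_on[OF e _ inD]
  have xi: "continuous_on D3 (\<lambda>e. xiF (fst e) (fst (snd e)) (snd (snd e)))"
    and eta: "continuous_on D3 (\<lambda>e. etaF (fst e) (fst (snd e)) (snd (snd e)))"
    unfolding xiF_def etaF_def by (auto intro!: continuous_intros)
  have x2: "continuous_on D3 (\<lambda>e. x2F (fst e) (fst (snd e)) (snd (snd e)))"
    and z: "continuous_on D3 (\<lambda>e. zF (fst e) (fst (snd e)) (snd (snd e)))"
    unfolding x2F_def zF_def by (intro continuous_intros xi eta; simp)+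
  have h: "continuous_on D3 (\<lambda>e. hom4 (fst e) (fst (snd e)) (x2F (fst e) (fst (snd e)) (snd (snd e))) 1)"
    unfolding hom4_def
  proof (rule continuous_on_vec_lambda)
    show "continuous_on D3 (\<lambda>e. if i = 0 then fst e else if i = 1 then fst (snd e) else
        if i = 2 then x2F (fst e) (fst (snd e)) (snd (snd e)) else 1)" for i :: 4
      by (cases "i = 0"; cases "i = 1"; cases "i = 2") (auto intro!: continuous_intros x2)
  qed
  have nzh: "hom4 (f0 x) (f1 x) (x2F (f0 x) (f1 x) (fv x)) 1 \<noteq> 0" for x
    by (metis hom4_nth(4) zero_index zero_neq_one)
  have pt: "continuous_map X T0 (\<lambda>x. ptF (f0 x) (f1 x) (fv x))"
    unfolding ptF_def
    by (rule continuous_map_o2_pt) (use on[OF h] on[OF z] nzh in simp_all)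
  have u: "continuous_map X (atlas_topology CP1) (\<lambda>x. cp1_pt (fv x * lform l2 (f0 x) (f1 x)) 1)"
    by (rule continuous_map_cp1_pt)
      (use on[of "\<lambda>e. snd (snd e) * lform l2 (fst e) (fst (snd e))"] in \<open>simp_all add: continuous_intros\<close>)
  have v: "continuous_map X (atlas_topology CP1) (\<lambda>x. cp1_pt (fv x) 1)"
    by (rule continuous_map_cp1_pt) (use assms in simp_all)
  have w: "continuous_map X (atlas_topology CP1) (\<lambda>x. cp1_pt (fv x) (lform l3 (f0 x) (f1 x)))"
    by (rule continuous_map_cp1_pt)
      (use assms nz on[of "\<lambda>e. lform l3 (fst e) (fst (snd e))"] in \<open>simp_all add: continuous_intros\<close>)
  show 1: "continuous_map X T1 (\<lambda>x. model1 (f0 x) (f1 x) (fv x))"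
    unfolding model1_def by (rule continuous_map_pairedI[OF pt u])
  show 2: "continuous_map X T2 (\<lambda>x. model2 (f0 x) (f1 x) (fv x))"
    unfolding model2_def by (rule continuous_map_pairedI[OF 1 v])
  show "continuous_map X T3 (\<lambda>x. model3 (f0 x) (f1 x) (fv x))"
    unfolding model3_def by (rule continuous_map_pairedI[OF 2 w])
qed

abbreviation "X0 \<equiv> Z0 a b Q \<inter> range (o2_param 3)"
abbreviation "X1 \<equiv> blow_up T0 X0 (\<lambda>P. cp1_pt (xi_coord Q P) 1) (lform_coord l1)"
abbreviation "X2 \<equiv> blow_up T1 X1 snd (lform_coord l2 \<circ> fst)"
abbreviation "X3 \<equiv> blow_up T2 X2 snd (lform_coord l3 \<circ> fst \<circ> fst)"

lemma resolution_model_alt: "resolution_model a b Q l1 l2 l3 = X3"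
  unfolding resolution_model_def Let_def ..

definition graph :: "'p set \<Rightarrow> ('p \<Rightarrow> cp1) \<Rightarrow> ('p \<Rightarrow> complex) \<Rightarrow> ('p \<times> cp1) set" where
  "graph X m l = {(p, cp1_pt m0 (m1 * l p)) |p m0 m1.
           p \<in> X \<and> (m0, m1) \<noteq> (0, 0) \<and> m p = cp1_pt m0 m1 \<and> (m0, m1 * l p) \<noteq> (0, 0)}"

lemma blow_up_graph: "blow_up T X m l = (X \<times> carrier_of CP1) \<inter> (prod_topology T (atlas_topology CP1) closure_of graph X m l)"
  unfolding blow_up_def graph_def ..

lemma graphI:
  "p \<in> X \<Longrightarrow> (m0, m1) \<noteq> (0, 0) \<Longrightarrow> m p = cp1_pt m0 m1 \<Longrightarrow> (m0, m1 * l p) \<noteq> (0, 0) \<Longrightarrow>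
    n = cp1_pt m0 (m1 * l p) \<Longrightarrow> (p, n) \<in> graph X m l"
  unfolding graph_def by (intro CollectI exI conjI) auto

lemma graphE:
  assumes "(p, n) \<in> graph X m l"
  obtains m0 m1 where "p \<in> X" "(m0, m1) \<noteq> (0, 0)" "m p = cp1_pt m0 m1" "(m0, m1 * l p) \<noteq> (0, 0)"
    "n = cp1_pt m0 (m1 * l p)"
  using assms that unfolding graph_def by (elim CollectE exE conjE) simp

lemma coords_ptF: "xi_coord Q (ptF x0 x1 v) = xiF x0 x1 v" "lform_coord l (ptF x0 x1 v) = lform l x0 x1"
  unfolding xi_coord_def lform_coord_def Let_def inv_ptF by (simp_all add: xi_eta_F)

lemma line_continuous: "continuous_map euclidean euclidean (\<lambda>t::complex. x + t * (d::complex))"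
  by (simp add: continuous_intros)

lemma line_nonzero:
  assumes "lform l x0 x1 = 0" "lform l (of_real lam) (1::complex) \<noteq> 0" "t \<noteq> (0::complex)"
  shows "lform l (x0 + t * of_real lam) (x1 + t * 1) \<noteq> 0"
  using assms unfolding lform_add lform_scale by simp

text \<open>A point where the form vanishes is approached along the direction
  \<open>(lam, 1)\<close>. There the form is nonzero by hypothesis, so it is nonzero at every other
  point of this line.\<close>

lemma mem_closure_of_graph:
  assumes cont: "\<And>x0 x1. continuous_map euclidean T (\<lambda>t::complex. m (x0 + t * of_real lam) (x1 + t * 1))"
    and G: "\<And>x0 x1. lform l x0 x1 \<noteq> 0 \<Longrightarrow> m x0 x1 \<in> G" and nz: "lform l (of_real lam) (1::complex) \<noteq> 0"
  shows "m x0 x1 \<in> T closure_of G"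
proof (cases "lform l x0 x1 = 0")
  case True
  have "m (x0 + 0 * of_real lam) (x1 + 0 * 1) \<in> T closure_of G"
    by (rule closure_of_line[OF cont G[OF line_nonzero[OF True nz]]])
  then show ?thesis by simp
next
  case False
  have "\<forall>t. m (x0 + t * of_real lam) (x1 + t * 1) \<in> topspace T"
    using continuous_map_image_subset_topspace[OF cont] by (simp add: image_subset_iff)
  from this[rule_format, of 0] have "m x0 x1 \<in> topspace T" by simp
  then show ?thesis by (rule mem_closure_of[OF G[OF False]])
qed

lemma model1_mem: "v \<noteq> 0 \<Longrightarrow> model1 x0 x1 v \<in> X1"
proof -
  assume v: "v \<noteq> 0"
  let ?G = "graph X0 (\<lambda>P. cp1_pt (xi_coord Q P) 1) (lform_coord l1)"
  have g: "model1 x0 x1 v \<in> ?G" if l: "lform l1 x0 x1 \<noteq> 0" for x0 x1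
    unfolding model1_def
  proof (rule graphI[where ?m0.0 = "xiF x0 x1 v" and ?m1.0 = 1])
    show "cp1_pt (v * lform l2 x0 x1) 1 = cp1_pt (xiF x0 x1 v) (1 * lform_coord l1 (ptF x0 x1 v))"
      using l unfolding coords_ptF by (subst cp1_pt_eq_iff) (auto simp: xiF_def)
  qed (use ptF_Z0[OF v] l in \<open>auto simp: coords_ptF\<close>)
  have "model1 x0 x1 v \<in> T1 closure_of ?G"
    by (rule mem_closure_of_graph[where l = l1 and m = "\<lambda>x0 x1. model1 x0 x1 v", OF _ g nzl(1)])
      (rule continuous_map_model(1)[OF line_continuous line_continuous], use v in simp_all)
  then show ?thesis
    unfolding blow_up_graph using ptF_Z0[OF v] by (simp add: model1_def)
qed

lemma model2_mem: "v \<noteq> 0 \<Longrightarrow> model2 x0 x1 v \<in> X2"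
proof -
  assume v: "v \<noteq> 0"
  let ?G = "graph X1 snd (lform_coord l2 \<circ> fst)"
  have g: "model2 x0 x1 v \<in> ?G" if l: "lform l2 x0 x1 \<noteq> 0" for x0 x1
    unfolding model2_def
  proof (rule graphI[where ?m0.0 = "v * lform l2 x0 x1" and ?m1.0 = 1])
    show "cp1_pt v 1 = cp1_pt (v * lform l2 x0 x1) (1 * (lform_coord l2 \<circ> fst) (model1 x0 x1 v))"
      using l v unfolding model1_def comp_def fst_conv coords_ptF by (subst cp1_pt_eq_iff) auto
  qed (use model1_mem[OF v] l v in \<open>auto simp: coords_ptF model1_def\<close>)
  have "model2 x0 x1 v \<in> T2 closure_of ?G"
    by (rule mem_closure_of_graph[where l = l2 and m = "\<lambda>x0 x1. model2 x0 x1 v", OF _ g nzl(2)])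
      (rule continuous_map_model(2)[OF line_continuous line_continuous], use v in simp_all)
  then show ?thesis
    unfolding blow_up_graph[of T1] using model1_mem[OF v] by (simp add: model2_def)
qed

text \<open>For \<open>v\<close> nonzero the ratio \<open>(v : l3)\<close> is defined even where
  \<open>l3\<close> vanishes, so the point already lies in the graph.\<close>

lemma model3_mem: "v \<noteq> 0 \<Longrightarrow> model3 x0 x1 v \<in> X3"
proof -
  assume v: "v \<noteq> 0"
  let ?G = "graph X2 snd (lform_coord l3 \<circ> fst \<circ> fst)"
  have g: "model3 x0 x1 v \<in> ?G" for x0 x1
    unfolding model3_def
    by (rule graphI[where ?m0.0 = v and ?m1.0 = 1])
      (use model2_mem[OF v] v in \<open>auto simp: coords_ptF model1_def model2_def\<close>)
  have "model3 x0 x1 v \<in> T3 closure_of ?G"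
    by (rule mem_closure_of_graph[where l = l1 and m = "\<lambda>x0 x1. model3 x0 x1 v", OF _ g nzl(1)])
      (rule continuous_map_model(3)[OF line_continuous line_continuous], use v in simp_all)
  then show ?thesis
    unfolding blow_up_graph[of T2] using model2_mem[OF v] v by (auto simp: model3_def)
qed

section \<open>Conversely, points of the blow-ups with finite nonzero \<open>v\<close> are given by
  the local coordinates\<close>

definition etac :: "o2 \<Rightarrow> complex" where
  "etac P = (let x = inv (o2_param 3) P in x $ 3 - \<i> * (x $ 2 + qform Q (x $ 0) (x $ 1)))"

lemma X0_xi_eta:
  assumes "p \<in> X0"
  shows "xi_coord Q p * etac p = lform_coord l1 p * lform_coord l2 p * lform_coord l3 p * lform_coord l4 p"
proof -
  obtain x where x: "p = o2_param 3 x" using assms by blast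
  have "inv (o2_param 3) p = x" unfolding x by (rule inv_f_f[OF inj_o2_param])
  moreover have "o2_pt (\<chi> i. if i = 3 then 1 else x $ i) (x $ 3) \<in> Z0 a b Q"
    using assms unfolding x o2_param_def by blast
  ultimately show ?thesis
    unfolding Z0_iff xi_coord_def etac_def lform_coord_def Let_def by simp
qed

text \<open>The values of \<xi> and \<eta> determine \<open>z\<close> as their half sum and
  \<open>x2 + Q\<close> from their difference, so the point is fixed by
  \<open>(x0, x1, v)\<close>.\<close>

lemma X0_eq_ptF:
  assumes "p \<in> X0" "v \<noteq> 0" "xi_coord Q p = v * lform_coord l1 p * lform_coord l2 p"
    "etac p * v = lform_coord l3 p * lform_coord l4 p"
  shows "p = ptF (inv (o2_param 3) p $ 0) (inv (o2_param 3) p $ 1) v"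
proof -
  define x where "x = inv (o2_param 3) p"
  have p: "p = o2_param 3 x" unfolding x_def using assms(1) by (simp add: f_inv_into_f)
  have xi: "x $ 3 + \<i> * (x $ 2 + qform Q (x $ 0) (x $ 1)) = xiF (x $ 0) (x $ 1) v"
    using assms(3) unfolding xi_coord_def lform_coord_def Let_def x_def[symmetric] xiF_def .
  have eta: "x $ 3 - \<i> * (x $ 2 + qform Q (x $ 0) (x $ 1)) = etaF (x $ 0) (x $ 1) v"
    using assms(2,4) unfolding etac_def lform_coord_def Let_def x_def[symmetric] etaF_def by (simp add: field_simps)
  have "x $ 3 = zF (x $ 0) (x $ 1) v" unfolding zF_def xi[symmetric] eta[symmetric] by simp
  moreover have "x $ 2 = x2F (x $ 0) (x $ 1) v"
    unfolding x2F_def xi[symmetric] eta[symmetric] by (simp add: field_simps)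
  ultimately have "inv (o2_param 3) (ptF (x $ 0) (x $ 1) v) = x"
    unfolding inv_ptF by (simp add: vec_eq_iff all4)
  moreover have "ptF (x $ 0) (x $ 1) v \<in> range (o2_param 3)" using ptF_Z0[OF assms(2)] by blast
  ultimately have "ptF (x $ 0) (x $ 1) v = o2_param 3 x" by (metis f_inv_into_f)
  then show ?thesis unfolding x_def[symmetric] using p by (rule HOL.trans[OF _ sym, symmetric])
qed

definition aff :: "cp1 \<Rightarrow> complex" where "aff P = inv psi1 P $ 1"

lemma aff_cp1_pt: "t \<noteq> 0 \<Longrightarrow> aff (cp1_pt s t) = s / t"
  by (simp add: aff_def inv_psi1)

lemma continuous_aff: "continuous_map (subtopology (atlas_topology CP1) (range psi1)) euclidean aff"
proof -
  have "continuous_map (subtopology (atlas_topology CP1) (range psi1)) euclidean (inv psi1)"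
    by (rule continuous_map_chart) (simp add: CP1_alt)
  from continuous_map_compose_on[OF this, of UNIV "\<lambda>x. x $ 1"]
  show ?thesis unfolding aff_def by (simp add: continuous_intros)
qed

abbreviation "R3 \<equiv> range (o2_param 3)"

lemma continuous_coords: "continuous_map (subtopology T0 R3) euclidean (inv (o2_param 3))"
  by (rule continuous_map_chart[OF O2_chart])

lemma continuous_xi_lform_eta:
  assumes "continuous_map X (subtopology T0 R3) p"
  shows "continuous_map X euclidean (\<lambda>x. xi_coord Q (p x))" "continuous_map X euclidean (\<lambda>x. etac (p x))"
    "continuous_map X euclidean (\<lambda>x. lform_coord l (p x))"
proof -
  have c: "continuous_map X euclidean (\<lambda>x. inv (o2_param 3) (p x))"
    using continuous_map_compose[OF assms continuous_coords] by (simp add: comp_def)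
  note on = continuous_map_compose_on[OF c, of UNIV]
  show "continuous_map X euclidean (\<lambda>x. xi_coord Q (p x))"
    unfolding xi_coord_def Let_def
    using on[of "\<lambda>x. x $ 3 + \<i> * (x $ 2 + qform Q (x $ 0) (x $ 1))"] by (simp add: continuous_intros)
  show "continuous_map X euclidean (\<lambda>x. etac (p x))"
    unfolding etac_def Let_def
    using on[of "\<lambda>x. x $ 3 - \<i> * (x $ 2 + qform Q (x $ 0) (x $ 1))"] by (simp add: continuous_intros)
  show "continuous_map X euclidean (\<lambda>x. lform_coord l (p x))"
    unfolding lform_coord_def Let_def
    using on[of "\<lambda>x. lform l (x $ 0) (x $ 1)"] by (simp add: continuous_intros)
qed

lemma continuous_map_mult_C:
  assumes "continuous_map X euclidean f" "continuous_map X euclidean (g :: _ \<Rightarrow> complex)"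
  shows "continuous_map X euclidean (\<lambda>x. f x * g x)"
proof -
  have "continuous_map X euclidean (\<lambda>x. (f x, g x))"
    using continuous_map_pairedI[OF assms] by (simp add: euclidean_product_topology)
  from continuous_map_compose_on[OF this, of UNIV "\<lambda>z. fst z * snd z"]
  show ?thesis by (simp add: continuous_intros)
qed

lemma openin_R3: "openin T0 R3"
  by (rule openin_chart_domain[OF O2_chart])

text \<open>The blow-ups are closures, so closed conditions on the graphs pass to them.  Over finite values of
  the last coordinate the graphs satisfy the equations because there the linear form is nonzero.\<close>

lemma X1_equations:
  assumes q: "(p, u) \<in> X1" and u: "u \<in> range psi1"
  shows "p \<in> X0 \<and> xi_coord Q p = aff u * lform_coord l1 p \<and>
    etac p * aff u = lform_coord l2 p * lform_coord l3 p * lform_coord l4 p"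
proof -
  let ?G = "graph X0 (\<lambda>P. cp1_pt (xi_coord Q P) 1) (lform_coord l1)"
  let ?V = "R3 \<times> range psi1"
  have mem: "p \<in> X0" "(p, u) \<in> T1 closure_of ?G" using q unfolding blow_up_graph by auto
  have V: "openin T1 ?V"
    unfolding openin_prod_Times_iff by (intro disjI2 conjI openin_R3 openin_range_psi)
  have top: "subtopology T1 ?V = prod_topology (subtopology T0 R3) (subtopology (atlas_topology CP1) (range psi1))"
    by (rule subtopology_Times)
  have cp: "continuous_map (subtopology T1 ?V) (subtopology T0 R3) fst"
    unfolding top by (rule continuous_map_fst)
  have ca: "continuous_map (subtopology T1 ?V) euclidean (\<lambda>q. aff (snd q))"
    unfolding top using continuous_map_compose[OF continuous_map_snd continuous_aff] by (simp add: comp_def)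
  note c = continuous_xi_lform_eta[OF cp]
  have gr: "xi_coord Q (fst s) = aff (snd s) * lform_coord l1 (fst s) \<and>
      etac (fst s) * aff (snd s) = lform_coord l2 (fst s) * lform_coord l3 (fst s) * lform_coord l4 (fst s)"
    if s: "s \<in> ?G" "s \<in> ?V" for s
  proof -
    have "(fst s, snd s) \<in> ?G" using s(1) by simp
    then obtain m0 m1 where m: "fst s \<in> X0" "(m0, m1) \<noteq> (0, 0)" "cp1_pt (xi_coord Q (fst s)) 1 = cp1_pt m0 m1"
      "(m0, m1 * lform_coord l1 (fst s)) \<noteq> (0, 0)" "snd s = cp1_pt m0 (m1 * lform_coord l1 (fst s))"
      by (rule graphE)
    have n: "m1 * lform_coord l1 (fst s) \<noteq> 0"
      using s(2) range_psi1[OF m(4)] m(5) by (metis mem_Times_iff)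
    have x: "xi_coord Q (fst s) * m1 = m0" using m(2,3) by (simp add: cp1_pt_eq_iff)
    have A: "aff (snd s) = xi_coord Q (fst s) / lform_coord l1 (fst s)"
      unfolding m(5) aff_cp1_pt[OF n] x[symmetric] using n by simp
    have "etac (fst s) * xi_coord Q (fst s) = lform_coord l1 (fst s) * lform_coord l2 (fst s) * lform_coord l3 (fst s) * lform_coord l4 (fst s)"
      using X0_xi_eta[OF m(1)] by (simp add: mult.commute)
    then show ?thesis unfolding A using n by simp
  qed
  have pV: "(p, u) \<in> ?V" using mem u by blast
  have "xi_coord Q (fst (p, u)) = aff (snd (p, u)) * lform_coord l1 (fst (p, u))"
    by (rule eq_on_closure_of[OF mem(2) V pV Hausdorff_space_euclidean c(1) continuous_map_mult_C[OF ca c(3)]])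
      (use gr in blast)
  moreover have "etac (fst (p, u)) * aff (snd (p, u)) =
      lform_coord l2 (fst (p, u)) * lform_coord l3 (fst (p, u)) * lform_coord l4 (fst (p, u))"
    by (rule eq_on_closure_of[OF mem(2) V pV Hausdorff_space_euclidean
          continuous_map_mult_C[OF c(2) ca] continuous_map_mult_C[OF continuous_map_mult_C[OF c(3) c(3)] c(3)]])
      (use gr in blast)
  ultimately show ?thesis using mem(1) by simp
qed

lemma X2_equations:
  assumes q: "((p, u), v) \<in> X2" and v: "v \<in> range psi1"
  shows "p \<in> X0 \<and> xi_coord Q p = aff v * lform_coord l1 p * lform_coord l2 p \<and>
    etac p * aff v = lform_coord l3 p * lform_coord l4 p \<and> u = cp1_pt (aff v * lform_coord l2 p) 1"
proof -
  let ?G = "graph X1 snd (lform_coord l2 \<circ> fst)"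
  let ?V = "(R3 \<times> carrier_of CP1) \<times> range psi1"
  have mem: "(p, u) \<in> X1" "((p, u), v) \<in> T2 closure_of ?G" using q unfolding blow_up_graph[of T1] by auto
  have mem0: "p \<in> X0" "u \<in> carrier_of CP1" using mem(1) unfolding blow_up_graph by auto
  have V: "openin T2 ?V"
    unfolding openin_prod_Times_iff[of T1] openin_prod_Times_iff
    using openin_R3 openin_range_psi openin_topspace[of "atlas_topology CP1"] unfolding topspace_atlas by blast
  have top: "subtopology T2 ?V = prod_topology (prod_topology (subtopology T0 R3)
      (subtopology (atlas_topology CP1) (carrier_of CP1))) (subtopology (atlas_topology CP1) (range psi1))"
    by (simp only: subtopology_Times)
  have cp: "continuous_map (subtopology T2 ?V) (subtopology T0 R3) (\<lambda>q. fst (fst q))"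
    unfolding top using continuous_map_compose[OF continuous_map_fst continuous_map_fst] by (simp add: comp_def)
  have cu: "continuous_map (subtopology T2 ?V) (atlas_topology CP1) (\<lambda>q. snd (fst q))"
  proof (rule continuous_map_into_fulltopology)
    show "continuous_map (subtopology T2 ?V) (subtopology (atlas_topology CP1) (carrier_of CP1)) (\<lambda>q. snd (fst q))"
      unfolding top using continuous_map_compose[OF continuous_map_fst continuous_map_snd] by (simp add: comp_def)
  qed
  have ca: "continuous_map (subtopology T2 ?V) euclidean (\<lambda>q. aff (snd q))"
    unfolding top using continuous_map_compose[OF continuous_map_snd continuous_aff] by (simp add: comp_def)
  note c = continuous_xi_lform_eta[OF cp]
  have gr: "xi_coord Q (fst (fst s)) = aff (snd s) * lform_coord l1 (fst (fst s)) * lform_coord l2 (fst (fst s)) \<and>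
      etac (fst (fst s)) * aff (snd s) = lform_coord l3 (fst (fst s)) * lform_coord l4 (fst (fst s)) \<and>
      snd (fst s) = cp1_pt (aff (snd s) * lform_coord l2 (fst (fst s))) 1"
    if s: "s \<in> ?G" "s \<in> ?V" for s
  proof -
    define p u where "p = fst (fst s)" and "u = snd (fst s)"
    have "((p, u), snd s) \<in> ?G" using s(1) unfolding p_def u_def by simp
    then obtain m0 m1 where "(p, u) \<in> X1" "(m0, m1) \<noteq> (0, 0)" "snd (p, u) = cp1_pt m0 m1"
      "(m0, m1 * (lform_coord l2 \<circ> fst) (p, u)) \<noteq> (0, 0)" "snd s = cp1_pt m0 (m1 * (lform_coord l2 \<circ> fst) (p, u))"
      by (rule graphE)
    then have m: "(p, u) \<in> X1" "(m0, m1) \<noteq> (0, 0)" "u = cp1_pt m0 m1"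
      "(m0, m1 * lform_coord l2 p) \<noteq> (0, 0)" "snd s = cp1_pt m0 (m1 * lform_coord l2 p)"
      by (simp_all only: comp_def fst_conv snd_conv not_False_eq_True)
    have n: "m1 * lform_coord l2 p \<noteq> 0"
      using s(2) range_psi1[OF m(4)] m(5) by (metis mem_Times_iff)
    have ur: "u \<in> range psi1" unfolding m(3) range_psi1[OF m(2)] using n by simp
    have au: "aff u = m0 / m1" unfolding m(3) using n by (intro aff_cp1_pt) simp
    have av: "aff (snd s) = m0 / m1 / lform_coord l2 p"
      unfolding m(5) aff_cp1_pt[OF n] by simp
    have "aff (snd s) * lform_coord l2 p = aff u" unfolding au av using n by simp
    moreover have "u = cp1_pt (m0 / m1) 1" unfolding m(3) using n m(2) by (subst cp1_pt_eq_iff) auto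
    then have "u = cp1_pt (aff u) 1" unfolding au .
    \<comment> \<open>The equations for \<open>u\<close> turn into those for \<open>v\<close> by
      substituting \<open>u = v l2\<close>; in the equation for \<eta> the common factor
      \<open>l2\<close>, nonzero here, is cancelled.\<close>
    ultimately show ?thesis
      using X1_equations[OF m(1) ur] n unfolding p_def[symmetric] u_def[symmetric]
      by (auto simp: mult_ac) (metis mult.commute mult.left_commute mult_cancel_left)+
  qed
  have pV: "((p, u), v) \<in> ?V" using mem0 v by blast
  let ?q = "((p, u), v)"
  have "xi_coord Q (fst (fst ?q)) = aff (snd ?q) * lform_coord l1 (fst (fst ?q)) * lform_coord l2 (fst (fst ?q))"
    by (rule eq_on_closure_of[OF mem(2) V pV Hausdorff_space_euclidean c(1)
          continuous_map_mult_C[OF continuous_map_mult_C[OF ca c(3)] c(3)]])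
      (use gr in blast)
  moreover have "etac (fst (fst ?q)) * aff (snd ?q) = lform_coord l3 (fst (fst ?q)) * lform_coord l4 (fst (fst ?q))"
    by (rule eq_on_closure_of[OF mem(2) V pV Hausdorff_space_euclidean
          continuous_map_mult_C[OF c(2) ca] continuous_map_mult_C[OF c(3) c(3)]])
      (use gr in blast)
  moreover have "snd (fst ?q) = cp1_pt (aff (snd ?q) * lform_coord l2 (fst (fst ?q))) 1"
    by (rule eq_on_closure_of[OF mem(2) V pV Hausdorff_space_CP1 cu
          continuous_map_cp1_pt[OF continuous_map_mult_C[OF ca c(3)]]])
      (use gr in \<open>simp_all add: Ball_def\<close>)
  ultimately show ?thesis using mem0 by simp
qed

text \<open>The inverse direction to \<open>model3_mem\<close>: on the open part where
  \<open>v\<close> is finite and nonzero the resolution consists exactly of the points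
  \<open>model3\<close>. This is what makes the local coordinates a chart.\<close>

lemma X3_eq_model3:
  assumes q: "(((p, u), v), w) \<in> X3" and v: "v \<in> range psi1" "aff v \<noteq> 0"
  shows "(((p, u), v), w) = model3 (inv (o2_param 3) p $ 0) (inv (o2_param 3) p $ 1) (aff v)"
proof -
  let ?G = "graph X2 snd (lform_coord l3 \<circ> fst \<circ> fst)"
  \<comment> \<open>On the open set where \<open>v\<close> is finite and nonzero the pair
    \<open>(v, l3)\<close> never vanishes, so the expected value of \<open>w\<close> is continuous
    up to the closure.\<close>
  let ?N = "{v \<in> range psi1. inv psi1 v \<in> {x. x $ 1 \<noteq> 0}}"
  let ?V = "((R3 \<times> carrier_of CP1) \<times> ?N) \<times> carrier_of CP1"
  have mem: "((p, u), v) \<in> X2" "(((p, u), v), w) \<in> T3 closure_of ?G" "w \<in> carrier_of CP1"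
    using q unfolding blow_up_graph[of T2] by auto
  note eqs = X2_equations[OF mem(1) v(1)]
  have mem0: "u \<in> carrier_of CP1" using mem(1) unfolding blow_up_graph[of T1] blow_up_graph[of T0] by auto
  have N: "openin (atlas_topology CP1) ?N"
    by (rule openin_chart_preimage) (auto simp: CP1_alt intro!: open_Collect_neq continuous_intros)
  have C: "openin (atlas_topology CP1) (carrier_of CP1)"
    using openin_topspace[of "atlas_topology CP1"] unfolding topspace_atlas .
  have V: "openin T3 ?V"
    unfolding openin_prod_Times_iff[of T2] openin_prod_Times_iff[of T1] openin_prod_Times_iff
    using openin_R3 N C by blast
  have top: "subtopology T3 ?V = prod_topology (prod_topology (prod_topology (subtopology T0 R3)
      (subtopology (atlas_topology CP1) (carrier_of CP1))) (subtopology (atlas_topology CP1) ?N))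
      (subtopology (atlas_topology CP1) (carrier_of CP1))"
    by (simp only: subtopology_Times)
  have cp: "continuous_map (subtopology T3 ?V) (subtopology T0 R3) (\<lambda>q. fst (fst (fst q)))"
    unfolding top
    using continuous_map_compose[OF continuous_map_compose[OF continuous_map_fst continuous_map_fst] continuous_map_fst]
    by (simp add: comp_def)
  have cw: "continuous_map (subtopology T3 ?V) (atlas_topology CP1) snd"
  proof (rule continuous_map_into_fulltopology)
    show "continuous_map (subtopology T3 ?V) (subtopology (atlas_topology CP1) (carrier_of CP1)) snd"
      unfolding top by (rule continuous_map_snd)
  qed
  have caN: "continuous_map (subtopology (atlas_topology CP1) ?N) euclidean aff"
  proof -
    have "subtopology (atlas_topology CP1) ?N = subtopology (subtopology (atlas_topology CP1) (range psi1)) ?N"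
      unfolding subtopology_subtopology by (rule arg_cong2[where f = subtopology]) auto
    then show ?thesis using continuous_map_from_subtopology[OF continuous_aff] by simp
  qed
  have ca: "continuous_map (subtopology T3 ?V) euclidean (\<lambda>q. aff (snd (fst q)))"
    unfolding top
    using continuous_map_compose[OF continuous_map_compose[OF continuous_map_fst continuous_map_snd] caN]
    by (simp add: comp_def)
  note c = continuous_xi_lform_eta[OF cp]
  have gr: "snd s = cp1_pt (aff (snd (fst s))) (lform_coord l3 (fst (fst (fst s))))"
    if s: "s \<in> ?G" "s \<in> ?V" for s
  proof -
    define p v where "p = fst (fst (fst s))" and "v = snd (fst s)"
    have "(fst s, snd s) \<in> ?G" using s(1) by simp
    then obtain m0 m1 where "fst s \<in> X2" "(m0, m1) \<noteq> (0, 0)" "snd (fst s) = cp1_pt m0 m1"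
      "(m0, m1 * (lform_coord l3 \<circ> fst \<circ> fst) (fst s)) \<noteq> (0, 0)"
      "snd s = cp1_pt m0 (m1 * (lform_coord l3 \<circ> fst \<circ> fst) (fst s))"
      by (rule graphE)
    then have m: "(m0, m1) \<noteq> (0, 0)" "v = cp1_pt m0 m1"
      "(m0, m1 * lform_coord l3 p) \<noteq> (0, 0)" "snd s = cp1_pt m0 (m1 * lform_coord l3 p)"
      unfolding p_def v_def by (simp_all only: comp_def not_False_eq_True)
    have vr: "v \<in> range psi1" using s(2) unfolding v_def by auto
    have m1: "m1 \<noteq> 0" using vr unfolding m(2) range_psi1[OF m(1)] .
    have av: "aff v = m0 / m1" unfolding m(2) by (rule aff_cp1_pt[OF m1])
    have "cp1_pt m0 (m1 * lform_coord l3 p) = cp1_pt (m1 * aff v) (m1 * lform_coord l3 p)"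
      unfolding av using m1 by simp
    then show ?thesis
      unfolding m(4) p_def[symmetric] v_def[symmetric] using cp1_pt_scale[OF m1] by simp
  qed
  let ?q = "(((p, u), v), w)"
  have pV: "?q \<in> ?V" using mem0 mem(3) eqs v unfolding aff_def by blast
  have "snd ?q = cp1_pt (aff (snd (fst ?q))) (lform_coord l3 (fst (fst (fst ?q))))"
  proof (rule eq_on_closure_of[OF mem(2) V pV Hausdorff_space_CP1 cw continuous_map_cp1_pt[OF ca c(3)]])
    show "(aff (snd (fst s)), lform_coord l3 (fst (fst (fst s)))) \<noteq> (0, 0)"
      if "s \<in> topspace (subtopology T3 ?V)" for s
      using that unfolding aff_def by auto
  qed (rule gr)
  then have w: "w = cp1_pt (aff v) (lform_coord l3 p)" by simp
  have lf: "lform_coord l p = lform l (inv (o2_param 3) p $ 0) (inv (o2_param 3) p $ 1)" for l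
    unfolding lform_coord_def Let_def ..
  have vv: "v = cp1_pt (aff v) 1"
  proof -
    obtain x :: "complex ^ 1" where "v = cp1_pt (x $ 1) 1" using v(1) by (elim imageE)
    then show ?thesis by (simp add: aff_cp1_pt)
  qed
  have pp: "p = ptF (inv (o2_param 3) p $ 0) (inv (o2_param 3) p $ 1) (aff v)"
    using eqs v(2) by (intro X0_eq_ptF) auto
  show ?thesis
    unfolding model3_def model2_def model1_def pp[symmetric] lf[symmetric]
    using w vv eqs by simp
qed

end

section \<open>Charts of the resolution along the curve\<close>

lemma param_continuous_at:
  assumes G: "continuous_map (top_of_set \<Omega>) (atlas_topology A) G" "open \<Omega>" and U: "(U, \<phi>) \<in> A"
    and w: "w \<in> \<Omega>" "G w \<in> U"
  shows "continuous (at w) (\<lambda>w. \<phi> (G w))"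
  unfolding continuous_at_open
proof (intro allI impI)
  fix S assume S: "open S \<and> \<phi> (G w) \<in> S"
  have "open {w \<in> \<Omega>. G w \<in> {p \<in> U. \<phi> p \<in> S}}"
    by (rule openin_param_preimage[OF G openin_chart_preimage[OF U]]) (use S in blast)
  then show "\<exists>s. open s \<and> w \<in> s \<and> (\<forall>x'\<in>s. \<phi> (G x') \<in> S)"
    using w S by (intro exI[of _ "{w \<in> \<Omega>. G w \<in> {p \<in> U. \<phi> p \<in> S}}"]) auto
qed

lemma invertible_injI:
  fixes J :: "complex ^ 'n::finite ^ 'n"
  assumes "inj ((*v) J)"
  shows "invertible J"
proof -
  obtain B where "B ** J = mat 1"
    using assms matrix_left_invertible_injective[of J] unfolding inj_def by blast
  then show ?thesis using matrix_left_right_inverse unfolding invertible_def by blast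
qed

lemma holo_param_restrict:
  assumes P: "holo_param A \<Omega> G" and W: "\<And>w. w \<in> \<Omega> \<Longrightarrow> G w \<in> W"
  shows "holo_param (restrict_atlas A W) \<Omega> G"
proof (rule holo_paramI[OF holo_param_open[OF P] holo_param_inj[OF P]])
  show "continuous_map (top_of_set \<Omega>) (atlas_topology (restrict_atlas A W)) G"
    unfolding restrict_atlas_topology continuous_map_in_subtopology
    using holo_param_cont[OF P] W by auto
  fix U \<phi> w assume U: "(U, \<phi>) \<in> restrict_atlas A W" "w \<in> \<Omega>" "G w \<in> U"
  then obtain U' where "U = U' \<inter> W" "(U', \<phi>) \<in> A" unfolding restrict_atlas_def by blast
  then show "\<exists>J. ((\<lambda>w. \<phi> (G w)) has_derivative (*v) J) (at w) \<and> invertible J"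
    using holo_paramD[OF P, of U' \<phi> w] U by blast
qed

lemma holo_param_unrestrict:
  assumes P: "holo_param (restrict_atlas A W) \<Omega> G"
  shows "holo_param A \<Omega> G"
proof (rule holo_paramI[OF holo_param_open[OF P] holo_param_inj[OF P]])
  show "continuous_map (top_of_set \<Omega>) (atlas_topology A) G"
    using holo_param_cont[OF P] unfolding restrict_atlas_topology continuous_map_in_subtopology by blast
  fix U \<phi> w assume U: "(U, \<phi>) \<in> A" "w \<in> \<Omega>" "G w \<in> U"
  have "G w \<in> W" using holo_param_sub_carrier[OF P U(2)] unfolding carrier_restrict_atlas by blast
  then show "\<exists>J. ((\<lambda>w. \<phi> (G w)) has_derivative (*v) J) (at w) \<and> invertible J"
    using holo_paramD[OF P restrict_atlasI[OF U(1)] U(2)] U(3) by blast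
qed

lemma holo_at_vjoin:
  fixes f :: "complex ^ 'k::finite \<Rightarrow> complex ^ 'n::finite" and g :: "complex ^ 'k \<Rightarrow> complex ^ 'm::finite"
  assumes "holo_at f x" "holo_at g x"
  shows "holo_at (\<lambda>x. vjoin (f x) (g x)) x"
proof (rule holo_atI)
  show "cdiff (\<lambda>x. vjoin (f x) (g x) $ i) x" for i :: "'n + 'm"
    using cdiff_nth_holo[OF assms(1)] cdiff_nth_holo[OF assms(2)] by (cases i) simp_all
qed

lemma holo_at_vec: "cdiff f x \<Longrightarrow> holo_at (\<lambda>x. vec (f x) :: complex ^ 'n::finite) x"
  by (rule holo_atI) simp

lemma vconj_matrix:
  fixes J :: "complex ^ 'n::finite ^ 'm::finite"
  shows "vconj (J *v vconj h) = (\<chi> i j. cnj (J $ i $ j)) *v h"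
  by (simp add: vec_eq_iff matrix_vector_mult_def)

lemma invertible_cnj:
  assumes "invertible (J :: complex ^ 'n::finite ^ 'n)"
  shows "invertible (\<chi> i j. cnj (J $ i $ j))"
proof (rule invertible_injI, rule injI)
  fix h h' assume "(\<chi> i j. cnj (J $ i $ j)) *v h = (\<chi> i j. cnj (J $ i $ j)) *v h'"
  then have "J *v vconj h = J *v vconj h'"
    unfolding vconj_matrix[symmetric] by (metis vconj_vconj)
  moreover obtain J' where "J' ** J = mat 1" using assms unfolding invertible_def by blast
  ultimately have "vconj h = vconj h'" by (metis matrix_vector_mul_assoc matrix_vector_mul_lid)
  then show "h = h'" by (metis vconj_vconj)
qed

lemma has_derivative_vconj:
  assumes "(f has_derivative (*v) J) (at (vconj w))"
  shows "((\<lambda>w. vconj (f (vconj w))) has_derivative (*v) (\<chi> i j. cnj (J $ i $ j))) (at w)"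
proof -
  have v: "(vconj has_derivative vconj) (at w)"
    by (rule bounded_linear_imp_has_derivative[OF bounded_linear_vconj])
  have "((\<lambda>w. vconj (f (vconj w))) has_derivative (\<lambda>h. vconj (J *v vconj h))) (at w)"
    by (rule bounded_linear.has_derivative[OF bounded_linear_vconj has_derivative_compose[OF v assms]])
  then show ?thesis by (rule has_derivative_eq_rhs) (simp add: fun_eq_iff vconj_matrix)
qed

lemma mem_vconj_image: "w \<in> vconj ` S \<longleftrightarrow> vconj w \<in> S"
  by (metis image_iff vconj_vconj)

text \<open>Conjugating both the coordinates in the source and the charts in the target replaces the
  Jacobian by its complex conjugate, which is again complex linear and invertible.\<close>

lemma holo_param_conj:
  assumes P: "holo_param A \<Omega> G"
  shows "holo_param (conj_atlas A) (vconj ` \<Omega>) (\<lambda>w. G (vconj w))"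
proof (rule holo_paramI)
  show "open (vconj ` \<Omega>)" using holo_param_open[OF P] by (rule open_vconj_image)
  show "inj_on (\<lambda>w. G (vconj w)) (vconj ` \<Omega>)"
  proof (rule inj_onI)
    fix w w' assume w: "w \<in> vconj ` \<Omega>" "w' \<in> vconj ` \<Omega>" "G (vconj w) = G (vconj w')"
    then have "vconj w = vconj w'"
      using inj_onD[OF holo_param_inj[OF P] w(3)] by (simp add: mem_vconj_image)
    then show "w = w'" by (metis vconj_vconj)
  qed
  have "continuous_map (top_of_set (vconj ` \<Omega>)) (top_of_set \<Omega>) vconj"
    unfolding continuous_map_in_subtopology by (auto simp: continuous_on_vconj)
  from continuous_map_compose[OF this holo_param_cont[OF P]]
  show "continuous_map (top_of_set (vconj ` \<Omega>)) (atlas_topology (conj_atlas A)) (\<lambda>w. G (vconj w))"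
    unfolding conj_atlas_topology by (simp add: comp_def)
  fix U \<phi> w assume U: "(U, \<phi>) \<in> conj_atlas A" "w \<in> vconj ` \<Omega>" "G (vconj w) \<in> U"
  obtain \<psi> where \<psi>: "\<phi> = vconj \<circ> \<psi>" "(U, \<psi>) \<in> A" using U(1) unfolding conj_atlas_alt by auto
  obtain J where J: "((\<lambda>w. \<psi> (G w)) has_derivative (*v) J) (at (vconj w))" "invertible J"
    using holo_paramD[OF P \<psi>(2) _ U(3)] U(2) unfolding mem_vconj_image by blast
  show "\<exists>J. ((\<lambda>w. \<phi> (G (vconj w))) has_derivative (*v) J) (at w) \<and> invertible J"
    unfolding \<psi>(1) comp_def using has_derivative_vconj[OF J(1)] invertible_cnj[OF J(2)] by blast
qed

text \<open>The inverse map recovers the original parametrisation, so its invertible Jacobian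
  factors through the new one; this makes the new Jacobian injective, hence invertible.\<close>

lemma holo_param_biholomorphic:
  assumes P: "holo_param B \<Omega> G" and bih: "biholomorphic B C \<tau>"
    and injB: "\<And>V \<psi>. (V, \<psi>) \<in> B \<Longrightarrow> inj_on \<psi> V" and injC: "\<And>U \<phi>. (U, \<phi>) \<in> C \<Longrightarrow> inj_on \<phi> U"
  shows "holo_param C \<Omega> (\<lambda>w. \<tau> (G w))"
proof (rule holo_paramI[OF holo_param_open[OF P]])
  let ?\<sigma> = "inv_into (carrier_of B) \<tau>"
  have \<tau>: "inj_on \<tau> (carrier_of B)" "holo_map B C \<tau>" "holo_map C B ?\<sigma>"
    using bih unfolding biholomorphic_def bij_betw_def by blast+
  note car = holo_param_sub_carrier[OF P]
  have \<sigma>\<tau>: "?\<sigma> (\<tau> (G w)) = G w" if "w \<in> \<Omega>" for w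
    by (rule inv_into_f_f[OF \<tau>(1) car[OF that]])
  show "inj_on (\<lambda>w. \<tau> (G w)) \<Omega>"
  proof (rule inj_onI)
    fix w w' assume w: "w \<in> \<Omega>" "w' \<in> \<Omega>" "\<tau> (G w) = \<tau> (G w')"
    then have "G w = G w'" using \<sigma>\<tau> by metis
    then show "w = w'" using inj_onD[OF holo_param_inj[OF P]] w by blast
  qed
  have c\<tau>: "continuous_map (atlas_topology B) (atlas_topology C) \<tau>"
    using \<tau>(2) unfolding holo_map_def by blast
  show cont: "continuous_map (top_of_set \<Omega>) (atlas_topology C) (\<lambda>w. \<tau> (G w))"
    using continuous_map_compose[OF holo_param_cont[OF P] c\<tau>] by (simp add: comp_def)
  fix U \<phi> w assume U: "(U, \<phi>) \<in> C" and w: "w \<in> \<Omega>" "\<tau> (G w) \<in> U"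
  obtain V \<psi> where V: "(V, \<psi>) \<in> B" "G w \<in> V" using car[OF w(1)] by (rule carrier_ofE)
  obtain J where J: "((\<lambda>w. \<psi> (G w)) has_derivative (*v) J) (at w)" "invertible J"
    using holo_paramD[OF P V(1) w(1) V(2)] by blast
  have "holo_on (\<phi> \<circ> \<tau> \<circ> inv_into V \<psi>) (\<psi> ` {p \<in> V. \<tau> p \<in> U})"
    using \<tau>(2) U V(1) unfolding holo_map_def by blast
  then have h1: "holo_at (\<phi> \<circ> \<tau> \<circ> inv_into V \<psi>) (\<psi> (G w))"
    using V(2) w(2) unfolding holo_on_iff by blast
  have "holo_on (\<psi> \<circ> ?\<sigma> \<circ> inv_into U \<phi>) (\<phi> ` {p \<in> U. ?\<sigma> p \<in> V})"
    using \<tau>(3) U V(1) unfolding holo_map_def by blast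
  moreover have "\<phi> (\<tau> (G w)) \<in> \<phi> ` {p \<in> U. ?\<sigma> p \<in> V}"
    using w V(2) \<sigma>\<tau>[OF w(1)] by simp
  ultimately have h2: "holo_at (\<psi> \<circ> ?\<sigma> \<circ> inv_into U \<phi>) (\<phi> (\<tau> (G w)))"
    unfolding holo_on_iff by blast
  define N where "N = {w \<in> \<Omega>. G w \<in> V} \<inter> {w \<in> \<Omega>. \<tau> (G w) \<in> U}"
  have N: "open N" unfolding N_def
    using openin_param_preimage[OF holo_param_cont[OF P] holo_param_open[OF P] openin_chart_domain[OF V(1)]]
      openin_param_preimage[OF cont holo_param_open[OF P] openin_chart_domain[OF U]] by blast
  have wN: "w \<in> N" using w V(2) unfolding N_def by blast
  have hG: "holo_at (\<lambda>w. \<psi> (G w)) w" using J(1) by blast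
  have e1: "(\<phi> \<circ> \<tau> \<circ> inv_into V \<psi>) (\<psi> (G y)) = \<phi> (\<tau> (G y))" if "y \<in> N" for y
    using that injB[OF V(1)] unfolding N_def by (simp add: inv_into_f_f)
  have e2: "(\<psi> \<circ> ?\<sigma> \<circ> inv_into U \<phi>) (\<phi> (\<tau> (G y))) = \<psi> (G y)" if "y \<in> N" for y
    using that injC[OF U] \<sigma>\<tau> unfolding N_def by (simp add: inv_into_f_f)
  have h: "holo_at (\<lambda>w. \<phi> (\<tau> (G w))) w"
    by (rule holo_at_cong[OF holo_at_compose[OF h1 hG] N wN e1])
  have "cjacobian (\<lambda>w. \<psi> (G w)) w = cjacobian (\<lambda>w. (\<psi> \<circ> ?\<sigma> \<circ> inv_into U \<phi>) (\<phi> (\<tau> (G w)))) w"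
    by (rule cjacobian_cong[OF holo_at_compose[OF h2 h] N wN e2])
  then have eq: "J = cjacobian (\<psi> \<circ> ?\<sigma> \<circ> inv_into U \<phi>) (\<phi> (\<tau> (G w))) ** cjacobian (\<lambda>w. \<phi> (\<tau> (G w))) w"
    unfolding cjacobian_eq[OF J(1)] cjacobian_compose[OF h h2] .
  obtain J' where J': "J' ** J = mat 1" using J(2) unfolding invertible_def by blast
  have "invertible (cjacobian (\<lambda>w. \<phi> (\<tau> (G w))) w)"
  proof (rule invertible_injI, rule injI)
    fix h h' assume "cjacobian (\<lambda>w. \<phi> (\<tau> (G w))) w *v h = cjacobian (\<lambda>w. \<phi> (\<tau> (G w))) w *v h'"
    then have "J *v h = J *v h'" unfolding eq by (simp flip: matrix_vector_mul_assoc)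
    then show "h = h'" using J' by (metis matrix_vector_mul_assoc matrix_vector_mul_lid)
  qed
  then show "\<exists>J. ((\<lambda>w. \<phi> (\<tau> (G w))) has_derivative (*v) J) (at w) \<and> invertible J"
    using cjacobian_has_derivative[OF h] by blast
qed

lemma cdiff_lform [intro]: "cdiff f x \<Longrightarrow> cdiff g x \<Longrightarrow> cdiff (\<lambda>x. lform l (f x) (g x)) x"
  unfolding lform_def by (intro cdiff_add cdiff_mult cdiff_const)

lemma cdiff_qform [intro]: "cdiff f x \<Longrightarrow> cdiff g x \<Longrightarrow> cdiff (\<lambda>x. qform Q (f x) (g x)) x"
  unfolding qform_def by (cases Q) (simp, intro cdiff_add cdiff_mult cdiff_const cdiff_power)

text \<open>Here \<open>\<kappa>\<close> and \<open>\<tau>\<close> are the witnesses contained in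
  \<open>small_resolution\<close>, and \<open>v0\<close> is any nonzero number; the curve that fixes
  its value enters only later.\<close>

locale resolved = resolution_data +
  fixes A :: "('z, 3) atlas" and \<mu> :: "'z \<Rightarrow> o2" and lam0 :: real
    and \<kappa> :: "'z \<Rightarrow> ((o2 \<times> cp1) \<times> cp1) \<times> cp1" and \<tau> :: "'z \<Rightarrow> 'z" and v0 :: complex
  fixes W3 W2 A3 A2
  defines "W3 \<equiv> {p \<in> carrier_of A. \<mu> p \<in> range (o2_param 3)}"
    and "W2 \<equiv> {p \<in> carrier_of A. \<mu> p \<in> range (o2_param 2)}"
    and "A3 \<equiv> restrict_atlas A W3" and "A2 \<equiv> restrict_atlas A W2"
  assumes cm: "complex_manifold A" and h\<mu>: "holo_map A O2 \<mu>"
    and emb: "holo_embedding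
           (restrict_atlas A {p \<in> carrier_of A. \<mu> p \<in> - {p_infty, p_infty_bar, p_zero lam0}}) O2 \<mu>"
    and \<kappa>: "holo_embedding A3 (prod_atlas (prod_atlas (prod_atlas O2 CP1) CP1) CP1) \<kappa>"
      "\<kappa> ` carrier_of A3 = resolution_model a b Q l1 l2 l3"
      "\<And>p. p \<in> carrier_of A3 \<Longrightarrow> fst (fst (fst (\<kappa> p))) = \<mu> p"
    and \<tau>: "biholomorphic (conj_atlas A3) A2 \<tau>"
      "\<And>p. p \<in> carrier_of A3 \<Longrightarrow> \<mu> (\<tau> p) = real_structure (\<mu> p)"
    and v0: "v0 \<noteq> 0"
begin

abbreviation "PA \<equiv> prod_atlas (prod_atlas (prod_atlas O2 CP1) CP1) CP1"

lemma PA_topology: "atlas_topology PA = T3"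
  by (simp add: prod_atlas_topology)

lemma holo_atlas_A: "holo_atlas A" and Haus: "Hausdorff_space (atlas_topology A)"
  using cm unfolding complex_manifold_def by blast+

lemma carrier_A3: "carrier_of A3 = W3"
  unfolding A3_def carrier_restrict_atlas W3_def by blast

lemma W_open: "openin (atlas_topology A) W3" "openin (atlas_topology A) W2"
proof -
  have c: "continuous_map (atlas_topology A) T0 \<mu>" using h\<mu> unfolding holo_map_def by blast
  show "openin (atlas_topology A) W3" "openin (atlas_topology A) W2"
    unfolding W3_def W2_def
    using openin_continuous_map_preimage[OF c openin_chart_domain[OF O2_chart]] by (simp_all add: topspace_atlas)
qed

text \<open>The chart \<open>G3\<close> has the coordinates \<open>(x\<^sub>1, v - v0, x\<^sub>0 - lam x\<^sub>1)\<close>, so that \<open>L\<close> is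
  \<open>w\<^sub>2 = w\<^sub>3 = 0\<close>.\<close>

definition \<Omega>3 :: "(complex ^ 3) set" where "\<Omega>3 = {w. v0 + w $ 2 \<noteq> 0}"

definition cx0 :: "complex ^ 3 \<Rightarrow> complex" where "cx0 w = w $ 3 + of_real lam * w $ 1"

definition G3 :: "complex ^ 3 \<Rightarrow> 'z" where
  "G3 w = inv_into (carrier_of A3) \<kappa> (model3 (cx0 w) (w $ 1) (v0 + w $ 2))"

lemma open_\<Omega>3: "open \<Omega>3"
  unfolding \<Omega>3_def by (intro open_Collect_neq continuous_intros)

lemma G3_props:
  assumes "w \<in> \<Omega>3"
  shows "G3 w \<in> W3" "\<kappa> (G3 w) = model3 (cx0 w) (w $ 1) (v0 + w $ 2)" "\<mu> (G3 w) = ptF (cx0 w) (w $ 1) (v0 + w $ 2)"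
proof -
  have "model3 (cx0 w) (w $ 1) (v0 + w $ 2) \<in> \<kappa> ` carrier_of A3"
    unfolding \<kappa>(2) resolution_model_alt by (rule model3_mem) (use assms in \<open>simp add: \<Omega>3_def\<close>)
  then have c: "G3 w \<in> carrier_of A3" and k: "\<kappa> (G3 w) = model3 (cx0 w) (w $ 1) (v0 + w $ 2)"
    unfolding G3_def by (simp_all add: inv_into_into f_inv_into_f)
  show "G3 w \<in> W3" using c carrier_A3 by simp
  show "\<kappa> (G3 w) = model3 (cx0 w) (w $ 1) (v0 + w $ 2)" by (rule k)
  show "\<mu> (G3 w) = ptF (cx0 w) (w $ 1) (v0 + w $ 2)"
    using \<kappa>(3)[OF c] unfolding k model3_def model2_def model1_def by simp
qed

lemma inj_G3: "inj_on G3 \<Omega>3"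
proof (rule inj_onI)
  fix w w' assume w: "w \<in> \<Omega>3" "w' \<in> \<Omega>3" "G3 w = G3 w'"
  then have m: "model3 (cx0 w) (w $ 1) (v0 + w $ 2) = model3 (cx0 w') (w' $ 1) (v0 + w' $ 2)"
    using G3_props(2) by metis
  then have v: "cp1_pt (v0 + w $ 2) 1 = cp1_pt (v0 + w' $ 2) 1"
    and p: "ptF (cx0 w) (w $ 1) (v0 + w $ 2) = ptF (cx0 w') (w' $ 1) (v0 + w' $ 2)"
    unfolding model3_def model2_def model1_def by auto
  have "w $ 2 = w' $ 2" using v by (simp add: cp1_pt_eq_iff)
  moreover have "hom4 (cx0 w) (w $ 1) (x2F (cx0 w) (w $ 1) (v0 + w $ 2)) (zF (cx0 w) (w $ 1) (v0 + w $ 2)) =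
      hom4 (cx0 w') (w' $ 1) (x2F (cx0 w') (w' $ 1) (v0 + w' $ 2)) (zF (cx0 w') (w' $ 1) (v0 + w' $ 2))"
    using p inv_ptF by metis
  then have "cx0 w = cx0 w'" "w $ 1 = w' $ 1" by (metis hom4_nth(1), metis hom4_nth(2))
  ultimately show "w = w'" by (simp add: vec_eq_iff forall_3 cx0_def)
qed

lemma \<kappa>_cont: "continuous_map (subtopology (atlas_topology A) W3) T3 \<kappa>"
proof -
  have "continuous_map (atlas_topology A3) (atlas_topology PA) \<kappa>"
    using \<kappa>(1) unfolding holo_embedding_def holo_map_def by blast
  then show ?thesis unfolding PA_topology unfolding A3_def restrict_atlas_topology .
qed

text \<open>An embedding has a continuous inverse on its image, and \<open>G3\<close> is this
  inverse composed with the continuous map \<open>model3\<close>.\<close>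

lemma cont_G3: "continuous_map (top_of_set \<Omega>3) (subtopology (atlas_topology A) W3) G3"
proof -
  have "embedding_map (atlas_topology A3) T3 \<kappa>"
    using \<kappa>(1) unfolding holo_embedding_def PA_topology by blast
  then obtain g where g: "homeomorphic_maps (atlas_topology A3) (subtopology T3 (\<kappa> ` topspace (atlas_topology A3))) \<kappa> g"
    unfolding embedding_map_def homeomorphic_map_maps by blast
  have cg: "continuous_map (subtopology T3 (\<kappa> ` W3)) (atlas_topology A3) g"
    and gk: "\<And>p. p \<in> W3 \<Longrightarrow> g (\<kappa> p) = p"
    using g unfolding homeomorphic_maps_def topspace_atlas carrier_A3 by blast+
  have ceu: "continuous_map (top_of_set \<Omega>3) euclidean (\<lambda>w. w $ i)" for i
    by (simp add: continuous_intros)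
  have c0: "continuous_map (top_of_set \<Omega>3) euclidean cx0" "continuous_map (top_of_set \<Omega>3) euclidean (\<lambda>w. v0 + w $ 2)"
    unfolding cx0_def by (simp_all add: continuous_intros)
  have "continuous_map (top_of_set \<Omega>3) T3 (\<lambda>w. model3 (cx0 w) (w $ 1) (v0 + w $ 2))"
    by (rule continuous_map_model(3)[OF c0(1) ceu c0(2)]) (simp add: \<Omega>3_def)
  moreover have "model3 (cx0 w) (w $ 1) (v0 + w $ 2) \<in> \<kappa> ` W3" if "w \<in> \<Omega>3" for w
    using G3_props[OF that] by (metis imageI)
  ultimately have "continuous_map (top_of_set \<Omega>3) (subtopology T3 (\<kappa> ` W3)) (\<lambda>w. model3 (cx0 w) (w $ 1) (v0 + w $ 2))"
    by (auto simp: continuous_map_in_subtopology)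
  from continuous_map_compose[OF this cg]
  have "continuous_map (top_of_set \<Omega>3) (subtopology (atlas_topology A) W3) (g \<circ> (\<lambda>w. model3 (cx0 w) (w $ 1) (v0 + w $ 2)))"
    unfolding A3_def restrict_atlas_topology .
  then show ?thesis
  proof (rule continuous_map_eq)
    fix w assume "w \<in> topspace (top_of_set \<Omega>3)"
    then have w: "w \<in> \<Omega>3" by simp
    show "(g \<circ> (\<lambda>w. model3 (cx0 w) (w $ 1) (v0 + w $ 2))) w = G3 w"
      using gk[OF G3_props(1)[OF w]] unfolding G3_props(2)[OF w] by simp
  qed
qed

lemma cdiff_coords:
  assumes "w \<in> \<Omega>3"
  shows "cdiff cx0 w" "cdiff (\<lambda>w. v0 + w $ 2) w"
    "cdiff (\<lambda>w. xiF (cx0 w) (w $ 1) (v0 + w $ 2)) w" "cdiff (\<lambda>w. etaF (cx0 w) (w $ 1) (v0 + w $ 2)) w"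
    "cdiff (\<lambda>w. x2F (cx0 w) (w $ 1) (v0 + w $ 2)) w" "cdiff (\<lambda>w. zF (cx0 w) (w $ 1) (v0 + w $ 2)) w"
proof -
  show 0: "cdiff cx0 w" unfolding cx0_def by (intro cdiff_add cdiff_mult cdiff_const cdiff_nth)
  show 1: "cdiff (\<lambda>w. v0 + w $ 2) w" by (intro cdiff_add cdiff_const cdiff_nth)
  show 2: "cdiff (\<lambda>w. xiF (cx0 w) (w $ 1) (v0 + w $ 2)) w"
    unfolding xiF_def by (intro cdiff_mult cdiff_lform 0 1 cdiff_nth)
  show 3: "cdiff (\<lambda>w. etaF (cx0 w) (w $ 1) (v0 + w $ 2)) w"
    unfolding etaF_def by (intro cdiff_divide cdiff_mult cdiff_lform 0 1 cdiff_nth) (use assms in \<open>simp add: \<Omega>3_def\<close>)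
  show "cdiff (\<lambda>w. x2F (cx0 w) (w $ 1) (v0 + w $ 2)) w"
    unfolding x2F_def by (intro cdiff_divide cdiff_diff cdiff_qform 0 2 3 cdiff_nth cdiff_const) simp
  show "cdiff (\<lambda>w. zF (cx0 w) (w $ 1) (v0 + w $ 2)) w"
    unfolding zF_def by (intro cdiff_divide cdiff_add 2 3 cdiff_const) simp
qed

end

context resolved
begin

text \<open>In product charts \<open>\<kappa>\<close> is a function of the three coordinates \<open>F\<close>.  As \<open>\<kappa>\<close> is an immersion,
  \<open>F\<close> has invertible derivative, and \<open>G3\<close> is its inverse.\<close>

lemma holo_param_G3: "holo_param A \<Omega>3 G3"
proof (rule holo_paramI[OF open_\<Omega>3 inj_G3 continuous_map_into_fulltopology[OF cont_G3]])
  fix U \<phi> w assume U: "(U, \<phi>) \<in> A" and w: "w \<in> \<Omega>3" "G3 w \<in> U"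
  note inj\<phi> = holo_atlas_inj[OF holo_atlas_A U]
  define L3 where "L3 = (\<lambda>w::complex ^ 3. lform l3 (cx0 w) (w $ 1))"
  have cL3: "cdiff L3 w" unfolding L3_def by (intro cdiff_lform cdiff_coords(1)[OF w(1)] cdiff_nth)
  \<comment> \<open>The last factor is read in the chart with coordinate \<open>l3 / v\<close> if
    \<open>l3\<close> vanishes at the point, and in the one with coordinate \<open>v / l3\<close>
    otherwise.\<close>
  obtain psi kf where psi: "(range psi, inv psi) \<in> CP1" "cp1_pt (v0 + w $ 2) (L3 w) \<in> range psi"
    and kf: "cdiff kf w" "\<And>y. y \<in> \<Omega>3 \<Longrightarrow> cp1_pt (v0 + y $ 2) (L3 y) \<in> range psi \<Longrightarrow>
        inv psi (cp1_pt (v0 + y $ 2) (L3 y)) = (vec (kf y) :: complex ^ 1)"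
  proof (cases "L3 w = 0")
    case True
    have "v0 + w $ 2 \<noteq> 0" using w(1) by (simp add: \<Omega>3_def)
    then show ?thesis
      by (intro that[of psi2 "\<lambda>y. L3 y / (v0 + y $ 2)"] cdiff_divide cL3 cdiff_coords(2)[OF w(1)])
        (auto simp: CP1_alt range_psi2 inv_psi2 \<Omega>3_def)
  next
    case False
    have r: "cp1_pt (v0 + y $ 2) (L3 y) \<in> range psi1 \<longleftrightarrow> L3 y \<noteq> 0" if "y \<in> \<Omega>3" for y
      by (rule range_psi1) (use that in \<open>simp add: \<Omega>3_def\<close>)
    show ?thesis
      by (rule that[of psi1 "\<lambda>y. (v0 + y $ 2) / L3 y"])
        (use False w(1) r in \<open>simp_all add: CP1_alt inv_psi1 cdiff_divide cL3 cdiff_coords(2)[OF w(1)]\<close>)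
  qed
  define N where "N = ((range (o2_param 3) \<times> range psi1) \<times> range psi1) \<times> range psi"
  define ch :: "((o2 \<times> cp1) \<times> cp1) \<times> cp1 \<Rightarrow> complex ^ (((4 + 1) + 1) + 1)"
    where "ch = (\<lambda>(p, q). vjoin ((\<lambda>(p, q). vjoin ((\<lambda>(p, q). vjoin (inv (o2_param 3) p) (inv psi1 q)) p) (inv psi1 q)) p) (inv psi q))"
  have p1: "(range psi1, inv psi1) \<in> CP1" by (simp add: CP1_alt)
  have chart: "(N, ch) \<in> PA"
    unfolding N_def ch_def by (rule prod_atlasI[OF prod_atlasI[OF prod_atlasI[OF O2_chart p1] p1] psi(1)])
  define Pexp where "Pexp = (\<lambda>y. vjoin (vjoin (vjoin (hom4 (cx0 y) (y $ 1) (x2F (cx0 y) (y $ 1) (v0 + y $ 2)) (zF (cx0 y) (y $ 1) (v0 + y $ 2)))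
      (vec ((v0 + y $ 2) * lform l2 (cx0 y) (y $ 1)) :: complex ^ 1)) (vec (v0 + y $ 2) :: complex ^ 1)) (vec (kf y) :: complex ^ 1))"
  have chP: "ch (model3 (cx0 y) (y $ 1) (v0 + y $ 2)) = Pexp y"
    if "y \<in> \<Omega>3" "cp1_pt (v0 + y $ 2) (L3 y) \<in> range psi" for y
    unfolding ch_def Pexp_def model3_def model2_def model1_def
    using kf(2)[OF that] by (simp add: inv_ptF inv_psi1 L3_def)
  \<comment> \<open>A left inverse of \<open>Pexp\<close>: the entries \<open>x0\<close>,
    \<open>x1\<close> and \<open>v\<close> of the product chart suffice to recover the three
    coordinates.\<close>
  define afun :: "complex ^ (((4 + 1) + 1) + 1) \<Rightarrow> complex ^ 3" where
    "afun = (\<lambda>k. \<chi> i. if i = 1 then k $ Inl (Inl (Inl 1)) else if i = 2 then k $ Inl (Inr 1) - v0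
      else k $ Inl (Inl (Inl 0)) - of_real lam * k $ Inl (Inl (Inl 1)))"
  have afun_nth: "afun k $ 1 = k $ Inl (Inl (Inl 1))" "afun k $ 2 = k $ Inl (Inr 1) - v0"
    "afun k $ 3 = k $ Inl (Inl (Inl 0)) - of_real lam * k $ Inl (Inl (Inl 1))" for k
    unfolding afun_def by simp_all
  have afunP: "afun (Pexp y) = y" for y
    by (simp add: vec_eq_iff forall_3 afun_nth Pexp_def cx0_def)
  have afun_holo: "holo_at afun k" for k
    unfolding holo_at_iff forall_3 afun_nth by (intro conjI cdiff_diff cdiff_mult cdiff_nth cdiff_const)
  have hPexp: "holo_at Pexp w"
    unfolding Pexp_def
  proof (intro holo_at_vjoin holo_at_vec kf(1) cdiff_mult cdiff_lform cdiff_coords(1,2)[OF w(1)] cdiff_nth)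
    have "\<forall>j. cdiff (\<lambda>y. hom4 (cx0 y) (y $ 1) (x2F (cx0 y) (y $ 1) (v0 + y $ 2)) (zF (cx0 y) (y $ 1) (v0 + y $ 2)) $ j) w"
      unfolding all4 hom4_nth using cdiff_coords[OF w(1)] by simp
    then show "holo_at (\<lambda>y. hom4 (cx0 y) (y $ 1) (x2F (cx0 y) (y $ 1) (v0 + y $ 2)) (zF (cx0 y) (y $ 1) (v0 + y $ 2))) w"
      by (intro holo_atI) blast
  qed
  \<comment> \<open>Restricting to nonzero \<open>v\<close> makes \<open>X3_eq_model3\<close>
    applicable, so every point of the neighbourhood \<open>D\<close> lies in the image of
    \<open>G3\<close>.\<close>
  define Nv where "Nv = {v \<in> range psi1. inv psi1 v \<in> {x. x $ 1 \<noteq> 0}}"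
  define N' where "N' = ((range (o2_param 3) \<times> range psi1) \<times> Nv) \<times> range psi"
  have NvO: "openin (atlas_topology CP1) Nv"
    unfolding Nv_def by (rule openin_chart_preimage[OF p1]) (auto intro!: open_Collect_neq continuous_intros)
  have N'O: "openin T3 N'"
    unfolding N'_def openin_prod_Times_iff[of T2] openin_prod_Times_iff[of T1] openin_prod_Times_iff
    using openin_R3 NvO openin_range_psi(1) openin_chart_domain[OF psi(1)] by blast
  have N'N: "N' \<subseteq> N" unfolding N'_def N_def Nv_def by blast
  define D where "D = U \<inter> {p \<in> W3. \<kappa> p \<in> N'}"
  have topW3: "topspace (subtopology (atlas_topology A) W3) = W3"
    unfolding topspace_subtopology topspace_atlas W3_def by blast
  have D: "openin (atlas_topology A) D"
  proof -
    have "openin (subtopology (atlas_topology A) W3) {p \<in> W3. \<kappa> p \<in> N'}"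
      using openin_continuous_map_preimage[OF \<kappa>_cont N'O] unfolding topW3 .
    then have "openin (atlas_topology A) {p \<in> W3. \<kappa> p \<in> N'}"
      using W_open(1) by (rule openin_trans_full)
    then show ?thesis unfolding D_def by (intro openin_Int openin_chart_domain[OF U])
  qed
  have inD: "G3 y \<in> D \<longleftrightarrow> G3 y \<in> U \<and> cp1_pt (v0 + y $ 2) (L3 y) \<in> range psi" if y: "y \<in> \<Omega>3" for y
  proof -
    have a: "ptF (cx0 y) (y $ 1) (v0 + y $ 2) \<in> range (o2_param 3)" using G3_props[OF y] unfolding W3_def by simp
    have b: "cp1_pt ((v0 + y $ 2) * lform l2 (cx0 y) (y $ 1)) 1 \<in> range psi1" by (subst range_psi1) simp_all
    have c: "cp1_pt (v0 + y $ 2) 1 \<in> Nv" using y unfolding Nv_def \<Omega>3_def by (simp add: range_psi1 inv_psi1)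
    have "\<kappa> (G3 y) \<in> N' \<longleftrightarrow> cp1_pt (v0 + y $ 2) (L3 y) \<in> range psi"
      unfolding G3_props(2)[OF y] model3_def model2_def model1_def N'_def mem_Times_iff fst_conv snd_conv L3_def
      using a b c by blast
    then show ?thesis using G3_props(1)[OF y] unfolding D_def by blast
  qed
  have Dback: "afun (ch (\<kappa> p)) \<in> \<Omega>3 \<and> G3 (afun (ch (\<kappa> p))) = p" if p: "p \<in> D" for p
  proof -
    obtain P u v x where k: "\<kappa> p = (((P, u), v), x)" by (metis prod.exhaust)
    have pc: "p \<in> carrier_of A3" "\<kappa> p \<in> N'" using p unfolding D_def carrier_A3 by blast+
    have "(((P, u), v), x) \<in> X3"
      using \<kappa>(2) pc(1) unfolding resolution_model_alt k[symmetric] by blast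
    moreover have v: "v \<in> range psi1" "aff v \<noteq> 0"
      using pc(2) unfolding k N'_def Nv_def aff_def by auto
    ultimately have m: "(((P, u), v), x) = model3 (inv (o2_param 3) P $ 0) (inv (o2_param 3) P $ 1) (aff v)"
      by (rule X3_eq_model3)
    define y where "y = afun (ch (\<kappa> p))"
    have ch: "ch (\<kappa> p) = vjoin (vjoin (vjoin (inv (o2_param 3) P) (inv psi1 u)) (inv psi1 v)) (inv psi x)"
      unfolding k ch_def by simp
    have y: "cx0 y = inv (o2_param 3) P $ 0" "y $ 1 = inv (o2_param 3) P $ 1" "v0 + y $ 2 = aff v"
      unfolding y_def cx0_def ch afun_nth by (simp_all add: aff_def)
    have "y \<in> \<Omega>3" unfolding \<Omega>3_def using y(3) v(2) by simp
    moreover have "G3 y = p"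
      unfolding G3_def y m[symmetric] k[symmetric]
    proof (rule inv_into_f_f[OF _ pc(1)])
      have "embedding_map (atlas_topology A3) (atlas_topology PA) \<kappa>"
        using \<kappa>(1) unfolding holo_embedding_def by blast
      then show "inj_on \<kappa> (carrier_of A3)"
        unfolding embedding_map_def homeomorphic_map_def topspace_atlas by blast
    qed
    ultimately show ?thesis unfolding y_def by blast
  qed
  have GD: "G3 w \<in> D" using inD[OF w(1)] w(2) psi(2) by blast
  define K where "K = ch \<circ> \<kappa> \<circ> inv_into (U \<inter> W3) \<phi>"
  have KG: "K (\<phi> p) = ch (\<kappa> p)" if "p \<in> D" for p
  proof -
    have "inv_into (U \<inter> W3) \<phi> (\<phi> p) = p"
      using that inj\<phi> unfolding D_def by (intro inv_into_f_f) (auto simp: inj_on_def)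
    then show ?thesis unfolding K_def by simp
  qed
  have A3c: "(U \<inter> W3, \<phi>) \<in> A3" unfolding A3_def by (rule restrict_atlasI[OF U])
  have GN: "G3 w \<in> U \<inter> W3" "\<kappa> (G3 w) \<in> N" using GD N'N unfolding D_def by blast+
  have "holo_on K (\<phi> ` {p \<in> U \<inter> W3. \<kappa> p \<in> N})"
    using \<kappa>(1) A3c chart unfolding holo_embedding_def holo_map_def K_def by blast
  then have hK: "holo_at K (\<phi> (G3 w))" using GN unfolding holo_on_iff by blast
  have injK: "inj ((*v) (cjacobian K (\<phi> (G3 w))))"
    using \<kappa>(1) A3c chart GN unfolding holo_embedding_def K_def by blast
  define F where "F = (\<lambda>x. afun (K x))"
  have hF: "holo_at F (\<phi> (G3 w))" unfolding F_def by (rule holo_at_compose[OF afun_holo hK])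
  have FG: "F (\<phi> (G3 y)) = y" if "y \<in> \<Omega>3" "G3 y \<in> D" for y
    unfolding F_def KG[OF that(2)] using Dback[OF that(2)] inj_onD[OF inj_G3 _ _ that(1)] by blast
  have Fw: "F (\<phi> (G3 w)) = w" by (rule FG[OF w(1) GD])
  have Dop: "open (\<phi> ` (U \<inter> D))" using D U unfolding openin_atlas_iff[OF holo_atlas_A] by blast
  \<comment> \<open>As \<open>K = Pexp \<circ> F\<close> near the point, injectivity of the
    derivative of \<open>K\<close> forces that of \<open>F\<close>, and the derivative of
    \<open>F\<close> is square.\<close>
  have KF: "Pexp (F x) = K x" if x: "x \<in> \<phi> ` (U \<inter> D)" for x
  proof -
    obtain p where p: "p \<in> D" "x = \<phi> p" using x by blast
    define y where "y = afun (ch (\<kappa> p))"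
    have y: "y \<in> \<Omega>3" "G3 y = p" using Dback[OF p(1)] unfolding y_def by blast+
    have "K x = ch (\<kappa> (G3 y))" unfolding p(2) KG[OF p(1)] y(2) ..
    also have "\<dots> = Pexp y"
      unfolding G3_props(2)[OF y(1)] by (rule chP[OF y(1)]) (use inD[OF y(1)] p(1) y(2) in blast)
    finally show ?thesis unfolding F_def p(2) KG[OF p(1)] y_def by simp
  qed
  have hP': "holo_at Pexp (F (\<phi> (G3 w)))" unfolding Fw by (rule hPexp)
  have "cjacobian K (\<phi> (G3 w)) = cjacobian (\<lambda>x. Pexp (F x)) (\<phi> (G3 w))"
    by (rule cjacobian_cong[OF holo_at_compose[OF hP' hF] Dop _ KF]) (use GD GN in blast)
  then have KJ: "cjacobian K (\<phi> (G3 w)) = cjacobian Pexp w ** cjacobian F (\<phi> (G3 w))"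
    using cjacobian_compose[OF hF hP'] unfolding Fw by simp
  have "invertible (cjacobian F (\<phi> (G3 w)))"
  proof (rule invertible_injI, rule injI)
    fix h h' assume "cjacobian F (\<phi> (G3 w)) *v h = cjacobian F (\<phi> (G3 w)) *v h'"
    then have "cjacobian K (\<phi> (G3 w)) *v h = cjacobian K (\<phi> (G3 w)) *v h'"
      unfolding KJ by (simp flip: matrix_vector_mul_assoc)
    then show "h = h'" by (rule injD[OF injK])
  qed
  then obtain J' where J': "J' ** cjacobian F (\<phi> (G3 w)) = mat 1" "cjacobian F (\<phi> (G3 w)) ** J' = mat 1"
    unfolding invertible_def by blast
  have "((\<lambda>w. \<phi> (G3 w)) has_derivative (*v) J') (at w)"
  proof (rule has_derivative_inverse_basic)
    show "(F has_derivative (*v) (cjacobian F (\<phi> (G3 w)))) (at (\<phi> (G3 w)))"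
      by (rule cjacobian_has_derivative[OF hF])
    show "(*v) J' \<circ> (*v) (cjacobian F (\<phi> (G3 w))) = id"
      using J'(1) by (simp add: fun_eq_iff matrix_vector_mul_assoc)
    show "continuous (at w) (\<lambda>w. \<phi> (G3 w))"
      by (rule param_continuous_at[OF continuous_map_into_fulltopology[OF cont_G3] open_\<Omega>3 U w])
    show "open {y \<in> \<Omega>3. G3 y \<in> D}"
      by (rule openin_param_preimage[OF continuous_map_into_fulltopology[OF cont_G3] open_\<Omega>3 D])
    show "w \<in> {y \<in> \<Omega>3. G3 y \<in> D}" using w GD by blast
    show "F (\<phi> (G3 z)) = z" if "z \<in> {y \<in> \<Omega>3. G3 y \<in> D}" for z using FG that by blast
  qed (rule bounded_linear_matrix_vector)
  moreover have "invertible J'" using J' unfolding invertible_def by blast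
  ultimately show "\<exists>J. ((\<lambda>w. \<phi> (G3 w)) has_derivative (*v) J) (at w) \<and> invertible J" by blast
qed

definition \<Omega>2 :: "(complex ^ 3) set" where "\<Omega>2 = {w. cnj v0 + w $ 2 \<noteq> 0}"

text \<open>Conjugating the coordinates compensates for \<open>\<tau>\<close>, which is holomorphic
  only for the conjugate atlas; the composite is therefore holomorphic.\<close>

definition G2 :: "complex ^ 3 \<Rightarrow> 'z" where "G2 w = \<tau> (G3 (vconj w))"

lemma \<Omega>2_vconj: "vconj ` \<Omega>3 = \<Omega>2"
proof -
  have "v0 + cnj x = 0 \<longleftrightarrow> cnj v0 + x = 0" for x
    by (metis complex_cnj_add complex_cnj_cnj complex_cnj_zero)
  then show ?thesis unfolding \<Omega>2_def set_eq_iff mem_vconj_image by (simp add: \<Omega>3_def)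
qed

text \<open>\<open>G3\<close> is restricted to the part over \<open>y3\<close> nonzero, conjugated,
  carried over by \<open>\<tau>\<close>, and the result regarded in the full atlas.\<close>

lemma holo_param_G2: "holo_param A \<Omega>2 G2"
proof -
  have 1: "holo_param A3 \<Omega>3 G3"
    unfolding A3_def by (rule holo_param_restrict[OF holo_param_G3 G3_props(1)])
  have injA: "inj_on \<phi> U" if "(U, \<phi>) \<in> restrict_atlas A W" for U \<phi> W
  proof -
    obtain U' where "U = U' \<inter> W" "(U', \<phi>) \<in> A" using \<open>(U, \<phi>) \<in> restrict_atlas A W\<close> unfolding restrict_atlas_def by blast
    then show ?thesis using holo_atlas_inj[OF holo_atlas_A, of U' \<phi>] by (auto simp: inj_on_def)
  qed
  have injC: "inj_on \<psi> V" if V: "(V, \<psi>) \<in> conj_atlas A3" for V \<psi>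
  proof -
    obtain \<phi> where "\<psi> = vconj \<circ> \<phi>" "(V, \<phi>) \<in> A3" using V unfolding conj_atlas_alt by auto
    then have "inj_on \<phi> V" "\<psi> = vconj \<circ> \<phi>" using injA unfolding A3_def by blast+
    then show ?thesis unfolding inj_on_def comp_def by (metis vconj_vconj)
  qed
  have "holo_param A2 \<Omega>2 (\<lambda>w. \<tau> (G3 (vconj w)))"
    using holo_param_biholomorphic[OF holo_param_conj[OF 1] \<tau>(1) injC] injA unfolding \<Omega>2_vconj A2_def by blast
  then show ?thesis
    unfolding A2_def G2_def[abs_def] by (rule holo_param_unrestrict)
qed

lemma \<mu>_G2:
  assumes "w \<in> \<Omega>2"
  shows "\<mu> (G2 w) = real_structure (ptF (cx0 (vconj w)) (cnj (w $ 1)) (v0 + cnj (w $ 2)))" "G2 w \<in> carrier_of A"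
proof -
  have w: "vconj w \<in> \<Omega>3" using assms unfolding \<Omega>2_vconj[symmetric] mem_vconj_image .
  show "\<mu> (G2 w) = real_structure (ptF (cx0 (vconj w)) (cnj (w $ 1)) (v0 + cnj (w $ 2)))"
    unfolding G2_def using \<tau>(2) G3_props[OF w] carrier_A3 by simp
  show "G2 w \<in> carrier_of A" by (rule holo_param_sub_carrier[OF holo_param_G2 assms])
qed

text \<open>Each of the three exceptional points has \<open>y2 = 0\<close> or \<open>y3 = 0\<close>.
  Where both coordinates are nonzero, \<open>\<mu>\<close> is therefore part of the embedding off
  the exceptional set.\<close>

lemma \<mu>_inj:
  assumes p: "p \<in> carrier_of A" "p' \<in> carrier_of A" "\<mu> p = \<mu> p'"
    and n: "\<mu> p \<in> range (o2_param 2)" "\<mu> p \<in> range (o2_param 3)"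
  shows "p = p'"
proof -
  have "p_infty \<notin> range (o2_param 2)" "p_infty_bar \<notin> range (o2_param 3)" "p_zero lam0 \<notin> range (o2_param 3)"
    unfolding p_infty_def p_infty_bar_def p_zero_def range_o2_param by simp_all
  then have "\<mu> p \<in> - {p_infty, p_infty_bar, p_zero lam0}" using n by blast
  then have q: "p \<in> carrier_of (restrict_atlas A {p \<in> carrier_of A. \<mu> p \<in> - {p_infty, p_infty_bar, p_zero lam0}})"
    "p' \<in> carrier_of (restrict_atlas A {p \<in> carrier_of A. \<mu> p \<in> - {p_infty, p_infty_bar, p_zero lam0}})"
    unfolding carrier_restrict_atlas using p by auto
  have "inj_on \<mu> (carrier_of (restrict_atlas A {p \<in> carrier_of A. \<mu> p \<in> - {p_infty, p_infty_bar, p_zero lam0}}))"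
    using emb unfolding holo_embedding_def embedding_map_def homeomorphic_map_def topspace_atlas by blast
  from inj_onD[OF this p(3) q] show ?thesis .
qed

end

section \<open>The coordinate change between the two conjugate charts along the curve\<close>

lemma real_structure_o2_pt:
  "real_structure (o2_pt y z) = o2_pt (hom4 (cnj (y $ 0)) (cnj (y $ 1)) (cnj (y $ 3)) (cnj (y $ 2))) (cnj z)"
proof -
  let ?h = "\<lambda>(y :: complex ^ 4, z). (hom4 (cnj (y $ 0)) (cnj (y $ 1)) (cnj (y $ 3)) (cnj (y $ 2)), cnj z)"
  have e: "?h (c *s y, c\<^sup>2 * z) = (cnj c *s hom4 (cnj (y $ 0)) (cnj (y $ 1)) (cnj (y $ 3)) (cnj (y $ 2)), (cnj c)\<^sup>2 * cnj z)" for c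
    by (simp add: vec_eq_iff all4)
  show ?thesis
  proof (intro equalityI subsetI)
    fix P assume "P \<in> real_structure (o2_pt y z)"
    then obtain c where "c \<noteq> 0" "P = ?h (c *s y, c\<^sup>2 * z)"
      unfolding real_structure_def o2_pt_def by blast
    then have "cnj c \<noteq> 0 \<and> P = (cnj c *s hom4 (cnj (y $ 0)) (cnj (y $ 1)) (cnj (y $ 3)) (cnj (y $ 2)), (cnj c)\<^sup>2 * cnj z)"
      unfolding e by simp
    then show "P \<in> o2_pt (hom4 (cnj (y $ 0)) (cnj (y $ 1)) (cnj (y $ 3)) (cnj (y $ 2))) (cnj z)"
      unfolding o2_pt_def by blast
  next
    fix P assume "P \<in> o2_pt (hom4 (cnj (y $ 0)) (cnj (y $ 1)) (cnj (y $ 3)) (cnj (y $ 2))) (cnj z)"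
    then obtain c where c: "c \<noteq> 0" "P = (c *s hom4 (cnj (y $ 0)) (cnj (y $ 1)) (cnj (y $ 3)) (cnj (y $ 2)), c\<^sup>2 * cnj z)"
      unfolding o2_pt_def by blast
    then have "P = ?h (cnj c *s y, (cnj c)\<^sup>2 * z)" unfolding e by simp
    moreover have "(cnj c *s y, (cnj c)\<^sup>2 * z) \<in> o2_pt y z" using c(1) unfolding o2_pt_def by force
    ultimately show "P \<in> real_structure (o2_pt y z)" unfolding real_structure_def by (rule image_eqI)
  qed
qed

lemma cnj_lform: "cnj (lform l (cnj x) (cnj y)) = lform l x (y :: complex)"
  by (simp add: lform_def)

lemma cnj_qform: "cnj (qform Q (cnj x) (cnj y)) = qform Q x (y :: complex)"
  by (cases Q) (simp add: qform_def)

lemma lform_divide: "lform l (x / c) (y / c) = lform l x y / (c :: complex)"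
  using lform_scale[of l "1 / c" x y] by simp

lemma qform_divide: "qform Q (x / c) (y / c) = qform Q x y / (c :: complex)\<^sup>2"
  using qform_scale[of Q "1 / c" x y] by (simp add: power_divide)

lemma lform_of_real: "lform l (of_real t) (1::complex) = of_real (lform l t 1)"
  by (simp add: lform_def)

lemma qform_of_real: "qform Q (of_real t) (1::complex) = of_real (qform Q t 1)"
  by (cases Q) (simp add: qform_def)

lemma cdiff_line:
  assumes "cdiff g w"
  shows "\<exists>d. ((\<lambda>t. g (w + t *s axis j 1)) has_field_derivative d) (at 0)"
proof -
  have "holo_at (\<lambda>w. vec (g w) :: complex ^ 1) w" by (rule holo_at_vec[OF assms])
  from cjacobian_entry[OF this, of j 1] show ?thesis by auto
qed

lemma cdiff_eventually_nonzero:
  assumes "cdiff g w" "g w \<noteq> 0"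
  shows "\<forall>\<^sub>F y in nhds w. g y \<noteq> 0"
proof -
  have "isCont g w" using assms(1) unfolding cdiff_def using has_derivative_continuous by blast
  then have "(g \<longlongrightarrow> g w) (nhds w)" by (simp add: isCont_def tendsto_at_iff_tendsto_nhds)
  then show ?thesis using assms(2) by (rule tendsto_imp_eventually_ne)
qed

text \<open>The number in \<open>g\<close> is the coefficient of \<open>x1^2\<close> in \<xi> along
  the curve, \<open>gg\<close> says that its squared modulus is the product of the four forms at
  \<open>lam\<close>, and \<open>D\<close> is the derivative of \<open>H = l3 l4 / (l1 l2)\<close>
  there. The sign of the curve is absorbed in \<open>r\<close>.\<close>

locale resolved_curve = resolved +
  fixes r \<alpha> :: real and D :: complex
  assumes \<alpha>0: "\<alpha> \<noteq> 0"
    and g: "v0 * lform l1 (of_real lam) 1 * lform l2 (of_real lam) 1 = of_real r + \<i> * of_real (\<alpha> + qform Q lam 1)"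
    and gg: "(v0 * lform l1 (of_real lam) 1 * lform l2 (of_real lam) 1) *
        cnj (v0 * lform l1 (of_real lam) 1 * lform l2 (of_real lam) 1) =
      lform l1 (of_real lam) 1 * lform l2 (of_real lam) 1 * lform l3 (of_real lam) 1 * lform l4 (of_real lam) 1"
    and D: "((\<lambda>t. lform l3 t 1 * lform l4 t 1 / (lform l1 t 1 * lform l2 t 1)) has_field_derivative D) (at (of_real lam))"
begin

definition "x2W w = x2F (cx0 w) (w $ 1) (v0 + w $ 2)"

text \<open>\<open>G3 = G2 \<circ> \<Phi>\<close>.  Dividing the homogeneous coordinates by \<open>x\<^sub>2\<close> turns \<open>\<xi>\<close> and \<open>\<eta>\<close> into
  \<open>\<xi> / x\<^sub>2\<^sup>2\<close> and \<open>\<eta> / x\<^sub>2\<^sup>2\<close>, and conjugation exchanges their roles; hence the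
  new \<open>v\<close> is \<open>\<eta> / (l\<^sub>1 l\<^sub>2) = l\<^sub>3 l\<^sub>4 / (v l\<^sub>1 l\<^sub>2)\<close>, which on \<open>L\<close> is the conjugate of \<open>v0\<close>.\<close>

definition \<Phi> :: "complex ^ 3 \<Rightarrow> complex ^ 3" where
  "\<Phi> w = (\<chi> i. if i = 1 then w $ 1 / x2W w
     else if i = 2 then lform l3 (cx0 w) (w $ 1) * lform l4 (cx0 w) (w $ 1) /
       ((v0 + w $ 2) * lform l1 (cx0 w) (w $ 1) * lform l2 (cx0 w) (w $ 1)) - cnj v0
     else w $ 3 / x2W w)"

lemma \<Phi>_nth: "\<Phi> w $ 1 = w $ 1 / x2W w"
  "\<Phi> w $ 2 = lform l3 (cx0 w) (w $ 1) * lform l4 (cx0 w) (w $ 1) /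
       ((v0 + w $ 2) * lform l1 (cx0 w) (w $ 1) * lform l2 (cx0 w) (w $ 1)) - cnj v0"
  "\<Phi> w $ 3 = w $ 3 / x2W w"
  by (simp_all add: \<Phi>_def)

text \<open>Both points have the same image under \<open>\<mu>\<close>, computed by dividing
  homogeneous coordinates by \<open>x2\<close>, and this image lies where \<open>\<mu>\<close> is
  injective.\<close>

lemma glue_\<Phi>:
  assumes w: "w \<in> \<Omega>3" "x2W w \<noteq> 0"
    and l: "lform l1 (cx0 w) (w $ 1) \<noteq> 0" "lform l2 (cx0 w) (w $ 1) \<noteq> 0"
      "lform l3 (cx0 w) (w $ 1) \<noteq> 0" "lform l4 (cx0 w) (w $ 1) \<noteq> 0"
  shows "\<Phi> w \<in> \<Omega>2 \<and> G3 w = G2 (\<Phi> w)"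
proof -
  define v X where "v = v0 + w $ 2" and "X = x2W w"
  define V' where "V' = lform l3 (cx0 w) (w $ 1) * lform l4 (cx0 w) (w $ 1) /
       (v * lform l1 (cx0 w) (w $ 1) * lform l2 (cx0 w) (w $ 1))"
  have v: "v \<noteq> 0" using w(1) by (simp add: \<Omega>3_def v_def)
  have X: "X \<noteq> 0" "X = x2F (cx0 w) (w $ 1) v" using w(2) by (simp_all add: X_def x2W_def v_def)
  have V': "V' \<noteq> 0" "cnj v0 + \<Phi> w $ 2 = V'" using v l by (simp_all add: V'_def \<Phi>_nth v_def)
  have mem: "\<Phi> w \<in> \<Omega>2" unfolding \<Omega>2_def using V' by simp
  have c0: "cx0 (vconj (\<Phi> w)) = cnj (cx0 w / X)"
    by (simp add: cx0_def \<Phi>_nth X_def add_divide_distrib)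
  have c1: "cnj (\<Phi> w $ 1) = cnj (w $ 1 / X)" by (simp add: \<Phi>_nth X_def)
  have cv: "v0 + cnj (\<Phi> w $ 2) = cnj V'" using arg_cong[OF V'(2), of cnj] by simp
  have xi: "cnj (xiF (cnj (cx0 w / X)) (cnj (w $ 1 / X)) (cnj V')) = etaF (cx0 w) (w $ 1) v / X\<^sup>2"
    unfolding xiF_def complex_cnj_mult cnj_lform complex_cnj_cnj lform_divide
    using X(1) l v by (simp add: V'_def etaF_def power2_eq_square)
  have eta: "cnj (etaF (cnj (cx0 w / X)) (cnj (w $ 1 / X)) (cnj V')) = xiF (cx0 w) (w $ 1) v / X\<^sup>2"
    unfolding etaF_def complex_cnj_mult complex_cnj_divide[of "_ * _"] cnj_lform complex_cnj_cnj lform_divide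
    using X(1) l v by (simp add: V'_def xiF_def power2_eq_square)
  have x2: "cnj (x2F (cnj (cx0 w / X)) (cnj (w $ 1 / X)) (cnj V')) = 1 / X"
  proof -
    have "cnj (x2F (cnj (cx0 w / X)) (cnj (w $ 1 / X)) (cnj V')) =
        (etaF (cx0 w) (w $ 1) v / X\<^sup>2 - xiF (cx0 w) (w $ 1) v / X\<^sup>2) / (- 2 * \<i>) - qform Q (cx0 w) (w $ 1) / X\<^sup>2"
      unfolding x2F_def complex_cnj_diff cnj_qform qform_divide
        complex_cnj_divide[of "xiF _ _ _ - etaF _ _ _"] xi eta by simp
    also have "\<dots> = x2F (cx0 w) (w $ 1) v / X\<^sup>2"
      unfolding x2F_def by (simp add: divide_simps) (simp add: algebra_simps)
    finally show ?thesis using X by (simp add: power2_eq_square)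
  qed
  have z: "cnj (zF (cnj (cx0 w / X)) (cnj (w $ 1 / X)) (cnj V')) = zF (cx0 w) (w $ 1) v / X\<^sup>2"
    unfolding zF_def complex_cnj_divide[of "xiF _ _ _ + etaF _ _ _"] complex_cnj_add xi eta
    by (simp add: add_divide_distrib mult.commute)
  have "\<mu> (G2 (\<Phi> w)) = o2_pt (hom4 (cx0 w / X) (w $ 1 / X) 1 (1 / X)) (zF (cx0 w) (w $ 1) v / X\<^sup>2)"
    unfolding \<mu>_G2(1)[OF mem] c0 c1 cv ptF_def real_structure_o2_pt hom4_nth x2 z by simp
  also have "\<dots> = o2_pt ((1 / X) *s hom4 (cx0 w) (w $ 1) X 1) ((1 / X)\<^sup>2 * zF (cx0 w) (w $ 1) v)"
    using X(1) by (intro arg_cong2[where f = o2_pt]) (simp_all add: vec_eq_iff all4 power_divide)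
  also have "\<dots> = \<mu> (G3 w)"
    using o2_pt_scale[of "1 / X"] X G3_props(3)[OF w(1)] by (simp add: ptF_def v_def)
  finally have eq: "\<mu> (G3 w) = \<mu> (G2 (\<Phi> w))" ..
  have "G3 w = G2 (\<Phi> w)"
  proof (rule \<mu>_inj[OF _ _ eq])
    show "G3 w \<in> carrier_of A" using G3_props(1)[OF w(1)] unfolding W3_def by blast
    show "G2 (\<Phi> w) \<in> carrier_of A" by (rule \<mu>_G2(2)[OF mem])
    show "\<mu> (G3 w) \<in> range (o2_param 2)" "\<mu> (G3 w) \<in> range (o2_param 3)"
      unfolding G3_props(3)[OF w(1)] ptF_def range_o2_param using X by (simp_all add: v_def)
  qed
  then show ?thesis using mem by blast
qed

text \<open>The factor \<open>x * 1\<close> is kept so that the homogeneity rules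
  \<open>lform_scale\<close> and \<open>qform_scale\<close> match after rewriting.\<close>

lemma axis_coords: "cx0 (axis 1 x) = x * of_real lam" "axis (1::3) x $ 1 = x * 1" "v0 + axis (1::3) x $ 2 = v0"
  by (simp_all add: cx0_def axis_nth)

lemma axis_\<Omega>: "axis 1 x \<in> \<Omega>3" "axis 1 x \<in> \<Omega>2"
  using v0 by (simp_all add: \<Omega>3_def \<Omega>2_def axis_nth)

text \<open>The value of \<xi> is \<open>g\<close>; since the product of \<xi> and \<eta> at
  \<open>x = 1\<close> is \<open>|g|^2\<close> by \<open>gg\<close>, the value of \<eta> is the
  complex conjugate of that of \<xi>.\<close>

lemma lam_line: "xiF (x * of_real lam) (x * 1) v0 = x\<^sup>2 * (of_real r + \<i> * of_real (\<alpha> + qform Q lam 1))"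
  "etaF (x * of_real lam) (x * 1) v0 = x\<^sup>2 * (of_real r - \<i> * of_real (\<alpha> + qform Q lam 1))"
proof -
  let ?p = "\<lambda>l. lform l (of_real lam) (1::complex)"
  show xi: "xiF (x * of_real lam) (x * 1) v0 = x\<^sup>2 * (of_real r + \<i> * of_real (\<alpha> + qform Q lam 1))"
    unfolding xiF_def lform_scale g[symmetric] by (simp add: power2_eq_square)
  have "cnj (v0 * ?p l1 * ?p l2) = of_real r - \<i> * of_real (\<alpha> + qform Q lam 1)"
    unfolding g by simp
  moreover have "(v0 * ?p l1 * ?p l2) * (?p l3 * ?p l4 / v0) = (v0 * ?p l1 * ?p l2) * cnj (v0 * ?p l1 * ?p l2)"
    unfolding gg using v0 by simp
  then have "?p l3 * ?p l4 / v0 = cnj (v0 * ?p l1 * ?p l2)"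
    using v0 nzl by (metis mult_cancel_left mult_eq_0_iff)
  ultimately show "etaF (x * of_real lam) (x * 1) v0 = x\<^sup>2 * (of_real r - \<i> * of_real (\<alpha> + qform Q lam 1))"
  proof -
    assume "cnj (v0 * ?p l1 * ?p l2) = of_real r - \<i> * of_real (\<alpha> + qform Q lam 1)"
      and "?p l3 * ?p l4 / v0 = cnj (v0 * ?p l1 * ?p l2)"
    then have e: "?p l3 * ?p l4 / v0 = of_real r - \<i> * of_real (\<alpha> + qform Q lam 1)" by simp
    have "x * ?p l3 * (x * ?p l4) / v0 = x\<^sup>2 * (?p l3 * ?p l4 / v0)" by (simp add: power2_eq_square)
    then show ?thesis unfolding etaF_def lform_scale e .
  qed
qed

lemma x2_line: "x2F (x * of_real lam) (x * 1) v0 = of_real \<alpha> * x\<^sup>2" "zF (x * of_real lam) (x * 1) v0 = of_real r * x\<^sup>2"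
  unfolding x2F_def zF_def lam_line qform_scale qform_of_real
  by (simp_all add: field_simps)

text \<open>The forms have real coefficients and \<open>lam\<close> is real, so \<open>gg\<close>
  divided by \<open>(l1 l2)^2\<close> gives \<open>H(lam) = |v0|^2\<close>. This is what sends the
  axis to the axis under \<open>\<Phi>\<close>.\<close>

lemma v0_cnj: "lform l3 (of_real lam) 1 * lform l4 (of_real lam) 1 / (lform l1 (of_real lam) 1 * lform l2 (of_real lam) 1) = v0 * cnj v0"
proof -
  have c: "cnj (lform l (of_real lam) 1) = lform l (of_real lam) (1::complex)" for l
    unfolding lform_of_real by simp
  have "v0 * cnj v0 * (lform l1 (of_real lam) 1 * lform l2 (of_real lam) 1) = lform l3 (of_real lam) 1 * lform l4 (of_real lam) 1"
    using gg nzl unfolding complex_cnj_mult c by (simp add: mult_ac)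
  then show ?thesis using nzl by (simp add: field_simps)
qed

lemma \<Phi>_axis: "x \<noteq> 0 \<Longrightarrow> \<Phi> (axis 1 x) = axis 1 (1 / (of_real \<alpha> * x))"
proof -
  assume x: "x \<noteq> 0"
  have "\<Phi> (axis 1 x) $ 2 = v0 * cnj v0 / v0 - cnj v0"
    unfolding \<Phi>_nth axis_coords lform_scale v0_cnj[symmetric] using x nzl v0 by simp
  then have 2: "\<Phi> (axis 1 x) $ 2 = 0" using v0 by simp
  have "x2W (axis 1 x) = of_real \<alpha> * x\<^sup>2" unfolding x2W_def axis_coords x2_line ..
  then show ?thesis
    using x 2 by (simp add: vec_eq_iff forall_3 \<Phi>_nth(1,3) axis_nth power2_eq_square)
qed

lemma line_nonzero_forms:
  assumes "x \<noteq> 0"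
  shows "lform l1 (cx0 (axis 1 x)) (axis (1::3) x $ 1) \<noteq> 0" "lform l2 (cx0 (axis 1 x)) (axis (1::3) x $ 1) \<noteq> 0"
    "lform l3 (cx0 (axis 1 x)) (axis (1::3) x $ 1) \<noteq> 0" "lform l4 (cx0 (axis 1 x)) (axis (1::3) x $ 1) \<noteq> 0"
    "x2W (axis 1 x) \<noteq> 0"
  unfolding x2W_def axis_coords x2_line lform_scale using assms nzl \<alpha>0 by simp_all

lemma cdiff_forms: "cdiff (\<lambda>w. lform l (cx0 w) (w $ 1)) w"
  unfolding cx0_def by (intro cdiff_lform cdiff_add cdiff_mult cdiff_nth cdiff_const)

lemma cdiff_x2W: "w \<in> \<Omega>3 \<Longrightarrow> cdiff x2W w"
  using cdiff_coords(5) unfolding x2W_def[abs_def] .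

lemma holo_\<Phi>:
  assumes x: "x \<noteq> 0"
  shows "holo_at \<Phi> (axis 1 x)"
  unfolding holo_at_iff forall_3 \<Phi>_nth
  by (intro conjI cdiff_divide cdiff_diff cdiff_mult cdiff_forms cdiff_x2W axis_\<Omega> cdiff_nth cdiff_const cdiff_add)
    (use line_nonzero_forms[OF x] v0 in \<open>simp_all add: axis_nth\<close>)

text \<open>Along the second axis direction the slope stays \<open>lam\<close>, so the second
  component is \<open>|v0|^2 / (v0 + t) - cnj v0\<close> and the third is 0. Along the third
  direction the slope becomes \<open>lam + t / x\<close>, whence \<open>H'(lam) / (v0 x)\<close>,
  and the third component is \<open>t / x2\<close> with \<open>x2 = \<alpha> x^2\<close> at
  \<open>t = 0\<close>.\<close>

lemma jac_\<Phi>: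
  assumes x: "x \<noteq> 0"
  shows "cjacobian \<Phi> (axis 1 x) $ 2 $ 2 = - (cnj v0 / v0)" "cjacobian \<Phi> (axis 1 x) $ 2 $ 3 = D / v0 / x"
    "cjacobian \<Phi> (axis 1 x) $ 3 $ 2 = 0" "cjacobian \<Phi> (axis 1 x) $ 3 $ 3 = 1 / of_real \<alpha> / x\<^sup>2"
proof -
  let ?H = "\<lambda>t. lform l3 t 1 * lform l4 t 1 / (lform l1 t 1 * lform l2 t (1::complex))"
  have pt2: "(axis 1 x + t *s axis 2 1 :: complex ^ 3) $ 1 = x * 1" "(axis 1 x + t *s axis 2 1 :: complex ^ 3) $ 2 = t"
    "(axis 1 x + t *s axis 2 1 :: complex ^ 3) $ 3 = 0" "cx0 (axis 1 x + t *s axis 2 1) = x * of_real lam" for t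
    by (simp_all add: cx0_def axis_def)
  have pt3: "(axis 1 x + t *s axis 3 1 :: complex ^ 3) $ 1 = x * 1" "(axis 1 x + t *s axis 3 1 :: complex ^ 3) $ 2 = 0"
    "(axis 1 x + t *s axis 3 1 :: complex ^ 3) $ 3 = t" "cx0 (axis 1 x + t *s axis 3 1) = x * (of_real lam + t / x)" for t
    using x by (simp_all add: cx0_def axis_def algebra_simps)
  note entry = cjacobian_entry_eq[OF holo_\<Phi>[OF x]]
  have f22: "\<Phi> (axis 1 x + t *s axis 2 1) $ 2 = (v0 * cnj v0) / (v0 + t) - cnj v0" for t
    unfolding \<Phi>_nth pt2 lform_scale v0_cnj[symmetric] using x nzl by (simp add: divide_simps)
  have "((\<lambda>t. (v0 * cnj v0) / (v0 + t) - cnj v0) has_field_derivative - (cnj v0 / v0)) (at 0)"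
    using v0 by (auto intro!: derivative_eq_intros)
  then show "cjacobian \<Phi> (axis 1 x) $ 2 $ 2 = - (cnj v0 / v0)"
    by (intro entry) (simp add: f22)
  have f23: "\<Phi> (axis 1 x + t *s axis 3 1) $ 2 = ?H (of_real lam + t / x) / v0 - cnj v0" for t
    unfolding \<Phi>_nth pt3 lform_scale using x by simp
  have inner: "((\<lambda>t. of_real lam + t / x) has_field_derivative 1 / x) (at 0)"
    using x by (auto intro!: derivative_eq_intros)
  have "(?H has_field_derivative D) (at (of_real lam + 0 / x))" using D by simp
  from DERIV_chain2[OF this inner]
  have "((\<lambda>t. ?H (of_real lam + t / x) / v0 - cnj v0) has_field_derivative D / v0 / x) (at 0)"
    by (rule DERIV_cong[OF DERIV_diff[OF DERIV_cdivide DERIV_const]]) simp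
  then show "cjacobian \<Phi> (axis 1 x) $ 2 $ 3 = D / v0 / x"
    by (intro entry) (simp only: f23)
  have f32: "\<Phi> (axis 1 x + t *s axis 2 1) $ 3 = 0" for t unfolding \<Phi>_nth pt2 by simp
  show "cjacobian \<Phi> (axis 1 x) $ 3 $ 2 = 0"
    by (intro entry) (simp only: f32 DERIV_const)
  have f33: "\<Phi> (axis 1 x + t *s axis 3 1) $ 3 = t / x2W (axis 1 x + t *s axis 3 1)" for t
    unfolding \<Phi>_nth pt3 ..
  \<comment> \<open>Only the existence of this derivative matters: its contribution to the quotient
    rule is multiplied by the numerator, which is 0 at \<open>t = 0\<close>.\<close>
  obtain d where d: "((\<lambda>t. x2W (axis 1 x + t *s axis 3 1)) has_field_derivative d) (at 0)"
    using cdiff_line[OF cdiff_x2W[OF axis_\<Omega>(1)]] by blast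
  have x20: "x2W (axis 1 x + 0 *s axis 3 1) = of_real \<alpha> * x\<^sup>2"
    using x2_line(1)[of x] unfolding x2W_def pt3 by simp
  have "((\<lambda>t. t / x2W (axis 1 x + t *s axis 3 1)) has_field_derivative 1 / of_real \<alpha> / x\<^sup>2) (at 0)"
    by (rule DERIV_cong[OF DERIV_divide[OF DERIV_ident d]])
      (use x \<alpha>0 in \<open>simp_all only: x20, simp_all\<close>)
  then show "cjacobian \<Phi> (axis 1 x) $ 3 $ 3 = 1 / of_real \<alpha> / x\<^sup>2"
    by (intro entry) (simp only: f33)
qed

text \<open>The two ends of the curve lie over the two conjugate singular points, and each of these
  is outside one of the sets \<open>y2\<close> nonzero, \<open>y3\<close> nonzero. This gives the
  separation required by \<open>chart_pair\<close>.\<close>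

lemma G_inf: "\<mu> (G3 (axis 1 0)) = p_infty" "\<mu> (G2 (axis 1 0)) = p_infty_bar"
proof -
  have p: "ptF 0 0 v0 = p_infty"
    using x2_line[of 0] unfolding ptF_def p_infty_def by simp
  show "\<mu> (G3 (axis 1 0)) = p_infty"
    using G3_props(3)[OF axis_\<Omega>(1), of 0] unfolding axis_coords by (simp add: p)
  have "\<mu> (G2 (axis 1 0)) = real_structure (ptF 0 0 v0)"
    using \<mu>_G2(1)[OF axis_\<Omega>(2), of 0] by (simp add: cx0_def axis_nth)
  then show "\<mu> (G2 (axis 1 0)) = p_infty_bar"
    unfolding p p_infty_def p_infty_bar_def real_structure_o2_pt by simp
qed

lemma chart_pair_resolved:
  "chart_pair A G3 G2 \<Omega>3 \<Omega>2 \<Phi> (of_real \<alpha>) (- (cnj v0 / v0)) (D / v0) (1 / of_real \<alpha>)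
    (atlas_topology A closure_of {G3 (axis 1 x) |x. x \<noteq> 0})"
proof
  show "holo_atlas A" "Hausdorff_space (atlas_topology A)" "holo_param A \<Omega>3 G3" "holo_param A \<Omega>2 G2"
    by (rule holo_atlas_A Haus holo_param_G3 holo_param_G2)+
  show "axis 1 x \<in> \<Omega>3" "axis 1 x \<in> \<Omega>2" for x by (rule axis_\<Omega>)+
  show "complex_of_real \<alpha> \<noteq> 0" "- (cnj v0 / v0) \<noteq> 0" "1 / complex_of_real \<alpha> \<noteq> 0" using \<alpha>0 v0 by simp_all
  show "G3 (axis 1 x) = G2 (axis 1 (1 / (of_real \<alpha> * x)))" if "x \<noteq> 0" for x
    using glue_\<Phi>[OF axis_\<Omega>(1) line_nonzero_forms(5,1,2,3,4)[OF that]] \<Phi>_axis[OF that] by simp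
  show "G2 (axis 1 0) \<notin> G3 ` \<Omega>3"
  proof
    assume "G2 (axis 1 0) \<in> G3 ` \<Omega>3"
    then obtain w where w: "w \<in> \<Omega>3" "G2 (axis 1 0) = G3 w" by (elim imageE)
    have "\<mu> (G2 (axis 1 0)) \<in> range (o2_param 3)"
      unfolding w(2) using G3_props(1)[OF w(1)] unfolding W3_def by (elim CollectE conjE)
    then show False unfolding G_inf p_infty_bar_def range_o2_param by simp
  qed
  show "G3 (axis 1 0) \<notin> G2 ` \<Omega>2"
  proof
    assume "G3 (axis 1 0) \<in> G2 ` \<Omega>2"
    then obtain w where w: "w \<in> \<Omega>2" "G3 (axis 1 0) = G2 w" by (elim imageE)
    have "\<mu> (G2 w) \<in> range (o2_param 2)"
      unfolding \<mu>_G2(1)[OF w(1)] ptF_def real_structure_o2_pt range_o2_param by simp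
    then show False unfolding w(2)[symmetric] G_inf p_infty_def range_o2_param by simp
  qed
  show "\<forall>\<^sub>F w in nhds (axis 1 x). w \<in> \<Omega>3 \<and> \<Phi> w \<in> \<Omega>2 \<and> G3 w = G2 (\<Phi> w)" if x: "x \<noteq> 0" for x
  proof -
    note n = line_nonzero_forms[OF x]
    note ev = cdiff_eventually_nonzero[OF cdiff_forms n(1)] cdiff_eventually_nonzero[OF cdiff_forms n(2)]
      cdiff_eventually_nonzero[OF cdiff_forms n(3)] cdiff_eventually_nonzero[OF cdiff_forms n(4)]
      cdiff_eventually_nonzero[OF cdiff_x2W[OF axis_\<Omega>(1)] n(5)] eventually_nhds_in_open[OF open_\<Omega>3 axis_\<Omega>(1)]
    show ?thesis
      using ev by eventually_elim (use glue_\<Phi> in blast)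
  qed
qed (use jac_\<Phi> in simp_all)

text \<open>Off the two singular points \<open>y1\<close> is nonzero, and then so are
  \<open>y2\<close> and \<open>y3\<close> because \<open>\<alpha>\<close> is. Hence the points are
  parametrised by \<open>x = y1 / y3\<close> and lie where \<open>\<mu>\<close> is
  injective.\<close>

lemma curve_points:
  assumes "r = s * sqrt (ffun a b lam - (\<alpha> + qform Q lam 1)\<^sup>2)"
  shows "{p \<in> carrier_of A. \<mu> p \<in> L_image a b Q s lam \<alpha> - {p_infty, p_infty_bar}} = {G3 (axis 1 x) |x. x \<noteq> 0}"
proof (intro equalityI subsetI)
  have \<mu>G: "\<mu> (G3 (axis 1 x)) = o2_pt (hom4 (x * of_real lam) (x * 1) (of_real \<alpha> * x\<^sup>2) 1) (of_real r * x\<^sup>2)" for x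
    unfolding G3_props(3)[OF axis_\<Omega>(1)] axis_coords ptF_def x2_line ..
  have car: "G3 (axis 1 x) \<in> carrier_of A" for x using G3_props(1)[OF axis_\<Omega>(1)] unfolding W3_def by blast
  have n23: "\<mu> (G3 (axis 1 x)) \<in> range (o2_param 2)" "\<mu> (G3 (axis 1 x)) \<in> range (o2_param 3)" if "x \<noteq> 0" for x
    unfolding \<mu>G range_o2_param using that \<alpha>0 by simp_all
  have ninf: "p_infty \<notin> range (o2_param 2)" "p_infty_bar \<notin> range (o2_param 3)"
    unfolding p_infty_def p_infty_bar_def range_o2_param by simp_all
  {
    fix p assume "p \<in> {G3 (axis 1 x) |x. x \<noteq> 0}"
    then obtain x where x: "p = G3 (axis 1 x)" "x \<noteq> 0" by blast
    let ?y = "hom4 (x * of_real lam) (x * 1) (of_real \<alpha> * x\<^sup>2) 1"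
    have "?y \<noteq> 0" by (metis hom4_nth(4) zero_index zero_neq_one)
    then have "\<mu> p \<in> L_image a b Q s lam \<alpha>"
      unfolding L_image_def x(1) \<mu>G assms
      by (intro CollectI exI[of _ ?y] exI[of _ "of_real (s * sqrt (ffun a b lam - (\<alpha> + qform Q lam 1)\<^sup>2)) * x\<^sup>2"])
        (simp add: mult.commute)
    then show "p \<in> {p \<in> carrier_of A. \<mu> p \<in> L_image a b Q s lam \<alpha> - {p_infty, p_infty_bar}}"
      using car n23[OF x(2)] ninf unfolding x(1) by auto
  next
    fix p assume p: "p \<in> {p \<in> carrier_of A. \<mu> p \<in> L_image a b Q s lam \<alpha> - {p_infty, p_infty_bar}}"
    then obtain y z where y: "\<mu> p = o2_pt y z" "y \<noteq> 0" "y $ 0 = of_real lam * y $ 1"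
        "y $ 2 * y $ 3 = of_real \<alpha> * (y $ 1)\<^sup>2" "z = of_real r * (y $ 1)\<^sup>2"
      unfolding L_image_def assms by blast
    have pn: "\<mu> p \<noteq> p_infty" "\<mu> p \<noteq> p_infty_bar" "p \<in> carrier_of A" using p by blast+
    have y1: "y $ 1 \<noteq> 0"
    proof
      assume 0: "y $ 1 = 0"
      then have z0: "z = 0" "y $ 0 = 0" "y $ 2 = 0 \<or> y $ 3 = 0" using y by auto
      then consider "y $ 2 = 0" "y $ 3 \<noteq> 0" | "y $ 3 = 0" "y $ 2 \<noteq> 0"
        using y(2) 0 by (auto simp: vec_eq_iff all4)
      then show False
      proof cases
        case 1
        have "y = (y $ 3) *s hom4 0 0 0 1" using 0 z0 1 by (simp add: vec_eq_iff all4)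
        then have "\<mu> p = p_infty"
          unfolding y(1) p_infty_def using o2_pt_scale[OF 1(2), of "hom4 0 0 0 1" 0] z0 by simp
        then show False using pn by blast
      next
        case 2
        have "y = (y $ 2) *s hom4 0 0 1 0" using 0 z0 2 by (simp add: vec_eq_iff all4)
        then have "\<mu> p = p_infty_bar"
          unfolding y(1) p_infty_bar_def using o2_pt_scale[OF 2(2), of "hom4 0 0 1 0" 0] z0 by simp
        then show False using pn by blast
      qed
    qed
    then have y3: "y $ 3 \<noteq> 0" "y $ 2 \<noteq> 0" using y(4) \<alpha>0 by auto
    define x where "x = y $ 1 / y $ 3"
    have x: "x \<noteq> 0" unfolding x_def using y1 y3 by simp
    have "y = (y $ 3) *s hom4 (x * of_real lam) (x * 1) (of_real \<alpha> * x\<^sup>2) 1"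
      using y3 y(3,4) unfolding x_def by (simp add: vec_eq_iff all4 field_simps power2_eq_square)
    moreover have "z = (y $ 3)\<^sup>2 * (of_real r * x\<^sup>2)" using y3 unfolding x_def y(5) by (simp add: power_divide)
    ultimately have "\<mu> p = o2_pt ((y $ 3) *s hom4 (x * of_real lam) (x * 1) (of_real \<alpha> * x\<^sup>2) 1) ((y $ 3)\<^sup>2 * (of_real r * x\<^sup>2))"
      unfolding y(1) by simp
    then have "\<mu> p = \<mu> (G3 (axis 1 x))" unfolding \<mu>G o2_pt_scale[OF y3(1)] .
    then have "p = G3 (axis 1 x)" using n23[OF x] by (intro \<mu>_inj pn(3) car) simp_all
    then show "p \<in> {G3 (axis 1 x) |x. x \<noteq> 0}" using x by blast
  }
qed

end

section \<open>The fourth linear form, the function \<open>h2\<close>, and the conclusion\<close>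

lemma four_forms_fourth:
  assumes ab: "a > 0" "b > 0" and l: "{l1, l2, l3} \<subseteq> four_forms a b" "distinct [l1, l2, l3]"
  obtains l4 where "\<And>x0 x1 :: complex. lform l1 x0 x1 * lform l2 x0 x1 * lform l3 x0 x1 * lform l4 x0 x1 =
      x0 * x1 * (x0 + x1) * (of_real a * x0 - of_real b * x1)"
proof -
  \<comment> \<open>Positivity of \<open>a\<close> and \<open>b\<close> separates
    \<open>(a, - b)\<close> from the other three pairs, so exactly one form remains after the choice
    of three.\<close>
  have d: "distinct [(1, 0), (0, 1), (1, 1), (a, - b)]" using ab by auto
  have "card (four_forms a b - {l1, l2, l3}) = card (four_forms a b) - card {l1, l2, l3}"
    by (rule card_Diff_subset[OF _ l(1)]) simp
  also have "card (four_forms a b) = 4" using d unfolding four_forms_def by simp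
  also have "card {l1, l2, l3} = 3" using l(2) by simp
  finally obtain l4 where l4: "four_forms a b - {l1, l2, l3} = {l4}"
    by (auto simp: card_1_singleton_iff)
  have F: "four_forms a b = {l1, l2, l3, l4}" using l4 l(1) by blast
  have d4: "distinct [l1, l2, l3, l4]" using l(2) l4 by auto
  have "lform l1 x0 x1 * lform l2 x0 x1 * lform l3 x0 x1 * lform l4 x0 x1 =
      x0 * x1 * (x0 + x1) * (of_real a * x0 - of_real b * x1)" for x0 x1 :: complex
  proof -
    have "lform l1 x0 x1 * lform l2 x0 x1 * lform l3 x0 x1 * lform l4 x0 x1 = (\<Prod>l\<in>four_forms a b. lform l x0 x1)"
      unfolding F using d4 by (simp add: mult.assoc)
    also have "\<dots> = x0 * x1 * (x0 + x1) * (of_real a * x0 - of_real b * x1)"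
      unfolding four_forms_def using d by (simp add: lform_def mult.assoc)
    finally show ?thesis .
  qed
  then show ?thesis by (rule that)
qed

lemma ffun_pos:
  assumes "a > 0" "b > 0" "t \<in> {-1<..<0} \<union> {b / a<..}"
  shows "ffun a b t > 0"
  using assms(3)
proof
  assume t: "t \<in> {-1<..<0}"
  have "a * t < 0" using t assms(1) by (simp add: mult_pos_neg)
  then have "a * t - b < 0" using assms(2) by simp
  moreover have "t * (t + 1) < 0" using t by (simp add: mult_neg_pos)
  ultimately show ?thesis unfolding ffun_def by (rule mult_neg_neg[rotated])
next
  assume t: "t \<in> {b / a<..}"
  then have "a * t - b > 0" using assms(1) by (simp add: field_simps)
  moreover have "t > 0" using t assms by (auto intro: order.strict_trans[of 0 "b / a" t])
  ultimately show ?thesis unfolding ffun_def by simp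
qed

lemma DERIV_lform_real: "((\<lambda>t. lform l t (1::real)) has_field_derivative fst l) (at t)"
  unfolding lform_def by (auto intro!: derivative_eq_intros)

lemma DERIV_lform_complex: "((\<lambda>t. lform l t (1::complex)) has_field_derivative of_real (fst l)) (at t)"
  unfolding lform_def by (auto intro!: derivative_eq_intros)

text \<open>One number \<open>d\<close> serves as real and as complex derivative: the real one is
  compared with \<open>h2\<close>, the complex one enters the Jacobian.\<close>

lemma DERIV_lform_ratio:
  assumes "lform l1 t 1 \<noteq> 0" "lform l2 t 1 \<noteq> (0::real)"
  obtains d where
    "((\<lambda>t. lform l3 t 1 * lform l4 t 1 / (lform l1 t 1 * lform l2 t 1)) has_real_derivative d) (at t)"
    "((\<lambda>t. lform l3 t 1 * lform l4 t 1 / (lform l1 t 1 * lform l2 t 1)) has_field_derivative complex_of_real d)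
      (at (of_real t))"
proof -
  have M: "((\<lambda>t. lform l t 1 * lform l' t 1) has_real_derivative fst l * lform l' t 1 + fst l' * lform l t 1) (at t)"
    for l l' by (rule DERIV_mult[OF DERIV_lform_real DERIV_lform_real])
  have C: "((\<lambda>t. lform l t 1 * lform l' t 1) has_field_derivative
      of_real (fst l) * lform l' (of_real t) 1 + of_real (fst l') * lform l (of_real t) (1::complex)) (at (of_real t))"
    for l l' by (rule DERIV_mult[OF DERIV_lform_complex DERIV_lform_complex])
  have nz: "lform l1 t 1 * lform l2 t 1 \<noteq> 0" "lform l1 (of_real t) 1 * lform l2 (of_real t) (1::complex) \<noteq> 0"
    using assms by (simp_all add: lform_of_real)
  note DR = DERIV_divide[OF M[of l3 l4] M[of l1 l2] nz(1)]
  show ?thesis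
  proof (rule that[OF DR])
    show "((\<lambda>t. lform l3 t 1 * lform l4 t 1 / (lform l1 t 1 * lform l2 t 1)) has_field_derivative
      complex_of_real (((fst l3 * lform l4 t 1 + fst l4 * lform l3 t 1) * (lform l1 t 1 * lform l2 t 1) -
        lform l3 t 1 * lform l4 t 1 * (fst l1 * lform l2 t 1 + fst l2 * lform l1 t 1)) /
        (lform l1 t 1 * lform l2 t 1 * (lform l1 t 1 * lform l2 t 1)))) (at (of_real t))"
      by (rule DERIV_cong[OF DERIV_divide[OF C[of l3 l4] C[of l1 l2] nz(2)]])
        (simp add: lform_of_real)
  qed
qed

theorem proposition5p18:
  fixes a b lam0 lam \<alpha> :: real
    and Q :: "real \<times> real \<times> real"
    and l1 l2 l3 :: "real \<times> real"
    and A :: "('z, 3) atlas"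
    and \<mu> :: "'z \<Rightarrow> o2"
  assumes ab: "a > 0" "b > 0"
    and nonneg: "\<And>t::real. (qform Q t 1)\<^sup>2 - ffun a b t \<ge> 0"
    and equality: "\<And>t::real. (qform Q t 1)\<^sup>2 - ffun a b t = 0 \<longleftrightarrow> t = lam0"
    and double_root: "\<exists>D::real poly. (\<forall>t. poly D t = (qform Q t 1)\<^sup>2 - ffun a b t) \<and> order lam0 D = 2"
    and above: "\<And>t::real. ffun a b t \<ge> 0 \<Longrightarrow> t \<noteq> lam0 \<Longrightarrow> qform Q t 1 > sqrt (ffun a b t)"
    and lam0_gt: "lam0 > b / a"
    and forms: "{l1, l2, l3} \<subseteq> four_forms a b" "distinct [l1, l2, l3]"
    and resolution: "small_resolution a b Q lam0 l1 l2 l3 A \<mu>"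
    and lam_in: "lam \<in> {-1<..<0} \<union> {b / a<..}"
    and alpha: "\<alpha> \<noteq> 0"
      "- qform Q lam 1 - sqrt (ffun a b lam) \<le> \<alpha>" "\<alpha> \<le> - qform Q lam 1 + sqrt (ffun a b lam)"
  shows "(\<forall>t \<in> {-1<..<0} \<union> {b / a<..}. h2 a b l1 l2 differentiable (at t)) \<and>
    (\<forall>s \<in> {1, -1}. let L = L_curve a b Q A \<mu> s lam \<alpha> in
       (normal_bundle_iso_split A L (\<lambda>i. 1) \<or>
        normal_bundle_iso_split A L (\<lambda>i. if i = 1 then 0 else 2)) \<and>
       (normal_bundle_iso_split A L (\<lambda>i. if i = 1 then 0 else 2) \<longleftrightarrow>
        deriv (h2 a b l1 l2) lam = 0))"
proof -
  let ?I = "{-1<..<0} \<union> {b / a<..}"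
  obtain l4 where prod4: "\<And>x0 x1 :: complex. lform l1 x0 x1 * lform l2 x0 x1 * lform l3 x0 x1 * lform l4 x0 x1 =
      x0 * x1 * (x0 + x1) * (of_real a * x0 - of_real b * x1)"
    using four_forms_fourth[OF ab forms] by blast
  have prodf: "lform l1 t 1 * lform l2 t 1 * lform l3 t 1 * lform l4 t 1 = ffun a b t" for t :: real
  proof -
    have "complex_of_real (lform l1 t 1 * lform l2 t 1 * lform l3 t 1 * lform l4 t 1) = of_real (ffun a b t)"
      using prod4[of "of_real t" 1] by (simp add: lform_of_real ffun_def)
    then show ?thesis unfolding of_real_eq_iff .
  qed
  have fpos: "ffun a b t > 0" if "t \<in> ?I" for t by (rule ffun_pos[OF ab that])
  have nzl: "lform l1 t 1 \<noteq> 0" "lform l2 t 1 \<noteq> 0" "lform l3 t 1 \<noteq> 0" "lform l4 t 1 \<noteq> 0" if "t \<in> ?I" for t :: real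
    using fpos[OF that] prodf[of t] by auto
  \<comment> \<open>On the two intervals \<open>f\<close> is positive and no linear form vanishes,
    so the square root and the quotient are differentiable.\<close>
  have dh: "\<exists>d. (h2 a b l1 l2 has_real_derivative d) (at t)" if t: "t \<in> ?I" for t
  proof -
    have "(ffun a b has_real_derivative (t + 1 + t) * (a * t - b) + t * (t + 1) * a) (at t)"
      unfolding ffun_def[abs_def] by (auto intro!: derivative_eq_intros simp: algebra_simps)
    from DERIV_divide[OF DERIV_chain2[OF DERIV_real_sqrt[OF fpos[OF t]] this]
        DERIV_mult[OF DERIV_lform_real[of l1] DERIV_lform_real[of l2]]] nzl[OF t]
    show ?thesis unfolding h2_def[abs_def] by auto
  qed
  have diff: "\<forall>t \<in> ?I. h2 a b l1 l2 differentiable (at t)"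
    using dh unfolding real_differentiable_def by blast
  obtain Dr where Dr: "((\<lambda>t. lform l3 t 1 * lform l4 t 1 / (lform l1 t 1 * lform l2 t 1)) has_real_derivative Dr) (at lam)"
    "((\<lambda>t. lform l3 t 1 * lform l4 t 1 / (lform l1 t 1 * lform l2 t 1)) has_field_derivative complex_of_real Dr)
      (at (of_real lam))"
    using DERIV_lform_ratio[OF nzl(1,2)[OF lam_in]] by blast
  \<comment> \<open>Since \<open>f = l1 l2 l3 l4\<close>, the square of \<open>h2\<close> is
    \<open>H = l3 l4 / (l1 l2)\<close> near \<open>lam\<close>. Thus \<open>H' = 2 h2 h2'\<close>,
    and \<open>h2\<close> is nonzero at \<open>lam\<close>.\<close>
  have crit: "deriv (h2 a b l1 l2) lam = 0 \<longleftrightarrow> Dr = 0"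
  proof -
    obtain d where d: "(h2 a b l1 l2 has_real_derivative d) (at lam)" using dh[OF lam_in] ..
    have sq: "h2 a b l1 l2 t * h2 a b l1 l2 t = lform l3 t 1 * lform l4 t 1 / (lform l1 t 1 * lform l2 t 1)"
      if "t \<in> ?I" for t
    proof -
      have "h2 a b l1 l2 t * h2 a b l1 l2 t = ffun a b t / ((lform l1 t 1 * lform l2 t 1) * (lform l1 t 1 * lform l2 t 1))"
        using fpos[OF that] unfolding h2_def by simp
      then show ?thesis unfolding prodf[symmetric] using nzl[OF that] by simp
    qed
    have "((\<lambda>t. lform l3 t 1 * lform l4 t 1 / (lform l1 t 1 * lform l2 t 1)) has_real_derivative
        d * h2 a b l1 l2 lam + d * h2 a b l1 l2 lam) (at lam)"
      by (rule has_field_derivative_transform_within_open[OF DERIV_mult[OF d d] _ lam_in sq])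
        (auto intro!: open_Un)
    then have "Dr = 2 * d * h2 a b l1 l2 lam" using Dr(1) DERIV_unique by fastforce
    moreover have "h2 a b l1 l2 lam \<noteq> 0" using fpos[OF lam_in] nzl[OF lam_in] by (simp add: h2_def)
    moreover have "deriv (h2 a b l1 l2) lam = d" by (rule DERIV_imp_deriv[OF d])
    ultimately show ?thesis by simp
  qed
  obtain \<kappa> \<tau> where res: "complex_manifold A" "holo_map A O2 \<mu>"
    "holo_embedding (restrict_atlas A {p \<in> carrier_of A. \<mu> p \<in> - {p_infty, p_infty_bar, p_zero lam0}}) O2 \<mu>"
    "holo_embedding (restrict_atlas A {p \<in> carrier_of A. \<mu> p \<in> range (o2_param 3)})
      (prod_atlas (prod_atlas (prod_atlas O2 CP1) CP1) CP1) \<kappa>"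
    "\<kappa> ` carrier_of (restrict_atlas A {p \<in> carrier_of A. \<mu> p \<in> range (o2_param 3)}) = resolution_model a b Q l1 l2 l3"
    "\<forall>p\<in>carrier_of (restrict_atlas A {p \<in> carrier_of A. \<mu> p \<in> range (o2_param 3)}). fst (fst (fst (\<kappa> p))) = \<mu> p"
    "biholomorphic (conj_atlas (restrict_atlas A {p \<in> carrier_of A. \<mu> p \<in> range (o2_param 3)}))
      (restrict_atlas A {p \<in> carrier_of A. \<mu> p \<in> range (o2_param 2)}) \<tau>"
    "\<forall>p\<in>carrier_of (restrict_atlas A {p \<in> carrier_of A. \<mu> p \<in> range (o2_param 3)}). \<mu> (\<tau> p) = real_structure (\<mu> p)"
    using resolution unfolding small_resolution_def Let_def by (elim conjE exE) (rule that)
  define q where "q = qform Q lam 1"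
  \<comment> \<open>The two bounds on \<alpha> say that \<open>f - (\<alpha> + Q)^2\<close> is
    nonnegative, so \<open>r\<close> below is a genuine real square root and
    \<open>|g|^2 = f\<close>.\<close>
  have "\<bar>\<alpha> + q\<bar> \<le> sqrt (ffun a b lam)" using alpha(2,3) unfolding q_def by linarith
  then have "(\<alpha> + q)\<^sup>2 \<le> (sqrt (ffun a b lam))\<^sup>2" by (metis abs_ge_zero power2_abs power_mono)
  then have le: "(\<alpha> + q)\<^sup>2 \<le> ffun a b lam" using fpos[OF lam_in] by simp
  have main: "(normal_bundle_iso_split A (L_curve a b Q A \<mu> s lam \<alpha>) (\<lambda>i. 1) \<or>
        normal_bundle_iso_split A (L_curve a b Q A \<mu> s lam \<alpha>) (\<lambda>i. if i = 1 then 0 else 2)) \<and>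
       (normal_bundle_iso_split A (L_curve a b Q A \<mu> s lam \<alpha>) (\<lambda>i. if i = 1 then 0 else 2) \<longleftrightarrow>
        deriv (h2 a b l1 l2) lam = 0)" if s: "s \<in> {1, -1}" for s :: real
  proof -
    define r where "r = s * sqrt (ffun a b lam - (\<alpha> + q)\<^sup>2)"
    define g where "g = complex_of_real r + \<i> * of_real (\<alpha> + q)"
    define p1 p2 p3 p4 where "p1 = lform l1 (of_real lam) (1::complex)" and "p2 = lform l2 (of_real lam) (1::complex)"
      and "p3 = lform l3 (of_real lam) (1::complex)" and "p4 = lform l4 (of_real lam) (1::complex)"
    have pnz: "p1 \<noteq> 0" "p2 \<noteq> 0" "p3 \<noteq> 0" "p4 \<noteq> 0"
      unfolding p1_def p2_def p3_def p4_def lform_of_real using nzl[OF lam_in] by simp_all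
    have pf: "p1 * p2 * p3 * p4 = of_real (ffun a b lam)"
      unfolding p1_def p2_def p3_def p4_def lform_of_real prodf[symmetric] by simp
    have r2: "r\<^sup>2 = ffun a b lam - (\<alpha> + q)\<^sup>2"
      using s le unfolding r_def by (auto simp: power_mult_distrib)
    have "g * cnj g = of_real (r\<^sup>2 + (\<alpha> + q)\<^sup>2)"
      unfolding complex_mult_cnj g_def by simp
    then have gg: "g * cnj g = p1 * p2 * p3 * p4" unfolding r2 pf by simp
    then have g0: "g \<noteq> 0" using pnz by auto
    \<comment> \<open>\<open>g\<close> is \<xi> on the curve at \<open>x1 = 1\<close>, so this is
      the constant value of \<open>v = \<xi> / (l1 l2)\<close> there.\<close>
    define v0 where "v0 = g / (p1 * p2)"
    have v0g: "v0 * p1 * p2 = g" unfolding v0_def using pnz by simp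
    have v0: "v0 \<noteq> 0" unfolding v0_def using g0 pnz by simp
    have rd: "resolution_data a b lam l1 l2 l3 l4"
      by unfold_locales (use prod4 pnz in \<open>simp_all add: p1_def p2_def p3_def p4_def\<close>)
    have rs: "resolved a b lam Q l1 l2 l3 l4 A \<mu> lam0 \<kappa> \<tau> v0"
      unfolding resolved_def resolved_axioms_def using rd res v0 by blast
    have rc: "resolved_curve a b lam Q l1 l2 l3 l4 A \<mu> lam0 \<kappa> \<tau> v0 r \<alpha> (of_real Dr)"
      unfolding resolved_curve_def resolved_curve_axioms_def
      using rs alpha(1) v0g gg Dr(2) unfolding p1_def p2_def p3_def p4_def g_def q_def by simp
    note L = resolved_curve.curve_points[OF rc, of s, unfolded q_def[symmetric], OF r_def]
    note cp = resolved_curve.chart_pair_resolved[OF rc, folded L, folded L_curve_def]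
    have b: "complex_of_real Dr / v0 = 0 \<longleftrightarrow> deriv (h2 a b l1 l2) lam = 0"
      using crit v0 by simp
    show ?thesis
      using chart_pair.normal_split_1_1[OF cp] chart_pair.normal_split_0_2[OF cp]
        chart_pair.normal_split_0_2_imp[OF cp] b by blast
  qed
  show ?thesis unfolding Let_def using diff main by blast
qed

end
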